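(* Let $\Omega=(a,b)\times(c,d)\subset\mathbb{R}^2$, $\lambda\in\mathbb{R}\setminus\{0\}$, and let $u$ be a solution on $[0,T]$, with $0<T<T_{\max}$, of $$\mathrm{i}\,\partial_t u+\Delta u=\lambda u\ln(|u|^2)\ \text{ in }\Omega,\qquad u=0\ \text{ on }\partial\Omega,\qquad u(\cdot,0)=u_0,$$ satisfying $$u\in C^2([0,T];L^{\infty}(\Omega))\cap C^1([0,T];W^{2,\infty}(\Omega))\cap C^0([0,T];W^{4,\infty}(\Omega)\cap H^1_0(\Omega)).$$ Assume that the meshes satisfy $h\lesssim h_{\min}$, i.e. $h\le C\,h_{\min}$ with a constant $C$ independent of $\tau$ and $h$. Then there exist $h_0>0$ and $\tau_0>0$ sufficiently small such that, whenever $0<h\le h_0$ and $0<\tau\le\tau_0$, the solution $u^n$ of the BDF1 scheme $$\mathrm{i}\,\frac{u^{n+1}_{j,k}-u^n_{j,k}}{\tau}+\delta^2_{\nabla}u^{n+1}_{j,k}=2\lambda f(u^n_{j,k}),\quad 1\le j\le J-1,\ 1\le k\le K-1,\ n=0,1,\dots,N-1,$$ with $u^{n}\in X_h^0$ for all $n$ and $u^0_{j,k}=u_0(x_j,y_k)$, satisfies, with $e^n_{j,k}=u(x_j,y_k,t_n)-u^n_{j,k}$, $$\|e^n\|\le C_u(\tau+h^2),\qquad |e^n|_1\le C_u\,\tau^{-\frac12}(\tau+h^2),\qquad n=0,1,\dots,N,$$ where $C_u$ is a positive constant independent of $\tau$ and $h$, depending on the norms of $u$ in the regularity class above and on the parameters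 $|\lambda|$, $|\Omega|$ and $T$.
   Context: Here $f(z)=z\ln|z|$ for $z\in\mathbb{C}$, with $f(0)=0$ (so $\lambda u\ln(|u|^2)=2\lambda f(u)$). $T_{\max}$ is the maximal existence time of the solution $u$. Discretization: $\tau=T/N$ with $N$ a positive integer, $t_n=n\tau$; $h_x=(b-a)/J$, $h_y=(d-c)/K$ with $J,K$ positive integers; $h=\max\{h_x,h_y\}$, $h_{\min}=\min\{h_x,h_y\}$; $x_j=a+jh_x$, $y_k=c+kh_y$ for $0\le j\le J$, $0\le k\le K$. $X_h^0$ is the space of complex grid functions $(v_{j,k})_{0\le j\le J,\,0\le k\le K}$ that vanish at the boundary indices (those with $j\in\{0,J\}$ or $k\in\{0,K\}$). Finite differences: $\delta_x^+v_{j,k}=(v_{j+1,k}-v_{j,k})/h_x$, $\delta_y^+v_{j,k}=(v_{j,k+1}-v_{j,k})/h_y$, $\delta^2_{\nabla}v_{j,k}=\dfrac{v_{j+1,k}-2v_{j,k}+v_{j-1,k}}{h_x^2}+\dfrac{v_{j,k+1}-2v_{j,k}+v_{j,k-1}}{h_y^2}$. Norms on $X_h^0$: $\|v\|=\big(h_xh_y\sum_{j=1}^{J-1}\sum_{k=1}^{K-1}|v_{j,k}|^2\big)^{1/2}$ and $|v|_1=\big(h_xh_y\sum_{j=0}^{J-1}\sum_{k=0}^{K-1}(|\delta_x^+v_{j,k}|^2+|\delta_y^+v_{j,k}|^2)\big)^{1/2}$. *)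

theory Defs
  imports "HOL-Probability.Essential_Supremum"
begin

type_synonym cfun = "real \<times> real \<Rightarrow> complex"

text \<open>Function spaces are given by their members and their norm. Members are representatives of
  almost-everywhere classes: every space and norm below depends only on the class.\<close>

datatype fspace = FSpace (members: "cfun set") (fnorm: "cfun \<Rightarrow> real")

definition inter_space :: "fspace \<Rightarrow> fspace \<Rightarrow> fspace" where
  "inter_space X Y = FSpace (members X \<inter> members Y) (\<lambda>f. fnorm X f + fnorm Y f)"

definition Lp :: "(real \<times> real) set \<Rightarrow> ereal \<Rightarrow> fspace" where
  "Lp \<Omega> p = (if p = \<infinity>
     then FSpace {f \<in> borel_measurable (lebesgue_on \<Omega>).
                    esssup (lebesgue_on \<Omega>) (\<lambda>z. ereal (cmod (f z))) < \<infinity>}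
                 (\<lambda>f. real_of_ereal (esssup (lebesgue_on \<Omega>) (\<lambda>z. ereal (cmod (f z)))))
     else FSpace {f \<in> borel_measurable (lebesgue_on \<Omega>).
                    integrable (lebesgue_on \<Omega>) (\<lambda>z. cmod (f z) powr real_of_ereal p)}
                 (\<lambda>f. (\<integral>z. cmod (f z) powr real_of_ereal p \<partial>lebesgue_on \<Omega>)
                        powr (1 / real_of_ereal p)))"


subsection \<open>Sobolev spaces\<close>

definition pdx :: "cfun \<Rightarrow> cfun" where
  "pdx \<phi> = (\<lambda>(x, y). vector_derivative (\<lambda>s. \<phi> (s, y)) (at x))"

definition pdy :: "cfun \<Rightarrow> cfun" where
  "pdy \<phi> = (\<lambda>(x, y). vector_derivative (\<lambda>s. \<phi> (x, s)) (at y))"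

definition pd :: "nat \<Rightarrow> nat \<Rightarrow> cfun \<Rightarrow> cfun" where
  "pd i j \<phi> = (pdx ^^ i) ((pdy ^^ j) \<phi>)"

text \<open>Smooth complex functions with compact support in \<open>\<Omega>\<close>. Total differentiability of all iterated
  partial derivatives makes them continuous, so this is \<open>C\<^sup>\<infinity>\<close>, and the order of the partial
  derivatives does not matter.\<close>

definition test_functions :: "(real \<times> real) set \<Rightarrow> cfun set" where
  "test_functions \<Omega> = {\<phi>. (\<forall>i j z. pd i j \<phi> differentiable (at z)) \<and>
     (\<exists>K. compact K \<and> K \<subseteq> \<Omega> \<and> (\<forall>z. z \<notin> K \<longrightarrow> \<phi> z = 0))}"

definition locally_integrable :: "(real \<times> real) set \<Rightarrow> cfun \<Rightarrow> bool" where
  "locally_integrable \<Omega> f \<longleftrightarrow> (\<forall>K. compact K \<and> K \<subseteq> \<Omega> \<longrightarrow> set_integrable lebesgue K f)"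

definition is_weak_deriv :: "(real \<times> real) set \<Rightarrow> nat \<Rightarrow> nat \<Rightarrow> cfun \<Rightarrow> cfun \<Rightarrow> bool" where
  "is_weak_deriv \<Omega> i j f g \<longleftrightarrow> locally_integrable \<Omega> f \<and> locally_integrable \<Omega> g \<and>
     (\<forall>\<phi> \<in> test_functions \<Omega>.
        (\<integral>z. f z * pd i j \<phi> z \<partial>lebesgue_on \<Omega>)
          = (-1) ^ (i + j) * (\<integral>z. g z * \<phi> z \<partial>lebesgue_on \<Omega>))"

definition weak_deriv :: "(real \<times> real) set \<Rightarrow> nat \<Rightarrow> nat \<Rightarrow> cfun \<Rightarrow> cfun" where
  "weak_deriv \<Omega> i j f = (SOME g. is_weak_deriv \<Omega> i j f g)"

definition Sobolev :: "(real \<times> real) set \<Rightarrow> nat \<Rightarrow> ereal \<Rightarrow> fspace" where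
  "Sobolev \<Omega> k p = FSpace
     {f \<in> members (Lp \<Omega> p).
        \<forall>i j. i + j \<le> k \<longrightarrow> (\<exists>g \<in> members (Lp \<Omega> p). is_weak_deriv \<Omega> i j f g)}
     (\<lambda>f. \<Sum>i\<le>k. \<Sum>j\<le>k - i. fnorm (Lp \<Omega> p) (weak_deriv \<Omega> i j f))"

definition H10 :: "(real \<times> real) set \<Rightarrow> fspace" where
  "H10 \<Omega> = FSpace
     {f \<in> members (Sobolev \<Omega> 1 2).
        \<forall>\<epsilon>>0. \<exists>\<phi> \<in> test_functions \<Omega>. fnorm (Sobolev \<Omega> 1 2) (\<lambda>z. f z - \<phi> z) < \<epsilon>}
     (fnorm (Sobolev \<Omega> 1 2))"


subsection \<open>Continuously differentiable functions of time with values in a function space\<close>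

definition continuous_in_time :: "real \<Rightarrow> fspace \<Rightarrow> (real \<Rightarrow> cfun) \<Rightarrow> bool" where
  "continuous_in_time T X u \<longleftrightarrow> (\<forall>t\<in>{0..T}. u t \<in> members X \<and>
     ((\<lambda>s. fnorm X (\<lambda>z. u s z - u t z)) \<longlongrightarrow> 0) (at t within {0..T}))"

definition has_time_deriv ::
    "real \<Rightarrow> fspace \<Rightarrow> (real \<Rightarrow> cfun) \<Rightarrow> (real \<Rightarrow> cfun) \<Rightarrow> bool" where
  "has_time_deriv T X u u' \<longleftrightarrow> (\<forall>t\<in>{0..T}. u' t \<in> members X \<and>
     ((\<lambda>s. fnorm X (\<lambda>z. (u s z - u t z) / complex_of_real (s - t) - u' t z)) \<longlongrightarrow> 0)
       (at t within {0..T}))"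

definition time_deriv :: "real \<Rightarrow> fspace \<Rightarrow> (real \<Rightarrow> cfun) \<Rightarrow> real \<Rightarrow> cfun" where
  "time_deriv T X u = (SOME u'. has_time_deriv T X u u')"

definition C_time :: "nat \<Rightarrow> real \<Rightarrow> fspace \<Rightarrow> (real \<Rightarrow> cfun) \<Rightarrow> bool" where
  "C_time m T X u \<longleftrightarrow>
     (\<forall>i\<le>m. continuous_in_time T X ((time_deriv T X ^^ i) u)) \<and>
     (\<forall>i<m. \<exists>v. has_time_deriv T X ((time_deriv T X ^^ i) u) v)"

definition C_time_norm :: "nat \<Rightarrow> real \<Rightarrow> fspace \<Rightarrow> (real \<Rightarrow> cfun) \<Rightarrow> real" where
  "C_time_norm m T X u = (\<Sum>i\<le>m. SUP t\<in>{0..T}. fnorm X ((time_deriv T X ^^ i) u t))"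


subsection \<open>The logarithmic Schroedinger equation\<close>

text \<open>A solution on \<open>[0,S]\<close> is a strong one, in
  \<open>C\<^sup>1([0,S]; L\<^sup>2) \<inter> C\<^sup>0([0,S]; H\<^sup>2 \<inter> H\<^sup>1\<^sub>0)\<close>, satisfying the equation almost everywhere
  in \<open>\<Omega>\<close> at every time. In two dimensions \<open>H\<^sup>2\<close> functions on a rectangle are continuous up to the
  boundary, and each \<open>v t\<close> is required to be the continuous representative, so that
  boundary values and values at grid points make sense. With \<open>ln 0 = 0\<close> the nonlinearity vanishes
  at \<open>0\<close>.\<close>

definition log_schroedinger_solution ::
    "(real \<times> real) set \<Rightarrow> real \<Rightarrow> cfun \<Rightarrow> real \<Rightarrow> (real \<Rightarrow> cfun) \<Rightarrow> bool" where
  "log_schroedinger_solution \<Omega> lam u0 S v \<longleftrightarrow>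
     C_time 1 S (Lp \<Omega> 2) v \<and>
     C_time 0 S (inter_space (Sobolev \<Omega> 2 2) (H10 \<Omega>)) v \<and>
     (\<forall>t\<in>{0..S}. continuous_on (closure \<Omega>) (v t)) \<and>
     (\<forall>t\<in>{0..S}. AE z in lebesgue_on \<Omega>.
        \<i> * time_deriv S (Lp \<Omega> 2) v t z
          + (weak_deriv \<Omega> 2 0 (v t) z + weak_deriv \<Omega> 0 2 (v t) z)
          = complex_of_real lam * v t z * complex_of_real (ln ((cmod (v t z))\<^sup>2))) \<and>
     (\<forall>t\<in>{0..S}. \<forall>z\<in>frontier \<Omega>. v t z = 0) \<and>
     (\<forall>z\<in>closure \<Omega>. v 0 z = u0 z)"

definition max_existence_time :: "(real \<times> real) set \<Rightarrow> real \<Rightarrow> cfun \<Rightarrow> ereal" where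
  "max_existence_time \<Omega> lam u0 =
     Sup {ereal S | S. 0 < S \<and> (\<exists>v. log_schroedinger_solution \<Omega> lam u0 S v)}"


subsection \<open>The finite difference scheme\<close>

definition flog :: "complex \<Rightarrow> complex" where
  "flog z = z * complex_of_real (ln (cmod z))"

definition X0 :: "nat \<Rightarrow> nat \<Rightarrow> (nat \<Rightarrow> nat \<Rightarrow> complex) set" where
  "X0 J K = {v. \<forall>j\<le>J. \<forall>k\<le>K. j = 0 \<or> j = J \<or> k = 0 \<or> k = K \<longrightarrow> v j k = 0}"

definition dxp :: "real \<Rightarrow> (nat \<Rightarrow> nat \<Rightarrow> complex) \<Rightarrow> nat \<Rightarrow> nat \<Rightarrow> complex" where
  "dxp hx v j k = (v (j + 1) k - v j k) / complex_of_real hx"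

definition dyp :: "real \<Rightarrow> (nat \<Rightarrow> nat \<Rightarrow> complex) \<Rightarrow> nat \<Rightarrow> nat \<Rightarrow> complex" where
  "dyp hy v j k = (v j (k + 1) - v j k) / complex_of_real hy"

text \<open>Only used for \<open>j \<ge> 1\<close> and \<open>k \<ge> 1\<close>, where the subtraction on indices is not truncated.\<close>

definition lap_h ::
    "real \<Rightarrow> real \<Rightarrow> (nat \<Rightarrow> nat \<Rightarrow> complex) \<Rightarrow> nat \<Rightarrow> nat \<Rightarrow> complex" where
  "lap_h hx hy v j k =
     (v (j + 1) k - 2 * v j k + v (j - 1) k) / complex_of_real (hx\<^sup>2)
     + (v j (k + 1) - 2 * v j k + v j (k - 1)) / complex_of_real (hy\<^sup>2)"

definition norm_h ::
    "nat \<Rightarrow> nat \<Rightarrow> real \<Rightarrow> real \<Rightarrow> (nat \<Rightarrow> nat \<Rightarrow> complex) \<Rightarrow> real" where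
  "norm_h J K hx hy v =
     sqrt (hx * hy * (\<Sum>j=1..<J. \<Sum>k=1..<K. (cmod (v j k))\<^sup>2))"

definition seminorm1_h ::
    "nat \<Rightarrow> nat \<Rightarrow> real \<Rightarrow> real \<Rightarrow> (nat \<Rightarrow> nat \<Rightarrow> complex) \<Rightarrow> real" where
  "seminorm1_h J K hx hy v =
     sqrt (hx * hy * (\<Sum>j<J. \<Sum>k<K. (cmod (dxp hx v j k))\<^sup>2 + (cmod (dyp hy v j k))\<^sup>2))"

text \<open>\<open>uh n j k\<close> is the value at time level \<open>n\<close> and grid point \<open>(j, k)\<close>.\<close>

definition bdf1_solution ::
    "real \<Rightarrow> real \<Rightarrow> real \<Rightarrow> nat \<Rightarrow> nat \<Rightarrow> nat \<Rightarrow> real \<Rightarrow> real \<Rightarrow> real \<Rightarrow> cfun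
      \<Rightarrow> (nat \<Rightarrow> nat \<Rightarrow> nat \<Rightarrow> complex) \<Rightarrow> bool" where
  "bdf1_solution lam a c J K N hx hy \<tau> u0 uh \<longleftrightarrow>
     (\<forall>n\<le>N. uh n \<in> X0 J K) \<and>
     (\<forall>j\<le>J. \<forall>k\<le>K. uh 0 j k = u0 (a + real j * hx, c + real k * hy)) \<and>
     (\<forall>n<N. \<forall>j\<in>{1..<J}. \<forall>k\<in>{1..<K}.
        \<i> * ((uh (n + 1) j k - uh n j k) / complex_of_real \<tau>) + lap_h hx hy (uh (n + 1)) j k
          = 2 * complex_of_real lam * flog (uh n j k))"

end

theory Submission
  imports Defs
begin

text \<open>The error \<open>e\<^sup>n = u(t\<^sub>n) - u\<^sup>n\<close> solves the linear implicit scheme with right-hand side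
\<open>2 \<lambda> (f(u(t\<^sub>n)) - f(u\<^sup>n)) + \<xi>\<^sup>n\<close>, where \<open>\<xi>\<^sup>n\<close> is the truncation error. The proof bounds \<open>\<xi>\<^sup>n\<close> by a
constant times \<open>\<tau> + h\<^sup>2\<close> at every grid point and then runs an energy argument.

\<^emph>\<open>Consistency.\<close> Since \<open>f\<close> is not Lipschitz, \<open>f(u(t\<^sub>n\<^sub>+\<^sub>1)) - f(u(t\<^sub>n))\<close> is not visibly \<open>O(\<tau>)\<close>; but the
equation at time \<open>t\<^sub>n\<close> gives \<open>2 \<lambda> f(u(t\<^sub>n)) = i u\<^sub>t(t\<^sub>n) + \<Delta>u(t\<^sub>n)\<close>, so that only
\<open>(u(t\<^sub>n\<^sub>+\<^sub>1) - u(t\<^sub>n)) / \<tau> - u\<^sub>t(t\<^sub>n)\<close>, \<open>\<Delta>(u(t\<^sub>n\<^sub>+\<^sub>1) - u(t\<^sub>n))\<close> and the difference of \<open>\<delta>\<^sup>2\<close> and \<open>\<Delta>\<close> at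
\<open>u(t\<^sub>n\<^sub>+\<^sub>1)\<close> remain. They are controlled by the norms in \<open>C\<^sup>2(L\<^sup>\<infinity>)\<close>, \<open>C\<^sup>1(W\<^sup>2\<^sup>,\<^sup>\<infinity>)\<close> and
\<open>C\<^sup>0(W\<^sup>4\<^sup>,\<^sup>\<infinity>)\<close>. As the equation holds only almost everywhere and the derivatives are weak, all of this is
done after integration against a smooth bump \<open>\<phi>\<close> around the grid point: pairings with \<open>\<phi>\<close> are scalar
functions of time, and of the amount by which \<open>\<phi>\<close> is translated, and these are classically
differentiable with derivatives bounded by the Sobolev norms times the integral of \<open>\<phi>\<close>. Ordinary Taylor
expansion applies, and shrinking the bump recovers the point values of the continuous functions
involved (lemma \<open>consistency\<close>). Stencils that reach the boundary are obtained as limits of slightly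
shorter ones.

Weak derivatives are chosen arbitrarily in the definition of the Sobolev norms, so they have to be unique
almost everywhere; this is the fundamental lemma of the calculus of variations (\<open>testing_zero_AE\<close>).
The suprema over time in the norms have to be finite as well; for this the norms only need to satisfy a
triangle inequality up to a factor.

\<^emph>\<open>Stability.\<close> Testing the error equation with \<open>e\<^sup>n\<^sup>+\<^sup>1\<close> and taking imaginary parts gives the \<open>L\<^sup>2\<close>
estimate. The part of the nonlinear term paired with \<open>e\<^sup>n\<close> is harmless by the one-sided bound
\<open>flog_monotone\<close>. The part paired with \<open>e\<^sup>n\<^sup>+\<^sup>1 - e\<^sup>n\<close> is absorbed by the numerical dissipation of the
implicit step, at the price of \<open>\<tau> |f(u(t\<^sub>n)) - f(u\<^sup>n)|\<^sup>2\<close>. The factor \<open>\<tau>\<close> compensates the logarithmic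
singularity of \<open>f\<close> at the origin and leaves \<open>O(|e|\<^sup>2 + \<tau>\<^sup>2)\<close>, except for a term \<open>\<tau> |e|\<^sup>4\<close> that accounts for the
growth of \<open>f\<close> (\<open>scaled_flog_diff_bound\<close>). By the discrete Ladyzhenskaya inequality the sum of that term is at most a multiple of \<open>\<tau> |e\<^sup>n|\<^sub>1\<^sup>2 \<parallel>e\<^sup>n\<parallel>\<^sup>2\<close>, and
\<open>\<tau> |e\<^sup>n|\<^sub>1\<^sup>2 \<le> 1\<close> for small \<open>\<tau>\<close> and \<open>h\<close> by the \<open>H\<^sup>1\<close> bound of the theorem itself, which is carried along in the
induction on \<open>n\<close>. That bound in turn follows from the real part of the tested equation (\<open>stability\<close>).\<close>

section \<open>Smooth bumps\<close>

text \<open>The factor \<open>1 / x\<^sup>k\<close> is there so that derivatives stay in the family; \<open>flat 0\<close> is the usual smooth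
  function that vanishes to infinite order at the origin.\<close>

definition flat :: "nat \<Rightarrow> real \<Rightarrow> real" where
  "flat k x = (if x > 0 then inverse x ^ k * exp (- inverse x) else 0)"

lemma flat_over_x_tendsto: "((\<lambda>h. flat k h / h) \<longlongrightarrow> 0) (at 0)"
proof -
  have "((\<lambda>x::real. x ^ (k + 1) / exp x) \<longlongrightarrow> 0) at_top"
    by (rule tendsto_power_div_exp_0)
  then have "((\<lambda>h::real. inverse h ^ (k + 1) / exp (inverse h)) \<longlongrightarrow> 0) (at_right 0)"
    using filterlim_compose filterlim_inverse_at_top_right by blast
  moreover have "\<forall>\<^sub>F h in at_right 0. inverse h ^ (k + 1) / exp (inverse h) = flat k h / h"
    by (auto simp: eventually_at_filter flat_def exp_minus field_simps)
  ultimately have R: "((\<lambda>h. flat k h / h) \<longlongrightarrow> 0) (at_right 0)"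
    by (rule Lim_transform_eventually)
  have "((\<lambda>h. flat k h / h) \<longlongrightarrow> 0) (at_left 0)"
    by (rule tendsto_eventually) (auto simp: eventually_at_filter flat_def)
  with R show ?thesis
    using filterlim_split_at by blast
qed

lemma flat_has_derivative:
  "(flat k has_real_derivative flat (k + 2) x - real k * flat (k + 1) x) (at x)"
proof -
  consider "x > 0" | "x < 0" | "x = 0" by linarith
  then show ?thesis
  proof cases
    case 1
    have "((\<lambda>x. inverse x ^ k * exp (- inverse x)) has_real_derivative
        flat (k + 2) x - real k * flat (k + 1) x) (at x)"
      using 1 apply (auto intro!: derivative_eq_intros simp: flat_def)
      apply (cases k)
       apply (auto simp: field_simps power2_eq_square)
      done
    then show ?thesis
    proof (rule DERIV_cong_ev[THEN iffD1, rotated -1])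
      show "\<forall>\<^sub>F y in nhds x. inverse y ^ k * exp (- inverse y) = flat k y"
        using eventually_nhds_in_open[of "{0<..}" x] 1
        by (auto elim!: eventually_mono simp: flat_def)
    qed auto
  next
    case 2
    have "((\<lambda>x. 0) has_real_derivative flat (k + 2) x - real k * flat (k + 1) x) (at x)"
      using 2 by (auto simp: flat_def)
    then show ?thesis
    proof (rule DERIV_cong_ev[THEN iffD1, rotated -1])
      show "\<forall>\<^sub>F y in nhds x. 0 = flat k y"
        using eventually_nhds_in_open[of "{..<0}" x] 2
        by (auto elim!: eventually_mono simp: flat_def)
    qed auto
  next
    case 3
    then show ?thesis
      using flat_over_x_tendsto[of k] by (simp add: has_field_derivative_def[symmetric] DERIV_def)
       (simp add: flat_def DERIV_def)
  qed
qed

text \<open>The algebra generated by constants and affinely rescaled flat functions. Smoothness of its members comes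
for free: every generator has its derivative in the algebra, hence so does every member, and this can be iterated.\<close>

inductive flat_alg :: "(real \<Rightarrow> real) \<Rightarrow> bool" where
  flat: "flat_alg (\<lambda>x. flat k (p * x + q))"
| const: "flat_alg (\<lambda>x. c)"
| add: "flat_alg f \<Longrightarrow> flat_alg g \<Longrightarrow> flat_alg (\<lambda>x. f x + g x)"
| mult: "flat_alg f \<Longrightarrow> flat_alg g \<Longrightarrow> flat_alg (\<lambda>x. f x * g x)"

lemma flat_alg_closed:
  "flat_alg f \<Longrightarrow> \<exists>f'. flat_alg f' \<and> (\<forall>x. (f has_real_derivative f' x) (at x))"
proof (induction rule: flat_alg.induct)
  case (flat k p q)
  let ?f' = "\<lambda>x. p * (flat (k + 2) (p * x + q) + - real k * flat (k + 1) (p * x + q))"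
  have "flat_alg ?f'"
    by (intro flat_alg.intros)
  moreover have "((\<lambda>x. flat k (p * x + q)) has_real_derivative ?f' x) (at x)" for x
  proof -
    have "((\<lambda>x. p * x + q) has_real_derivative p) (at x)"
      by (auto intro!: derivative_eq_intros)
    from DERIV_chain2[OF flat_has_derivative this] show ?thesis
      by (simp add: algebra_simps)
  qed
  ultimately show ?case by blast
next
  case (const c)
  have "((\<lambda>x. c) has_real_derivative (\<lambda>x. 0) x) (at x)" for x by simp
  then show ?case using flat_alg.const by blast
next
  case (add f g)
  then obtain f' g' where "flat_alg f'" "\<And>x. (f has_real_derivative f' x) (at x)"
    "flat_alg g'" "\<And>x. (g has_real_derivative g' x) (at x)" by blast
  then show ?case
    by (intro exI[of _ "\<lambda>x. f' x + g' x"]) (auto intro: flat_alg.add intro!: derivative_intros)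
next
  case (mult f g)
  then obtain f' g' where *: "flat_alg f'" "\<And>x. (f has_real_derivative f' x) (at x)"
    "flat_alg g'" "\<And>x. (g has_real_derivative g' x) (at x)" by blast
  then have "flat_alg (\<lambda>x. f' x * g x + g' x * f x)"
    using mult by (intro flat_alg.add flat_alg.mult)
  with * show ?case
    by (intro exI[of _ "\<lambda>x. f' x * g x + g' x * f x"]) (auto intro!: DERIV_mult)
qed

lemma
  assumes "flat_alg f"
  shows flat_alg_deriv: "flat_alg (deriv f)"
    and flat_alg_has_derivative: "(f has_real_derivative deriv f x) (at x)"
proof -
  obtain f' where f': "flat_alg f'" "\<And>x. (f has_real_derivative f' x) (at x)"
    using flat_alg_closed[OF assms] by blast
  then have "deriv f = f'"
    by (auto intro: DERIV_imp_deriv)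
  with f' show "flat_alg (deriv f)" "(f has_real_derivative deriv f x) (at x)" by auto
qed

lemma flat_alg_deriv_funpow: "flat_alg f \<Longrightarrow> flat_alg ((deriv ^^ i) f)"
  by (induction i) (auto intro: flat_alg_deriv)

lemma flat_alg_continuous: "flat_alg f \<Longrightarrow> continuous_on S f"
  using flat_alg_has_derivative
  by (metis DERIV_continuous_on has_field_derivative_at_within)

lemma flat_alg_translate:
  "flat_alg f \<Longrightarrow> flat_alg (\<lambda>x. f (x - s))"
proof (induction rule: flat_alg.induct)
  case (flat k p q)
  have "(\<lambda>x. flat k (p * (x - s) + q)) = (\<lambda>x. flat k (p * x + (q - p * s)))"
    by (simp add: algebra_simps)
  then show ?case using flat_alg.flat by metis
qed (auto intro: flat_alg.intros)

lemma deriv_translate: "flat_alg f \<Longrightarrow> deriv (\<lambda>x. f (x - s)) = (\<lambda>x. deriv f (x - s))"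
proof
  fix x assume "flat_alg f"
  from flat_alg_has_derivative[OF this, of "x - s"]
  have "((\<lambda>x. f (x - s)) has_real_derivative deriv f (x - s)) (at x)"
    using DERIV_shift[of f "deriv f (x - s)" x "- s"] by simp
  then show "deriv (\<lambda>x. f (x - s)) x = deriv f (x - s)" by (rule DERIV_imp_deriv)
qed

lemma deriv_funpow_translate:
  "flat_alg f \<Longrightarrow> (deriv ^^ i) (\<lambda>x. f (x - s)) = (\<lambda>x. (deriv ^^ i) f (x - s))"
  by (induction i) (auto simp: deriv_translate flat_alg_deriv_funpow)

definition vanishes_off :: "real set \<Rightarrow> (real \<Rightarrow> real) \<Rightarrow> bool" where
  "vanishes_off S f \<longleftrightarrow> (\<forall>x. x \<notin> S \<longrightarrow> f x = 0)"

lemma vanishes_off_deriv: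
  assumes "vanishes_off S f" "closed S"
  shows "vanishes_off S (deriv f)"
  unfolding vanishes_off_def
proof safe
  fix x assume "x \<notin> S"
  have "((\<lambda>x. 0) has_real_derivative 0) (at x)" by simp
  moreover have "\<forall>\<^sub>F y in nhds x. 0 = f y"
    by (rule eventually_mono[OF eventually_nhds_in_open[of "- S" x]])
      (use assms \<open>x \<notin> S\<close> in \<open>auto simp: vanishes_off_def open_Compl\<close>)
  ultimately have "(f has_real_derivative 0) (at x)"
    using DERIV_cong_ev[of x x "\<lambda>x. 0" f 0 0] by simp
  then show "deriv f x = 0" by (rule DERIV_imp_deriv)
qed

lemma vanishes_off_deriv_funpow:
  "vanishes_off S f \<Longrightarrow> closed S \<Longrightarrow> vanishes_off S ((deriv ^^ i) f)"
  by (induction i) (auto intro: vanishes_off_deriv)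

lemma flat_alg_bounded:
  assumes "flat_alg f" "vanishes_off {\<alpha>..\<beta>} f"
  obtains B where "B \<ge> 0" "\<And>x. \<bar>f x\<bar> \<le> B"
proof -
  have "compact (f ` {\<alpha>..\<beta>})"
    by (intro compact_continuous_image flat_alg_continuous assms) auto
  then obtain B where B: "\<And>x. x \<in> {\<alpha>..\<beta>} \<Longrightarrow> \<bar>f x\<bar> \<le> B"
    by (metis (no_types, lifting) bounded_iff compact_imp_bounded image_eqI real_norm_def)
  then have "\<bar>f x\<bar> \<le> max B 0" for x
    using assms(2) B[of x] by (cases "x \<in> {\<alpha>..\<beta>}") (auto simp: vanishes_off_def le_max_iff_disj)
  then show ?thesis using that[of "max B 0"] by simp
qed

text \<open>Products of functions of one variable make all mixed partial derivatives explicit, whatever their order.\<close>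

definition tensor :: "(real \<Rightarrow> real) \<Rightarrow> (real \<Rightarrow> real) \<Rightarrow> cfun" where
  "tensor f g = (\<lambda>(x, y). complex_of_real (f x * g y))"

lemma pdx_tensor: "flat_alg f \<Longrightarrow> pdx (tensor f g) = tensor (deriv f) g"
proof (rule ext, clarify)
  fix x y assume f: "flat_alg f"
  have "((\<lambda>s. f s * g y) has_real_derivative deriv f x * g y) (at x)"
    by (intro DERIV_cmult_right flat_alg_has_derivative f)
  then have "((\<lambda>s. complex_of_real (f s * g y)) has_vector_derivative
      complex_of_real (deriv f x * g y)) (at x)"
    by (intro has_vector_derivative_of_real)
      (simp add: has_real_derivative_iff_has_vector_derivative)
  then show "pdx (tensor f g) (x, y) = tensor (deriv f) g (x, y)"
    by (simp add: pdx_def tensor_def vector_derivative_at)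
qed

lemma pdy_tensor: "flat_alg g \<Longrightarrow> pdy (tensor f g) = tensor f (deriv g)"
proof (rule ext, clarify)
  fix x y assume g: "flat_alg g"
  have "((\<lambda>s. f x * g s) has_real_derivative f x * deriv g y) (at y)"
    by (intro DERIV_cmult flat_alg_has_derivative g)
  then have "((\<lambda>s. complex_of_real (f x * g s)) has_vector_derivative
      complex_of_real (f x * deriv g y)) (at y)"
    by (intro has_vector_derivative_of_real)
      (simp add: has_real_derivative_iff_has_vector_derivative)
  then show "pdy (tensor f g) (x, y) = tensor f (deriv g) (x, y)"
    by (simp add: pdy_def tensor_def vector_derivative_at)
qed

lemma pd_tensor:
  assumes "flat_alg f" "flat_alg g"
  shows "pd i j (tensor f g) = tensor ((deriv ^^ i) f) ((deriv ^^ j) g)"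
proof -
  have 1: "(pdy ^^ j) (tensor f g) = tensor f ((deriv ^^ j) g)"
    using assms by (induction j) (auto simp: pdy_tensor flat_alg_deriv_funpow)
  have "(pdx ^^ i) (tensor f h) = tensor ((deriv ^^ i) f) h" for h
    using assms by (induction i) (auto simp: pdx_tensor flat_alg_deriv_funpow)
  with 1 show ?thesis by (simp add: pd_def)
qed

lemma tensor_differentiable:
  assumes "flat_alg f" "flat_alg g"
  shows "tensor f g differentiable (at z)"
proof -
  have fg: "f differentiable (at x)" "g differentiable (at x)" for x
    using assms[THEN flat_alg_has_derivative]
    by (meson has_field_derivative_imp_has_derivative differentiableI)+
  have "(f \<circ> fst) differentiable (at z)" "(g \<circ> snd) differentiable (at z)"
    by (intro differentiable_chain_at fg bounded_linear_imp_differentiable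
        bounded_linear_fst bounded_linear_snd)+
  then have "(\<lambda>z. f (fst z)) differentiable (at z)" "(\<lambda>z. g (snd z)) differentiable (at z)"
    by (simp_all add: o_def)
  then have "(\<lambda>z. f (fst z) * g (snd z)) differentiable (at z)"
    by (rule differentiable_mult)
  then have "(\<lambda>z. complex_of_real (f (fst z) * g (snd z))) differentiable (at z)"
    using differentiable_chain_at[of "\<lambda>z. f (fst z) * g (snd z)" z complex_of_real]
    by (simp add: o_def bounded_linear_imp_differentiable bounded_linear_of_real)
  then show ?thesis by (simp add: tensor_def case_prod_unfold)
qed

lemma tensor_test_function:
  assumes "flat_alg f" "flat_alg g" "vanishes_off {\<alpha>..\<beta>} f" "vanishes_off {\<gamma>..\<delta>} g"
    and "{\<alpha>..\<beta>} \<times> {\<gamma>..\<delta>} \<subseteq> \<Omega>"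
  shows "tensor f g \<in> test_functions \<Omega>"
  unfolding test_functions_def
proof (safe)
  show "pd i j (tensor f g) differentiable at (x, y)" for i j x y
    using assms by (simp add: pd_tensor tensor_differentiable flat_alg_deriv_funpow)
  show "\<exists>K. compact K \<and> K \<subseteq> \<Omega> \<and> (\<forall>z. z \<notin> K \<longrightarrow> tensor f g z = 0)"
    using assms by (intro exI[of _ "{\<alpha>..\<beta>} \<times> {\<gamma>..\<delta>}"])
      (auto simp: tensor_def vanishes_off_def intro!: compact_Times)
qed

text \<open>As the parameter \<open>n\<close> grows, the bumps converge boundedly to the indicator function of the interval between \<open>\<alpha>\<close>
and \<open>\<beta>\<close>, while their support stays in that interval. Dominated convergence thus leads directly from test functions to boxes.\<close>

definition bump :: "real \<Rightarrow> real \<Rightarrow> real \<Rightarrow> real \<Rightarrow> real" where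
  "bump n \<alpha> \<beta> x = flat 0 (n * (x - \<alpha>)) * flat 0 (n * (\<beta> - x))"

lemma bump_smooth: "flat_alg (bump n \<alpha> \<beta>)"
proof -
  have "bump n \<alpha> \<beta> = (\<lambda>x. flat 0 (n * x + (- n * \<alpha>)) * flat 0 (- n * x + n * \<beta>))"
    by (auto simp: bump_def algebra_simps)
  moreover have "flat_alg (\<lambda>x. flat 0 (n * x + (- n * \<alpha>)) * flat 0 (- n * x + n * \<beta>))"
    by (rule flat_alg.mult; rule flat_alg.flat)
  ultimately show ?thesis by (simp only:)
qed

lemma bump_nonneg: "0 \<le> bump n \<alpha> \<beta> x" and bump_le_1: "n > 0 \<Longrightarrow> bump n \<alpha> \<beta> x \<le> 1"
proof -
  have *: "0 \<le> flat 0 t" "flat 0 t \<le> 1" for t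
    by (auto simp: flat_def)
  then show "0 \<le> bump n \<alpha> \<beta> x" "bump n \<alpha> \<beta> x \<le> 1"
    by (auto simp: bump_def intro: mult_le_one)
qed

lemma bump_vanishes: "n > 0 \<Longrightarrow> vanishes_off {\<alpha>..\<beta>} (bump n \<alpha> \<beta>)"
  by (auto simp: vanishes_off_def bump_def flat_def zero_less_mult_iff)

lemma bump_pos: "n > 0 \<Longrightarrow> \<alpha> < x \<Longrightarrow> x < \<beta> \<Longrightarrow> 0 < bump n \<alpha> \<beta> x"
  by (auto simp: bump_def flat_def)

lemma bump_tendsto: "(\<lambda>n. bump (real (Suc n)) \<alpha> \<beta> x) \<longlonglongrightarrow> indicator {\<alpha><..<\<beta>} x"
proof (cases "x \<in> {\<alpha><..<\<beta>}")
  case True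
  have F: "(\<lambda>n. flat 0 (real (Suc n) * t)) \<longlonglongrightarrow> 1" if "t > 0" for t
  proof -
    have "(\<lambda>n. exp (- (inverse (real (Suc n)) * inverse t))) \<longlonglongrightarrow> exp (- (0 * inverse t))"
      by (intro tendsto_intros LIMSEQ_inverse_real_of_nat)
    then show ?thesis using that by (simp add: flat_def)
  qed
  have "(\<lambda>n. bump (real (Suc n)) \<alpha> \<beta> x) \<longlonglongrightarrow> 1 * 1"
    unfolding bump_def using True by (intro tendsto_mult F) auto
  then show ?thesis using True by simp
next
  case False
  then have "x - \<alpha> \<le> 0 \<or> \<beta> - x \<le> 0" by auto
  then have "bump (real (Suc n)) \<alpha> \<beta> x = 0" for n
    by (auto simp: bump_def flat_def zero_less_mult_iff)
  moreover have "indicator {\<alpha><..<\<beta>} x = (0::real)"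
    using False unfolding indicator_def by (simp only: if_False of_bool_eq)
  ultimately show ?thesis by (simp only: tendsto_const)
qed

section \<open>Functions are determined by their pairings with test functions\<close>

definition test_pair :: "(real \<times> real) set \<Rightarrow> (real \<Rightarrow> real) \<Rightarrow> (real \<Rightarrow> real) \<Rightarrow> bool" where
  "test_pair \<Omega> f g \<longleftrightarrow> flat_alg f \<and> flat_alg g \<and>
     (\<exists>\<alpha> \<beta> \<gamma> \<delta>. vanishes_off {\<alpha>..\<beta>} f \<and> vanishes_off {\<gamma>..\<delta>} g \<and> {\<alpha>..\<beta>} \<times> {\<gamma>..\<delta>} \<subseteq> \<Omega>)"

lemma test_pair_test_function: "test_pair \<Omega> f g \<Longrightarrow> tensor f g \<in> test_functions \<Omega>"
  unfolding test_pair_def using tensor_test_function by blast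

lemma continuous_on_tensor:
  assumes "flat_alg f" "flat_alg g"
  shows "continuous_on S (tensor f g)"
  unfolding tensor_def case_prod_unfold using assms
  by (intro continuous_intros continuous_on_compose2[OF flat_alg_continuous[of f UNIV]]
      continuous_on_compose2[OF flat_alg_continuous[of g UNIV]]) auto

lemma tensor_measurable [measurable]:
  assumes "test_pair \<Omega> f g"
  shows "tensor f g \<in> borel_measurable borel" "tensor f g \<in> borel_measurable lebesgue"
    "tensor f g \<in> borel_measurable (lebesgue_on S)"
proof -
  show 1: "tensor f g \<in> borel_measurable borel"
    using assms by (intro borel_measurable_continuous_onI continuous_on_tensor) (auto simp: test_pair_def)
  then show 2: "tensor f g \<in> borel_measurable lebesgue"
    by (intro measurable_completion) simp
  show "tensor f g \<in> borel_measurable (lebesgue_on S)"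
    by (rule measurable_restrict_space1[OF 2])
qed

lemma tensor_bounded:
  assumes "test_pair \<Omega> f g"
  obtains B where "B \<ge> 0" "\<And>z. cmod (tensor f g z) \<le> B"
proof -
  obtain B1 B2 where "B1 \<ge> 0" "\<And>x. \<bar>f x\<bar> \<le> B1" "B2 \<ge> 0" "\<And>x. \<bar>g x\<bar> \<le> B2"
    using assms flat_alg_bounded[of f] flat_alg_bounded[of g]
    unfolding test_pair_def by metis
  then show ?thesis
    by (intro that[of "B1 * B2"]) (auto simp: tensor_def norm_mult intro!: mult_mono)
qed

text \<open>The sets over which \<open>g\<close> integrates to zero form a Dynkin system, and boxes generate the Borel sets. A Borel
measurable version of \<open>g\<close> therefore has the same integrals as zero over all Borel sets.\<close>

lemma AE_zero_if_box_integrals_zero: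
  fixes g :: "'a::euclidean_space \<Rightarrow> real"
  assumes int: "integrable lebesgue g" and off: "\<And>z. z \<notin> box p q \<Longrightarrow> g z = 0"
    and zero: "\<And>c d. box c d \<subseteq> box p q \<Longrightarrow> (LINT z:box c d|lebesgue. g z) = 0"
  shows "AE z in lebesgue. g z = 0"
proof -
  obtain g' where g': "g' \<in> borel_measurable lborel" "AE z in lborel. g z = g' z"
    using completion_ex_borel_measurable_real borel_measurable_integrable[OF int] by blast
  have AE: "AE z in lebesgue. g z = g' z"
    by (rule AE_completion) (rule g')
  have int': "integrable lborel g'"
  proof -
    have "integrable lebesgue g'"
      using int AE g' by (subst integrable_cong_AE[where g = g])
        (auto intro: measurable_completion borel_measurable_integrable)
    then show ?thesis using g' by (simp add: integrable_completion)
  qed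
  have si: "set_integrable lebesgue A g" if "A \<in> sets lebesgue" for A
    using int that unfolding set_integrable_def by (rule integrable_mult_indicator[rotated])
  have tot: "(LINT z:UNIV|lebesgue. g z) = 0"
  proof -
    have "(LINT z:UNIV|lebesgue. g z) = (LINT z:box p q|lebesgue. g z)"
      unfolding set_lebesgue_integral_def
      by (intro Bochner_Integration.integral_cong) (use off in \<open>auto simp: indicator_def\<close>)
    then show ?thesis using zero by simp
  qed
  have leb: "A \<in> sets lebesgue" if "A \<in> sigma_sets UNIV (range (\<lambda>(a, b). box a b :: 'a set))" for A
  proof -
    have "A \<in> sets borel" using that by (subst borel_eq_box) simp
    then show ?thesis by (simp add: sets_completionI_sets)
  qed
  have all: "(LINT z:A|lebesgue. g z) = 0" if "A \<in> sets borel" for A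
  proof -
    have "Int_stable (range (\<lambda>(a, b). box a b :: 'a set))"
      by (auto simp: Int_stable_def box_Int_box)
    moreover have "range (\<lambda>(a, b). box a b :: 'a set) \<subseteq> Pow UNIV" by simp
    moreover have "A \<in> sigma_sets UNIV (range (\<lambda>(a, b). box a b :: 'a set))"
      using that by (simp add: borel_eq_box)
    ultimately show ?thesis
    proof (induction rule: sigma_sets_induct_disjoint[consumes 3])
      case (basic A)
      then obtain c d where A: "A = box c d" by auto
      obtain c' d' where "box c d \<inter> box p q = box c' d'"
        using box_Int_box by blast
      moreover have "(LINT z:A|lebesgue. g z) = (LINT z:box c d \<inter> box p q|lebesgue. g z)"
        unfolding set_lebesgue_integral_def A
        by (intro Bochner_Integration.integral_cong) (use off in \<open>auto simp: indicator_def\<close>)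
      ultimately show ?case using zero[of c' d'] by auto
    next
      case empty
      show ?case by (simp add: set_lebesgue_integral_def)
    next
      case (compl A)
      then have A: "A \<in> sets lebesgue" by (intro leb)
      have "(LINT z:A \<union> (UNIV - A)|lebesgue. g z)
          = (LINT z:A|lebesgue. g z) + (LINT z:UNIV - A|lebesgue. g z)"
        using A by (intro set_integral_Un si) auto
      then show ?case using compl tot by simp
    next
      case (union A)
      then have A: "A i \<in> sets lebesgue" for i
        by (intro leb) auto
      have "(LINT z:(\<Union>i. A i)|lebesgue. g z) = (\<Sum>i. LINT z:A i|lebesgue. g z)"
        using A union(1) by (intro lebesgue_integral_countable_add si) (auto simp: disjoint_family_on_def)
      then show ?case using union by simp
    qed
  qed
  have "AE z in lborel. g' z = 0"
  proof (rule density_unique_real)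
    fix A :: "'a set" assume A: "A \<in> sets lborel"
    have "(LINT z:A|lborel. g' z) = (LINT z:A|lebesgue. g' z)"
      unfolding set_lebesgue_integral_def using A g'
      by (subst integral_completion) auto
    also have "\<dots> = (LINT z:A|lebesgue. g z)"
      unfolding set_lebesgue_integral_def
    proof (rule integral_cong_AE)
      have A': "A \<in> sets lebesgue" using A by (simp add: sets_completionI_sets)
      have "g' \<in> borel_measurable lebesgue" using g'(1) by (intro measurable_completion) simp
      then show "(\<lambda>z. indicator A z *\<^sub>R g' z) \<in> borel_measurable lebesgue"
        using A' by (intro borel_measurable_scaleR borel_measurable_indicator)
      show "(\<lambda>z. indicator A z *\<^sub>R g z) \<in> borel_measurable lebesgue"
        using A' int by (intro borel_measurable_scaleR borel_measurable_indicator borel_measurable_integrable)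
    qed (use AE in auto)
    also have "\<dots> = 0" using all A by simp
    finally show "(LINT z:A|lborel. g' z) = (LINT z:A|lborel. 0)" by simp
  qed (use int' in auto)
  then have "AE z in lebesgue. g' z = 0" by (rule AE_completion)
  with AE show ?thesis by auto
qed

lemma AE_zero_if_box_integrals_zero_complex:
  fixes g :: "'a::euclidean_space \<Rightarrow> complex"
  assumes int: "integrable lebesgue g" and off: "\<And>z. z \<notin> box p q \<Longrightarrow> g z = 0"
    and zero: "\<And>c d. box c d \<subseteq> box p q \<Longrightarrow> (LINT z:box c d|lebesgue. g z) = 0"
  shows "AE z in lebesgue. g z = 0"
proof -
  have i: "integrable lebesgue (\<lambda>z. indicator (box c d) z *\<^sub>R g z)" for c d
    using int by (rule integrable_mult_indicator[rotated]) auto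
  have "(LINT z:box c d|lebesgue. Re (g z)) = 0" "(LINT z:box c d|lebesgue. Im (g z)) = 0"
    if "box c d \<subseteq> box p q" for c d
    using zero[OF that] integral_Re[OF i, of c d] integral_Im[OF i, of c d]
    by (simp_all add: set_lebesgue_integral_def)
  then have "AE z in lebesgue. Re (g z) = 0" "AE z in lebesgue. Im (g z) = 0"
    using off by (auto intro!: AE_zero_if_box_integrals_zero[of _ p q] integrable_Re[OF int] integrable_Im[OF int])
  then show ?thesis by eventually_elim (simp add: complex_eq_iff)
qed

text \<open>Dominated convergence along products of bumps that converge to the indicator function of the box.\<close>

lemma box_integral_zero_if_test_integrals_zero:
  fixes u :: cfun
  assumes u: "locally_integrable \<Omega> u" and \<Omega>: "\<Omega> \<in> sets lebesgue"
    and sub: "{\<alpha>..\<beta>} \<times> {\<gamma>..\<delta>} \<subseteq> \<Omega>"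
    and zero: "\<And>\<phi>. \<phi> \<in> test_functions \<Omega> \<Longrightarrow> (LINT z|lebesgue_on \<Omega>. u z * \<phi> z) = 0"
  shows "(LINT z:{\<alpha><..<\<beta>} \<times> {\<gamma><..<\<delta>}|lebesgue. u z) = 0"
proof -
  define K where "K = {\<alpha>..\<beta>} \<times> {\<gamma>..\<delta>}"
  have K: "compact K" "K \<subseteq> \<Omega>" using sub by (auto simp: K_def compact_Times)
  \<comment> \<open>the bumps have the same support for every n, so that the indicator of K can be inserted\<close>
  define \<phi> where "\<phi> n = tensor (bump (real (Suc n)) \<alpha> \<beta>) (bump (real (Suc n)) \<gamma> \<delta>)" for n
  have tp: "test_pair \<Omega> (bump (real (Suc n)) \<alpha> \<beta>) (bump (real (Suc n)) \<gamma> \<delta>)" for n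
    unfolding test_pair_def using sub bump_smooth bump_vanishes by (metis of_nat_0_less_iff zero_less_Suc)
  have off: "\<phi> n z = 0" if "z \<notin> K" for n z
    using that bump_vanishes[of "real (Suc n)"]
    by (cases z) (auto simp: \<phi>_def tensor_def K_def vanishes_off_def)
  have i: "integrable lebesgue (\<lambda>z. indicator K z *\<^sub>R u z)"
    using u K unfolding locally_integrable_def set_integrable_def by auto
  have mK: "indicator K \<in> borel_measurable lebesgue" using K(1) by (intro borel_measurable_indicator lmeasurable_compact fmeasurableD)
  have "(\<lambda>n. LINT z|lebesgue. (indicator K z *\<^sub>R u z) * \<phi> n z)
      \<longlonglongrightarrow> (LINT z|lebesgue. indicator ({\<alpha><..<\<beta>} \<times> {\<gamma><..<\<delta>}) z *\<^sub>R u z)"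
  proof (rule integral_dominated_convergence[where w = "\<lambda>z. norm (indicator K z *\<^sub>R u z)"])
    show "integrable lebesgue (\<lambda>z. norm (indicator K z *\<^sub>R u z))"
      using i by (rule integrable_norm)
    show "(\<lambda>z. (indicator K z *\<^sub>R u z) * \<phi> n z) \<in> borel_measurable lebesgue" for n
      using borel_measurable_integrable[OF i] tensor_measurable(2)[OF tp[of n]]
      unfolding \<phi>_def by (rule borel_measurable_times)
    have "norm (\<phi> n z) \<le> 1" for n z
      unfolding \<phi>_def tensor_def case_prod_unfold norm_of_real
      using bump_nonneg bump_le_1[of "real (Suc n)"] by (auto simp: abs_mult intro!: mult_le_one)
    then show "AE z in lebesgue. norm ((indicator K z *\<^sub>R u z) * \<phi> n z) \<le> norm (indicator K z *\<^sub>R u z)" for n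
      unfolding norm_mult by (intro AE_I2 mult_right_le_one_le) auto
    have "(\<lambda>n. (indicator K z *\<^sub>R u z) * \<phi> n z) \<longlonglongrightarrow> indicator ({\<alpha><..<\<beta>} \<times> {\<gamma><..<\<delta>}) z *\<^sub>R u z" for z
    proof -
      have "(\<lambda>n. complex_of_real (bump (real (Suc n)) \<alpha> \<beta> (fst z) * bump (real (Suc n)) \<gamma> \<delta> (snd z)))
          \<longlonglongrightarrow> complex_of_real (indicator {\<alpha><..<\<beta>} (fst z) * indicator {\<gamma><..<\<delta>} (snd z))"
        by (intro tendsto_of_real tendsto_mult bump_tendsto)
      then have "(\<lambda>n. (indicator K z *\<^sub>R u z) * \<phi> n z) \<longlonglongrightarrow> (indicator K z *\<^sub>R u z) *
          complex_of_real (indicator {\<alpha><..<\<beta>} (fst z) * indicator {\<gamma><..<\<delta>} (snd z))"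
        unfolding \<phi>_def tensor_def case_prod_unfold by (intro tendsto_mult tendsto_const)
      also have "(indicator K z *\<^sub>R u z) *
          complex_of_real (indicator {\<alpha><..<\<beta>} (fst z) * indicator {\<gamma><..<\<delta>} (snd z))
          = indicator ({\<alpha><..<\<beta>} \<times> {\<gamma><..<\<delta>}) z *\<^sub>R u z"
        by (cases z) (auto simp: indicator_def K_def)
      finally show ?thesis .
    qed
    then show "AE z in lebesgue. (\<lambda>n. (indicator K z *\<^sub>R u z) * \<phi> n z)
        \<longlonglongrightarrow> indicator ({\<alpha><..<\<beta>} \<times> {\<gamma><..<\<delta>}) z *\<^sub>R u z" by simp
    show "(\<lambda>z. indicator ({\<alpha><..<\<beta>} \<times> {\<gamma><..<\<delta>}) z *\<^sub>R u z) \<in> borel_measurable lebesgue"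
    proof -
      have "open ({\<alpha><..<\<beta>} \<times> {\<gamma><..<\<delta>})" by (intro open_Times) auto
      then have "indicat_real ({\<alpha><..<\<beta>} \<times> {\<gamma><..<\<delta>}) \<in> borel_measurable lebesgue"
        by (intro borel_measurable_indicator) auto
      from borel_measurable_scaleR[OF this borel_measurable_integrable[OF i]]
      show ?thesis
        by (rule measurable_cong[THEN iffD1, rotated]) (auto simp: K_def indicator_def)
    qed
  qed
  moreover have "(LINT z|lebesgue. (indicator K z *\<^sub>R u z) * \<phi> n z) = 0" for n
  proof -
    have "(\<lambda>z. (indicator K z *\<^sub>R u z) * \<phi> n z) = (\<lambda>z. indicator \<Omega> z *\<^sub>R (u z * \<phi> n z))"
      using off K by (auto simp: indicator_def fun_eq_iff)
    then show ?thesis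
      using zero[OF test_pair_test_function[OF tp[of n]]] \<Omega>
      by (simp add: integral_restrict_space \<phi>_def)
  qed
  ultimately show ?thesis
    unfolding set_lebesgue_integral_def by (simp add: LIMSEQ_const_iff)
qed

lemma pdx_vanishes:
  assumes "\<And>z. z \<notin> K \<Longrightarrow> \<phi> z = 0" "closed K" "z \<notin> K"
  shows "pdx \<phi> z = 0"
proof (cases z)
  case (Pair x y)
  have o: "open ((\<lambda>s. (s, y)) -` (- K))"
    using assms(2) by (intro open_vimage continuous_intros) auto
  have "((\<lambda>s. 0) has_vector_derivative 0) (at x)" by simp
  then have "((\<lambda>s. \<phi> (s, y)) has_vector_derivative 0) (at x)"
  proof (rule has_vector_derivative_transform_within_open[OF _ o])
    show "x \<in> (\<lambda>s. (s, y)) -` (- K)" using assms(3) Pair by simp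
    show "0 = \<phi> (s, y)" if "s \<in> (\<lambda>s. (s, y)) -` (- K)" for s
      using assms(1)[of "(s, y)"] that by simp
  qed
  then show ?thesis by (simp add: pdx_def Pair vector_derivative_at)
qed

lemma pdy_vanishes:
  assumes "\<And>z. z \<notin> K \<Longrightarrow> \<phi> z = 0" "closed K" "z \<notin> K"
  shows "pdy \<phi> z = 0"
proof (cases z)
  case (Pair x y)
  have o: "open ((\<lambda>s. (x, s)) -` (- K))"
    using assms(2) by (intro open_vimage continuous_intros) auto
  have "((\<lambda>s. 0) has_vector_derivative 0) (at y)" by simp
  then have "((\<lambda>s. \<phi> (x, s)) has_vector_derivative 0) (at y)"
  proof (rule has_vector_derivative_transform_within_open[OF _ o])
    show "y \<in> (\<lambda>s. (x, s)) -` (- K)" using assms(3) Pair by simp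
    show "0 = \<phi> (x, s)" if "s \<in> (\<lambda>s. (x, s)) -` (- K)" for s
      using assms(1)[of "(x, s)"] that by simp
  qed
  then show ?thesis by (simp add: pdy_def Pair vector_derivative_at)
qed

lemma pd_vanishes:
  assumes "\<And>z. z \<notin> K \<Longrightarrow> \<phi> z = 0" "closed K" "z \<notin> K"
  shows "pd i j \<phi> z = 0"
proof -
  have "\<And>z. z \<notin> K \<Longrightarrow> (pdy ^^ j) \<phi> z = 0"
    using assms(1) by (induction j) (auto intro: pdy_vanishes[OF _ assms(2)])
  then have "\<And>z. z \<notin> K \<Longrightarrow> (pdx ^^ i) ((pdy ^^ j) \<phi>) z = 0"
    by (induction i) (auto intro: pdx_vanishes[OF _ assms(2)])
  then show ?thesis using assms(3) by (simp add: pd_def)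
qed

lemma pd_0: "pd 0 0 \<phi> = \<phi>"
  by (simp add: pd_def)

lemma bounded_if_compact_support:
  fixes \<psi> :: cfun
  assumes c: "continuous_on UNIV \<psi>" and K: "compact K" and off: "\<And>z. z \<notin> K \<Longrightarrow> \<psi> z = 0"
  shows "\<exists>B\<ge>0. \<forall>z. cmod (\<psi> z) \<le> B"
proof -
  have "bounded (\<psi> ` K)" using K continuous_on_subset[OF c]
    by (intro compact_imp_bounded compact_continuous_image) auto
  then obtain B where "B > 0" "\<And>z. z \<in> K \<Longrightarrow> cmod (\<psi> z) \<le> B"
    unfolding bounded_pos by auto
  then have "cmod (\<psi> z) \<le> B" for z using off[of z] by (cases "z \<in> K") auto
  then show ?thesis using \<open>B > 0\<close> by (intro exI[of _ B]) simp
qed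

lemma test_function_bounded:
  assumes \<phi>: "\<phi> \<in> test_functions \<Omega>"
  shows "\<exists>B\<ge>0. \<forall>z. cmod (\<phi> z) \<le> B"
proof -
  obtain K where K: "compact K" "\<And>z. z \<notin> K \<Longrightarrow> \<phi> z = 0"
    and d: "\<And>i j z. pd i j \<phi> differentiable (at z)"
    using \<phi> unfolding test_functions_def by blast
  have "continuous_on UNIV (pd 0 0 \<phi>)"
    using d by (meson differentiable_imp_continuous_within continuous_at_imp_continuous_on)
  then have "continuous_on UNIV \<phi>" by (simp only: pd_0)
  from bounded_if_compact_support[OF this K] show ?thesis .
qed

locale rectangle =
  fixes a b c d :: real and \<Omega> :: "(real \<times> real) set"
  assumes ab: "a < b" and cd: "c < d" and \<Omega>_eq: "\<Omega> = {a<..<b} \<times> {c<..<d}"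
begin

abbreviation Leb where "Leb \<equiv> lebesgue_on \<Omega>"

abbreviation pairing :: "cfun \<Rightarrow> cfun \<Rightarrow> complex" where
  "pairing f \<phi> \<equiv> LINT z|Leb. f z * \<phi> z"

lemma open_\<Omega>: "open \<Omega>"
  unfolding \<Omega>_eq by (intro open_Times) auto

lemma \<Omega>_box: "\<Omega> = box (a, c) (b, d)"
  unfolding \<Omega>_eq by (auto simp: box_def Basis_prod_def)

lemma closure_\<Omega>: "closure \<Omega> = {a..b} \<times> {c..d}"
  unfolding \<Omega>_eq using ab cd by (simp add: closure_Times)

lemma \<Omega>_lmeasurable [simp]: "\<Omega> \<in> lmeasurable"
  unfolding \<Omega>_box by simp

lemma \<Omega>_sets [simp]: "\<Omega> \<in> sets lebesgue"
  by (rule fmeasurableD) simp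

sublocale finite_measure "Leb"
  by (rule finite_measure_lebesgue_on) simp

lemma measure_\<Omega>: "measure lebesgue \<Omega> = (b - a) * (d - c)"
proof -
  have "measure lebesgue \<Omega> = measure lborel (cbox (a, c) (b, d))"
    by (simp add: \<Omega>_box measure_lborel_box_eq measure_lborel_cbox_eq)
  then show ?thesis using ab cd by (simp add: content_Pair)
qed

lemma \<Omega>_not_null: "emeasure Leb (space Leb) \<noteq> 0"
proof -
  have "measure lebesgue \<Omega> > 0" using ab cd by (simp add: measure_\<Omega>)
  then have "emeasure lebesgue \<Omega> \<noteq> 0" unfolding measure_def by (intro notI) simp
  then show ?thesis by (simp add: emeasure_restrict_space)
qed

text \<open>Smaller boxes whose closures lie in the rectangle: local integrability says something only about compact subsets.\<close>

definition inset :: "nat \<Rightarrow> (real \<times> real) set" where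
  "inset n = {a + 1 / real (Suc n)<..<b - 1 / real (Suc n)} \<times> {c + 1 / real (Suc n)<..<d - 1 / real (Suc n)}"

abbreviation "inset_lo n \<equiv> (a + 1 / real (Suc n), c + 1 / real (Suc n))"
abbreviation "inset_hi n \<equiv> (b - 1 / real (Suc n), d - 1 / real (Suc n))"

lemma inset_box: "inset n = box (inset_lo n) (inset_hi n)"
  unfolding inset_def by (auto simp: box_def Basis_prod_def)

lemma closure_inset:
  "cbox (inset_lo n) (inset_hi n) \<subseteq> \<Omega>"
proof -
  define t where "t = 1 / real (Suc n)"
  have "t > 0" by (simp add: t_def)
  then show ?thesis unfolding \<Omega>_eq cbox_Pair_eq t_def[symmetric] by auto
qed

lemma inset_subset: "inset n \<subseteq> \<Omega>"
  using closure_inset[of n] box_subset_cbox unfolding inset_box by blast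

lemma inset_exhaust:
  assumes "z \<in> \<Omega>"
  obtains m where "\<And>n. n \<ge> m \<Longrightarrow> z \<in> inset n"
proof -
  obtain x y where z: "z = (x, y)" by (cases z)
  define e where "e = Min {x - a, b - x, y - c, d - y}"
  have "e > 0" using assms by (auto simp: e_def z \<Omega>_eq)
  have e: "e \<le> x - a" "e \<le> b - x" "e \<le> y - c" "e \<le> d - y" by (auto simp: e_def)
  obtain m where m: "1 / real (Suc m) < e"
    using nat_approx_posE[OF \<open>e > 0\<close>] by blast
  have "z \<in> inset n" if "n \<ge> m" for n
  proof -
    have "1 / real (Suc n) \<le> 1 / real (Suc m)" using that by (intro divide_left_mono) auto
    then show ?thesis using m e by (auto simp: inset_def z)
  qed
  then show ?thesis using that by blast
qed

lemma integrable_inset: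
  assumes "locally_integrable \<Omega> u"
  shows "integrable lebesgue (\<lambda>z. indicator (inset n) z *\<^sub>R u z)"
proof -
  have "compact (cbox (inset_lo n) (inset_hi n)) \<and> cbox (inset_lo n) (inset_hi n) \<subseteq> \<Omega>"
    using closure_inset compact_cbox by blast
  from assms[unfolded locally_integrable_def, rule_format, OF this]
  have "set_integrable lebesgue (cbox (inset_lo n) (inset_hi n)) u" .
  then have "set_integrable lebesgue (inset n) u"
    unfolding inset_box by (rule set_integrable_subset) (simp_all add: box_subset_cbox)
  then show ?thesis by (simp add: set_integrable_def)
qed

lemma locally_integrable_measurable:
  assumes "locally_integrable \<Omega> u"
  shows "u \<in> borel_measurable Leb"
proof -
  have "(\<lambda>z. indicator \<Omega> z *\<^sub>R u z) \<in> borel_measurable lebesgue"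
  proof (rule borel_measurable_LIMSEQ_metric)
    show "(\<lambda>z. indicator (inset n) z *\<^sub>R u z) \<in> borel_measurable lebesgue" for n
      by (rule borel_measurable_integrable[OF integrable_inset[OF assms]])
    show "(\<lambda>n. indicator (inset n) z *\<^sub>R u z) \<longlonglongrightarrow> indicator \<Omega> z *\<^sub>R u z" for z
    proof (cases "z \<in> \<Omega>")
      case True
      obtain m where "\<And>n. n \<ge> m \<Longrightarrow> z \<in> inset n" using inset_exhaust[OF True] by blast
      then have "\<forall>\<^sub>F n in sequentially. indicator (inset n) z *\<^sub>R u z = indicator \<Omega> z *\<^sub>R u z"
        using True by (intro eventually_sequentiallyI[of m]) auto
      then show ?thesis by (rule tendsto_eventually)
    next
      case False
      then have "z \<notin> inset n" for n using inset_subset[of n] by blast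
      then show ?thesis using False by simp
    qed
  qed
  then show ?thesis by (simp add: borel_measurable_restrict_space_iff)
qed

text \<open>The fundamental lemma of the calculus of variations: on each of countably many boxes that exhaust the rectangle,
all integrals over smaller boxes vanish.\<close>

lemma testing_zero_AE:
  assumes u: "locally_integrable \<Omega> u"
    and zero: "\<And>\<phi>. \<phi> \<in> test_functions \<Omega> \<Longrightarrow> pairing u \<phi> = 0"
  shows "AE z in Leb. u z = 0"
proof -
  have part: "AE z in lebesgue. indicator (inset n) z *\<^sub>R u z = 0" for n
  proof (rule AE_zero_if_box_integrals_zero_complex[OF integrable_inset[OF u]])
    show "indicator (inset n) z *\<^sub>R u z = 0" if "z \<notin> box (inset_lo n) (inset_hi n)" for z
      using that by (simp add: inset_box)
    fix r s assume "box r s \<subseteq> box (inset_lo n) (inset_hi n)"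
    then have sub: "box r s \<subseteq> inset n" by (simp only: inset_box)
    show "(LINT z:box r s|lebesgue. indicator (inset n) z *\<^sub>R u z) = 0"
    proof (cases "box r s = {}")
      case False
      obtain r1 r2 s1 s2 where rs: "r = (r1, r2)" "s = (s1, s2)" by (cases r, cases s)
      have bx: "box r s = {r1<..<s1} \<times> {r2<..<s2}"
        unfolding rs by (auto simp: box_def Basis_prod_def)
      have "inset n \<noteq> {}" using sub False by auto
      then have "cbox r s \<subseteq> \<Omega>"
        using closure_mono[OF sub] closure_inset[of n] False unfolding inset_box by (simp add: closure_box)
      then have "{r1..s1} \<times> {r2..s2} \<subseteq> \<Omega>" unfolding rs cbox_Pair_eq by (simp add: cbox_Pair_eq)
      from box_integral_zero_if_test_integrals_zero[OF u \<Omega>_sets this zero]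
      have "(LINT z:box r s|lebesgue. u z) = 0" by (simp add: bx)
      also have "(LINT z:box r s|lebesgue. u z) = (LINT z:box r s|lebesgue. indicator (inset n) z *\<^sub>R u z)"
        unfolding set_lebesgue_integral_def
        by (intro Bochner_Integration.integral_cong) (use sub in \<open>auto simp: indicator_def\<close>)
      finally show ?thesis by simp
    qed (simp add: set_lebesgue_integral_def)
  qed
  have "AE z in lebesgue. \<forall>n. indicator (inset n) z *\<^sub>R u z = 0"
    unfolding AE_all_countable using part by blast
  then have "AE z in lebesgue. z \<in> \<Omega> \<longrightarrow> u z = 0"
  proof eventually_elim
    case (elim z)
    show ?case
    proof
      assume "z \<in> \<Omega>"
      then obtain m where "z \<in> inset m" using inset_exhaust by blast
      then show "u z = 0" using elim[rule_format, of m] by simp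
    qed
  qed
  then show ?thesis by (simp add: AE_restrict_space_iff)
qed

lemma locally_integrable_if_integrable:
  assumes "integrable Leb u"
  shows "locally_integrable \<Omega> u"
  unfolding locally_integrable_def
proof safe
  fix K assume K: "compact K" "K \<subseteq> \<Omega>"
  have "set_integrable lebesgue \<Omega> u"
    using assms by (simp add: integrable_restrict_space set_integrable_def)
  then show "set_integrable lebesgue K u"
    by (rule set_integrable_subset) (use K in \<open>auto simp: lmeasurable_compact fmeasurableD\<close>)
qed

lemma locally_integrable_times_compact:
  assumes u: "locally_integrable \<Omega> u" and K: "compact K" "K \<subseteq> \<Omega>"
    and c: "continuous_on UNIV \<psi>" and off: "\<And>z. z \<notin> K \<Longrightarrow> \<psi> z = 0"
  shows "integrable Leb (\<lambda>z. u z * \<psi> z)"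
proof -
  obtain B where B: "B \<ge> 0" "\<And>z. cmod (\<psi> z) \<le> B"
    using bounded_if_compact_support[OF c K(1) off] by blast
  have [measurable]: "\<psi> \<in> borel_measurable lebesgue"
    using borel_measurable_continuous_onI[OF c] by (intro measurable_completion) simp
  have i: "integrable lebesgue (\<lambda>z. indicator K z *\<^sub>R u z)"
    using u K unfolding locally_integrable_def set_integrable_def by auto
  note [measurable] = borel_measurable_integrable[OF i]
  have "integrable lebesgue (\<lambda>z. (indicator K z *\<^sub>R u z) * \<psi> z)"
  proof (rule Bochner_Integration.integrable_bound[where f = "\<lambda>z. (indicator K z *\<^sub>R u z) * of_real B"])
    show "integrable lebesgue (\<lambda>z. (indicator K z *\<^sub>R u z) * of_real B)"
      using i by (intro integrable_mult_left) auto
    show "AE z in lebesgue. norm ((indicator K z *\<^sub>R u z) * \<psi> z)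
        \<le> norm ((indicator K z *\<^sub>R u z) * complex_of_real B)"
      using B by (auto simp: norm_mult intro!: mult_left_mono)
  qed measurable
  also have "(\<lambda>z. (indicator K z *\<^sub>R u z) * \<psi> z)
      = (\<lambda>z. indicator \<Omega> z *\<^sub>R (u z * \<psi> z))"
    using K off by (auto simp: indicator_def fun_eq_iff)
  finally show ?thesis by (simp add: integrable_restrict_space)
qed

lemma locally_integrable_times_pd:
  assumes \<phi>: "\<phi> \<in> test_functions \<Omega>" and u: "locally_integrable \<Omega> u"
  shows "integrable Leb (\<lambda>z. u z * pd i j \<phi> z)"
proof -
  obtain K where K: "compact K" "K \<subseteq> \<Omega>" "\<And>z. z \<notin> K \<Longrightarrow> \<phi> z = 0"
    and d: "\<And>i j z. pd i j \<phi> differentiable (at z)"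
    using \<phi> unfolding test_functions_def by blast
  show ?thesis
  proof (rule locally_integrable_times_compact[OF u K(1,2)])
    show "continuous_on UNIV (pd i j \<phi>)"
      using d by (meson differentiable_imp_continuous_within continuous_at_imp_continuous_on)
    show "pd i j \<phi> z = 0" if "z \<notin> K" for z
      using pd_vanishes[OF K(3) compact_imp_closed[OF K(1)] that] .
  qed
qed

lemma locally_integrable_times_test:
  "\<phi> \<in> test_functions \<Omega> \<Longrightarrow> locally_integrable \<Omega> u \<Longrightarrow> integrable Leb (\<lambda>z. u z * \<phi> z)"
  using locally_integrable_times_pd[of \<phi> u 0 0] by (simp only: pd_0)

lemma locally_integrable_diff:
  assumes "locally_integrable \<Omega> u" "locally_integrable \<Omega> v"
  shows "locally_integrable \<Omega> (\<lambda>z. u z - v z)"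
  unfolding locally_integrable_def
proof (intro allI impI)
  fix K assume "compact K \<and> K \<subseteq> \<Omega>"
  then have "set_integrable lebesgue K u" "set_integrable lebesgue K v"
    using assms unfolding locally_integrable_def by blast+
  then show "set_integrable lebesgue K (\<lambda>z. u z - v z)" by (rule set_integral_diff)
qed

text \<open>This makes the arbitrary choice in the definition of weak derivatives irrelevant: the chosen function agrees almost
everywhere with any other candidate, in particular with a bounded or square integrable one.\<close>

lemma weak_deriv_unique:
  assumes g: "is_weak_deriv \<Omega> i j f g" and h: "is_weak_deriv \<Omega> i j f h"
  shows "AE z in Leb. g z = h z"
proof -
  have "AE z in Leb. g z - h z = 0"
  proof (rule testing_zero_AE)
    show li: "locally_integrable \<Omega> (\<lambda>z. g z - h z)"
      using g h by (auto simp: is_weak_deriv_def intro: locally_integrable_diff)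
    fix \<phi> assume \<phi>: "\<phi> \<in> test_functions \<Omega>"
    have "pairing g \<phi> = pairing h \<phi>"
    proof -
      have "(- 1) ^ (i + j) * pairing g \<phi>
          = (- 1) ^ (i + j) * pairing h \<phi>"
        using g[unfolded is_weak_deriv_def, THEN conjunct2, THEN conjunct2, rule_format, OF \<phi>]
          h[unfolded is_weak_deriv_def, THEN conjunct2, THEN conjunct2, rule_format, OF \<phi>] by simp
      then show ?thesis by simp
    qed
    then show "(LINT z|Leb. (g z - h z) * \<phi> z) = 0"
      using g h \<phi> by (simp add: left_diff_distrib is_weak_deriv_def locally_integrable_times_test)
  qed
  then show ?thesis by simp
qed

end

section \<open>Quasi-norms and functions of time\<close>

lemma members_inter_space [simp]: "members (inter_space X Y) = members X \<inter> members Y"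
  and fnorm_inter_space [simp]: "fnorm (inter_space X Y) f = fnorm X f + fnorm Y f"
  by (simp_all add: inter_space_def)

lemma members_Lp_infty: "members (Lp \<Omega> \<infinity>) = {f \<in> borel_measurable (lebesgue_on \<Omega>).
      esssup (lebesgue_on \<Omega>) (\<lambda>z. ereal (cmod (f z))) < \<infinity>}"
  and fnorm_Lp_infty: "fnorm (Lp \<Omega> \<infinity>) f = real_of_ereal (esssup (lebesgue_on \<Omega>) (\<lambda>z. ereal (cmod (f z))))"
  by (simp_all add: Lp_def)

lemma members_Lp_2: "members (Lp \<Omega> 2) = {f \<in> borel_measurable (lebesgue_on \<Omega>).
      integrable (lebesgue_on \<Omega>) (\<lambda>z. (cmod (f z))\<^sup>2)}"
  and fnorm_Lp_2: "fnorm (Lp \<Omega> 2) f = sqrt (\<integral>z. (cmod (f z))\<^sup>2 \<partial>lebesgue_on \<Omega>)"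
  by (simp_all add: Lp_def powr_half_sqrt integral_nonneg_AE)

\<comment> \<open>the exponent 2 stays a numeral, as in the two preceding facts, instead of becoming a coerced real number\<close>
declare numeral_eq_ereal [simp del]

text \<open>A linear space of functions on which \<open>N\<close> satisfies the triangle inequality up to the factor 2. This weak form suffices
for boundedness in time, and for the \<open>L\<^sup>2\<close> norm it is immediate from \<open>|x + y|\<^sup>2 \<le> 2 |x|\<^sup>2 + 2 |y|\<^sup>2\<close>.\<close>

definition quasi_norm_on :: "cfun set \<Rightarrow> (cfun \<Rightarrow> real) \<Rightarrow> bool" where
  "quasi_norm_on M N \<longleftrightarrow>
     (\<forall>f\<in>M. \<forall>g\<in>M. (\<lambda>z. f z + g z) \<in> M \<and> N (\<lambda>z. f z + g z) \<le> 2 * (N f + N g)) \<and>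
     (\<forall>f\<in>M. \<forall>k. (\<lambda>z. k * f z) \<in> M) \<and> (\<forall>f\<in>M. 0 \<le> N f)"

lemma quasi_norm_onD:
  assumes "quasi_norm_on M N"
  shows "f \<in> M \<Longrightarrow> g \<in> M \<Longrightarrow> (\<lambda>z. f z + g z) \<in> M"
    and "f \<in> M \<Longrightarrow> g \<in> M \<Longrightarrow> N (\<lambda>z. f z + g z) \<le> 2 * (N f + N g)"
    and "f \<in> M \<Longrightarrow> (\<lambda>z. k * f z) \<in> M"
    and "f \<in> M \<Longrightarrow> 0 \<le> N f"
  using assms by (auto simp: quasi_norm_on_def)

lemma quasi_norm_on_diff:
  assumes "quasi_norm_on M N" "f \<in> M" "g \<in> M"
  shows "(\<lambda>z. f z - g z) \<in> M" and "N f \<le> 2 * (N (\<lambda>z. f z - g z) + N g)"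
proof -
  show *: "(\<lambda>z. f z - g z) \<in> M"
    using quasi_norm_onD(1)[OF assms(1) assms(2) quasi_norm_onD(3)[OF assms(1,3), of "-1"]] by simp
  show "N f \<le> 2 * (N (\<lambda>z. f z - g z) + N g)"
    using quasi_norm_onD(2)[OF assms(1) * assms(3)] by simp
qed

text \<open>Continuity bounds the norm near each time, and Bolzano's bisection principle glues the local bounds together. Without this the
suprema in the norms of functions of time would be unspecified.\<close>

lemma continuous_in_time_bdd_above:
  assumes q: "quasi_norm_on M (fnorm X)" and sub: "members X \<subseteq> M" and u: "continuous_in_time T X u"
  shows "bdd_above ((\<lambda>t. fnorm X (u t)) ` {0..T})"
proof (cases "0 \<le> T")
  case True
  have mem: "u t \<in> M" if "t \<in> {0..T}" for t
    using u sub that by (auto simp: continuous_in_time_def)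
  have "bdd_above ((\<lambda>t. fnorm X (u t)) ` ({0..T} \<inter> {0..T}))" using True
  proof (rule Bolzano[where P = "\<lambda>r s. bdd_above ((\<lambda>t. fnorm X (u t)) ` ({0..T} \<inter> {r..s}))"])
    fix r s t :: real
    assume "bdd_above ((\<lambda>t. fnorm X (u t)) ` ({0..T} \<inter> {r..s}))"
      "bdd_above ((\<lambda>t. fnorm X (u t)) ` ({0..T} \<inter> {s..t}))" "r \<le> s" "s \<le> t"
    then have "bdd_above ((\<lambda>t. fnorm X (u t)) ` ({0..T} \<inter> {r..s}) \<union> (\<lambda>t. fnorm X (u t)) ` ({0..T} \<inter> {s..t}))"
      by simp
    then show "bdd_above ((\<lambda>t. fnorm X (u t)) ` ({0..T} \<inter> {r..t}))"
      by (rule bdd_above_mono) force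
  next
    fix t assume t: "0 \<le> t" "t \<le> T"
    have "((\<lambda>s. fnorm X (\<lambda>z. u s z - u t z)) \<longlongrightarrow> 0) (at t within {0..T})"
      using u t by (auto simp: continuous_in_time_def)
    then have "\<forall>\<^sub>F s in at t within {0..T}. fnorm X (\<lambda>z. u s z - u t z) < 1"
      by (rule order_tendstoD) simp
    then obtain e where e: "e > 0"
      "\<And>s. s \<in> {0..T} \<Longrightarrow> s \<noteq> t \<Longrightarrow> dist s t < e \<Longrightarrow> fnorm X (\<lambda>z. u s z - u t z) < 1"
      unfolding eventually_at by auto
    have "fnorm X (u s) \<le> 2 * (1 + fnorm X (u t))" if "s \<in> {0..T}" "dist s t < e" for s
    proof (cases "s = t")
      case False
      have "fnorm X (u s) \<le> 2 * (fnorm X (\<lambda>z. u s z - u t z) + fnorm X (u t))"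
        using quasi_norm_on_diff(2)[OF q mem mem] that(1) t by simp
      also have "\<dots> \<le> 2 * (1 + fnorm X (u t))"
        using e(2)[OF that(1) False that(2)] by simp
      finally show ?thesis .
    next
      case True
      then show ?thesis using quasi_norm_onD(4)[OF q mem[of t]] t by simp
    qed
    then have "bdd_above ((\<lambda>t. fnorm X (u t)) ` ({0..T} \<inter> {r..s}))" if "r \<le> t" "t \<le> s" "s - r < e" for r s
      using that by (intro bdd_aboveI2[where M = "2 * (1 + fnorm X (u t))"]) (auto simp: dist_real_def)
    with e(1) show "\<exists>e>0. \<forall>r s. r \<le> t \<and> t \<le> s \<and> s - r < e \<longrightarrow>
        bdd_above ((\<lambda>t. fnorm X (u t)) ` ({0..T} \<inter> {r..s}))" by (intro exI[of _ e]) simp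
  qed
  then show ?thesis by simp
qed simp

lemma fnorm_le_C_time_norm:
  assumes q: "quasi_norm_on M (fnorm X)" "members X \<subseteq> M" and u: "C_time m T X u"
    and i: "i \<le> m" and t: "t \<in> {0..T}"
  shows "fnorm X ((time_deriv T X ^^ i) u t) \<le> C_time_norm m T X u"
proof -
  have c: "continuous_in_time T X ((time_deriv T X ^^ k) u)" if "k \<le> m" for k
    using u that by (auto simp: C_time_def)
  let ?S = "\<lambda>k. SUP t\<in>{0..T}. fnorm X ((time_deriv T X ^^ k) u t)"
  have le: "fnorm X ((time_deriv T X ^^ k) u t) \<le> ?S k" if "k \<le> m" for k
    using continuous_in_time_bdd_above[OF q c[OF that]] t by (rule cSUP_upper[rotated])
  have nn: "0 \<le> fnorm X ((time_deriv T X ^^ k) u t)" if "k \<le> m" for k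
    using c[OF that] q t by (intro quasi_norm_onD(4)[OF q(1)]) (auto simp: continuous_in_time_def)
  have "?S i \<le> (\<Sum>k\<le>m. ?S k)"
    using i le nn by (intro member_le_sum) (auto intro: order_trans)
  with le[OF i] show ?thesis by (simp add: C_time_norm_def)
qed

lemma C_time_has_time_deriv:
  assumes "C_time m T X u" "i < m"
  shows "has_time_deriv T X ((time_deriv T X ^^ i) u) ((time_deriv T X ^^ Suc i) u)"
proof -
  have "\<exists>v. has_time_deriv T X ((time_deriv T X ^^ i) u) v"
    using assms by (auto simp: C_time_def)
  then show ?thesis by (simp add: time_deriv_def[of T X] someI_ex)
qed

lemma C_time_members: "C_time m T X u \<Longrightarrow> i \<le> m \<Longrightarrow> t \<in> {0..T} \<Longrightarrow> (time_deriv T X ^^ i) u t \<in> members X"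
  by (auto simp: C_time_def continuous_in_time_def)

text \<open>A bounded linear functional maps a differentiable function of time to a differentiable scalar function. All later
arguments in time use the scalar functions only.\<close>

lemma has_time_deriv_testing:
  assumes q: "quasi_norm_on M (fnorm X)" and sub: "members X \<subseteq> M"
    and int: "\<And>f. f \<in> M \<Longrightarrow> integrable L (\<lambda>z. f z * \<psi> z)"
    and bound: "\<And>f. f \<in> M \<Longrightarrow> cmod (LINT z|L. f z * \<psi> z) \<le> k * fnorm X f"
    and u: "\<And>t. t \<in> {0..T} \<Longrightarrow> u t \<in> M"
    and u': "has_time_deriv T X u u'" and t: "t \<in> {0..T}"
  shows "((\<lambda>t. LINT z|L. u t z * \<psi> z) has_vector_derivative (LINT z|L. u' t z * \<psi> z)) (at t within {0..T})"
proof -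
  define l where "l f = (LINT z|L. f z * \<psi> z)" for f :: cfun
  have ad: "l (\<lambda>z. f z - g z) = l f - l g" if "f \<in> M" "g \<in> M" for f g
    unfolding l_def left_diff_distrib using int that by simp
  have sc: "l (\<lambda>z. c * f z) = c * l f" for f c
    unfolding l_def mult.assoc by simp
  define R where "R s = (\<lambda>z. (u s z - u t z) / complex_of_real (s - t) - u' t z)" for s
  have u't: "u' t \<in> M" using u' t sub by (auto simp: has_time_deriv_def)
  have quot: "(\<lambda>z. (u s z - u t z) / complex_of_real (s - t)) \<in> M" if "s \<in> {0..T}" for s
    using quasi_norm_onD(3)[OF q quasi_norm_on_diff(1)[OF q u[OF that] u[OF t]], of "1 / complex_of_real (s - t)"]
    by simp
  have RM: "R s \<in> M" if "s \<in> {0..T}" for s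
    unfolding R_def by (rule quasi_norm_on_diff(1)[OF q quot[OF that] u't])
  have lR: "complex_of_real (s - t) * l (R s) = l (u s) - l (u t) - complex_of_real (s - t) * l (u' t)"
    if "s \<in> {0..T}" "s \<noteq> t" for s
  proof -
    have "l (R s) = l (\<lambda>z. (u s z - u t z) / complex_of_real (s - t)) - l (u' t)"
      unfolding R_def by (rule ad[OF quot[OF that(1)] u't])
    also have "l (\<lambda>z. (u s z - u t z) / complex_of_real (s - t)) = (l (u s) - l (u t)) / complex_of_real (s - t)"
      using sc[of "1 / complex_of_real (s - t)" "\<lambda>z. u s z - u t z"] ad[OF u[OF that(1)] u[OF t]] by simp
    finally show ?thesis using that(2) by (simp add: field_simps)
  qed
  have lim: "((\<lambda>s. k * fnorm X (R s)) \<longlongrightarrow> 0) (at t within {0..T})"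
    using tendsto_mult_right_zero[of "\<lambda>s. fnorm X (R s)"] u' t unfolding has_time_deriv_def R_def by blast
  have ev: "\<forall>\<^sub>F s in at t within {0..T}. s \<in> {0..T} \<and> s \<noteq> t"
    by (simp add: eventually_at_filter)
  have "((\<lambda>s. norm (l (u s) - l (u t) - (s - t) *\<^sub>R l (u' t)) / norm (s - t)) \<longlongrightarrow> 0) (at t within {0..T})"
  proof (rule Lim_null_comparison[OF _ lim])
    show "\<forall>\<^sub>F s in at t within {0..T}. norm (norm (l (u s) - l (u t) - (s - t) *\<^sub>R l (u' t)) / norm (s - t)) \<le> k * fnorm X (R s)"
      using ev
    proof eventually_elim
      case (elim s)
      then have "norm (l (u s) - l (u t) - (s - t) *\<^sub>R l (u' t)) = \<bar>s - t\<bar> * cmod (l (R s))"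
        using lR[of s] by (simp add: scaleR_conv_of_real flip: norm_mult norm_of_real[where 'a = complex])
      with elim have "norm (norm (l (u s) - l (u t) - (s - t) *\<^sub>R l (u' t)) / norm (s - t)) = cmod (l (R s))"
        by simp
      also have "\<dots> \<le> k * fnorm X (R s)"
        using bound[OF RM] elim unfolding l_def by blast
      finally show ?case .
    qed
  qed
  then show ?thesis
    unfolding has_vector_derivative_def has_derivative_iff_norm l_def
    by (simp add: bounded_linear_scaleR_left)
qed

section \<open>Lebesgue and Sobolev spaces on a rectangle\<close>

context rectangle
begin

definition L1_norm :: "cfun \<Rightarrow> real" where
  "L1_norm \<phi> = (LINT z|Leb. cmod (\<phi> z))"

lemma test_integrable: "\<phi> \<in> test_functions \<Omega> \<Longrightarrow> integrable Leb \<phi>"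
  using locally_integrable_times_test[of \<phi> "\<lambda>z. 1"] locally_integrable_if_integrable[of "\<lambda>z. 1"] by simp

lemma Lp_infty_iff:
  "f \<in> members (Lp \<Omega> \<infinity>) \<longleftrightarrow> f \<in> borel_measurable Leb \<and> (\<exists>k. AE z in Leb. cmod (f z) \<le> k)"
proof safe
  assume f: "f \<in> members (Lp \<Omega> \<infinity>)"
  then show m: "f \<in> borel_measurable Leb" by (simp add: members_Lp_infty)
  have "esssup Leb (\<lambda>z. ereal (cmod (f z))) < \<infinity>" using f by (simp add: members_Lp_infty)
  then have "\<exists>k :: real. esssup Leb (\<lambda>z. ereal (cmod (f z))) \<le> ereal k"
    by (cases "esssup Leb (\<lambda>z. ereal (cmod (f z)))") auto
  then obtain k :: real where "esssup Leb (\<lambda>z. ereal (cmod (f z))) \<le> ereal k" ..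
  note k = this
  have "AE z in Leb. cmod (f z) \<le> k"
    using esssup_AE[of "\<lambda>z. ereal (cmod (f z))" "Leb"]
  proof eventually_elim
    case (elim z)
    from order_trans[OF elim k] show ?case by simp
  qed
  then show "\<exists>k. AE z in Leb. cmod (f z) \<le> k" ..
next
  fix k assume f: "f \<in> borel_measurable Leb" and k: "AE z in Leb. cmod (f z) \<le> k"
  then have "esssup Leb (\<lambda>z. ereal (cmod (f z))) \<le> ereal k"
    by (intro esssup_I) auto
  then have "esssup Leb (\<lambda>z. ereal (cmod (f z))) < \<infinity>"
    by (rule le_less_trans) simp
  with f show "f \<in> members (Lp \<Omega> \<infinity>)" by (simp add: members_Lp_infty)
qed

lemma
  assumes "f \<in> members (Lp \<Omega> \<infinity>)"
  shows Lp_infty_nonneg: "0 \<le> fnorm (Lp \<Omega> \<infinity>) f"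
    and Lp_infty_AE: "AE z in Leb. cmod (f z) \<le> fnorm (Lp \<Omega> \<infinity>) f"
    and Lp_infty_norm_le: "0 \<le> k \<Longrightarrow> AE z in Leb. cmod (f z) \<le> k \<Longrightarrow> fnorm (Lp \<Omega> \<infinity>) f \<le> k"
proof -
  let ?E = "esssup Leb (\<lambda>z. ereal (cmod (f z)))"
  have f: "f \<in> borel_measurable Leb" "?E < \<infinity>" using assms by (auto simp: members_Lp_infty)
  have "esssup Leb (\<lambda>z. 0 :: ereal) \<le> ?E"
    by (rule esssup_mono) auto
  then have 0: "0 \<le> ?E" using esssup_const[OF \<Omega>_not_null, of "0 :: ereal"] by simp
  then have r: "?E = ereal (fnorm (Lp \<Omega> \<infinity>) f)" using f by (simp add: fnorm_Lp_infty ereal_real)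
  show "0 \<le> fnorm (Lp \<Omega> \<infinity>) f" using 0 r by (simp only: ereal_less_eq(5))
  show "AE z in Leb. cmod (f z) \<le> fnorm (Lp \<Omega> \<infinity>) f"
    using esssup_AE[of "\<lambda>z. ereal (cmod (f z))" "Leb"] unfolding r by simp
  show "fnorm (Lp \<Omega> \<infinity>) f \<le> k" if "0 \<le> k" "AE z in Leb. cmod (f z) \<le> k"
  proof -
    have "?E \<le> ereal k" using f that by (intro esssup_I) auto
    then show ?thesis unfolding r by simp
  qed
qed

lemma quasi_norm_Lp_infty: "quasi_norm_on (members (Lp \<Omega> \<infinity>)) (fnorm (Lp \<Omega> \<infinity>))"
  unfolding quasi_norm_on_def
proof (intro conjI ballI allI)
  fix f g assume f: "f \<in> members (Lp \<Omega> \<infinity>)" and g: "g \<in> members (Lp \<Omega> \<infinity>)"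
  have ae: "AE z in Leb. cmod (f z + g z) \<le> fnorm (Lp \<Omega> \<infinity>) f + fnorm (Lp \<Omega> \<infinity>) g"
    using Lp_infty_AE[OF f] Lp_infty_AE[OF g] by eventually_elim (metis add_mono norm_triangle_le)
  then show m: "(\<lambda>z. f z + g z) \<in> members (Lp \<Omega> \<infinity>)"
    using f g by (auto simp: Lp_infty_iff)
  show "fnorm (Lp \<Omega> \<infinity>) (\<lambda>z. f z + g z) \<le> 2 * (fnorm (Lp \<Omega> \<infinity>) f + fnorm (Lp \<Omega> \<infinity>) g)"
    using Lp_infty_norm_le[OF m _ ae] Lp_infty_nonneg[OF f] Lp_infty_nonneg[OF g] by simp
next
  fix f k assume f: "f \<in> members (Lp \<Omega> \<infinity>)"
  have "AE z in Leb. cmod (k * f z) \<le> cmod k * fnorm (Lp \<Omega> \<infinity>) f"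
    using Lp_infty_AE[OF f] by eventually_elim (simp add: norm_mult mult_left_mono)
  then show "(\<lambda>z. k * f z) \<in> members (Lp \<Omega> \<infinity>)"
    using f by (auto simp: Lp_infty_iff)
qed (rule Lp_infty_nonneg)

lemma quasi_norm_Lp_2: "quasi_norm_on (members (Lp \<Omega> 2)) (fnorm (Lp \<Omega> 2))"
  unfolding quasi_norm_on_def
proof (intro conjI ballI allI)
  fix f g assume f: "f \<in> members (Lp \<Omega> 2)" and g: "g \<in> members (Lp \<Omega> 2)"
  then have [measurable]: "f \<in> borel_measurable Leb" "g \<in> borel_measurable Leb"
    and i: "integrable Leb (\<lambda>z. (cmod (f z))\<^sup>2)" "integrable Leb (\<lambda>z. (cmod (g z))\<^sup>2)"
    by (auto simp: members_Lp_2)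
  have le: "(cmod (f z + g z))\<^sup>2 \<le> 2 * ((cmod (f z))\<^sup>2 + (cmod (g z))\<^sup>2)" for z
  proof -
    have "(cmod (f z + g z))\<^sup>2 \<le> (cmod (f z) + cmod (g z))\<^sup>2"
      by (intro power_mono norm_triangle_ineq) auto
    also have "\<dots> \<le> 2 * ((cmod (f z))\<^sup>2 + (cmod (g z))\<^sup>2)"
      using sum_squares_bound[of "cmod (f z)" "cmod (g z)"] by (simp add: power2_sum)
    finally show ?thesis .
  qed
  have i2: "integrable Leb (\<lambda>z. 2 * ((cmod (f z))\<^sup>2 + (cmod (g z))\<^sup>2))"
    using i by simp
  have i3: "integrable Leb (\<lambda>z. (cmod (f z + g z))\<^sup>2)"
    using i2 by (rule Bochner_Integration.integrable_bound) (use le in \<open>auto simp: abs_of_nonneg\<close>)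
  then show "(\<lambda>z. f z + g z) \<in> members (Lp \<Omega> 2)" by (simp add: members_Lp_2)
  have "(LINT z|Leb. (cmod (f z + g z))\<^sup>2) \<le> (LINT z|Leb. 2 * ((cmod (f z))\<^sup>2 + (cmod (g z))\<^sup>2))"
    using i3 i2 le by (intro integral_mono) auto
  also have "\<dots> = 2 * ((LINT z|Leb. (cmod (f z))\<^sup>2) + (LINT z|Leb. (cmod (g z))\<^sup>2))"
    using i by simp
  also have "\<dots> = 2 * ((fnorm (Lp \<Omega> 2) f)\<^sup>2 + (fnorm (Lp \<Omega> 2) g)\<^sup>2)"
    by (simp add: fnorm_Lp_2 integral_nonneg_AE)
  also have "\<dots> \<le> (2 * (fnorm (Lp \<Omega> 2) f + fnorm (Lp \<Omega> 2) g))\<^sup>2"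
    using mult_nonneg_nonneg[of "fnorm (Lp \<Omega> 2) f" "fnorm (Lp \<Omega> 2) g"]
    by (simp add: fnorm_Lp_2 integral_nonneg_AE power2_eq_square algebra_simps)
  finally show "fnorm (Lp \<Omega> 2) (\<lambda>z. f z + g z) \<le> 2 * (fnorm (Lp \<Omega> 2) f + fnorm (Lp \<Omega> 2) g)"
    unfolding fnorm_Lp_2[of _ "\<lambda>z. f z + g z"]
    by (intro real_le_lsqrt) (auto simp: fnorm_Lp_2 integral_nonneg_AE)
next
  fix f k assume "f \<in> members (Lp \<Omega> 2)"
  then show "(\<lambda>z. k * f z) \<in> members (Lp \<Omega> 2)"
    by (auto simp: members_Lp_2 norm_mult power_mult_distrib)
qed (simp add: fnorm_Lp_2 integral_nonneg_AE)

lemma Lp_infty_integrable: "f \<in> members (Lp \<Omega> \<infinity>) \<Longrightarrow> integrable Leb f"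
  unfolding Lp_infty_iff by (auto intro: integrable_const_bound)

lemma Lp_2_integrable:
  assumes "f \<in> members (Lp \<Omega> 2)"
  shows "integrable Leb f"
proof (rule Bochner_Integration.integrable_bound)
  show "integrable Leb (\<lambda>z. 1 + (cmod (f z))\<^sup>2)"
    using assms by (auto simp: members_Lp_2)
  have "x \<le> 1 + x\<^sup>2" for x :: real
    using sum_squares_bound[of x 1] by (smt (verit) one_power2 zero_le_power2)
  then show "AE z in Leb. norm (f z) \<le> norm (1 + (cmod (f z))\<^sup>2)" by auto
qed (use assms in \<open>auto simp: members_Lp_2\<close>)

lemma Lp_infty_test_bound:
  assumes f: "f \<in> members (Lp \<Omega> \<infinity>)" and \<phi>: "\<phi> \<in> test_functions \<Omega>"
  shows "cmod (pairing f \<phi>) \<le> L1_norm \<phi> * fnorm (Lp \<Omega> \<infinity>) f"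
proof -
  have i: "integrable Leb (\<lambda>z. f z * \<phi> z)"
    using \<phi> f by (intro locally_integrable_times_test locally_integrable_if_integrable Lp_infty_integrable)
  have "cmod (pairing f \<phi>) \<le> (LINT z|Leb. cmod (\<phi> z) * fnorm (Lp \<Omega> \<infinity>) f)"
  proof (rule integral_norm_bound[THEN order_trans], rule integral_mono_AE)
    show "integrable Leb (\<lambda>z. cmod (f z * \<phi> z))" using i by (rule integrable_norm)
    show "integrable Leb (\<lambda>z. cmod (\<phi> z) * fnorm (Lp \<Omega> \<infinity>) f)"
      using test_integrable[OF \<phi>] by (intro integrable_mult_left integrable_norm)
    show "AE z in Leb. cmod (f z * \<phi> z) \<le> cmod (\<phi> z) * fnorm (Lp \<Omega> \<infinity>) f"
      using Lp_infty_AE[OF f] by eventually_elim (simp add: norm_mult mult.commute[of "cmod (f _)"] mult_left_mono)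
  qed
  then show ?thesis by (simp add: L1_norm_def)
qed

text \<open>The bound comes from \<open>|f| \<le> N + |f|\<^sup>2 / N\<close> with \<open>N\<close> the norm of \<open>f\<close>, integrated over the rectangle.\<close>

lemma Lp_2_test_bound:
  assumes \<phi>: "\<phi> \<in> test_functions \<Omega>"
  shows "\<exists>k. \<forall>f\<in>members (Lp \<Omega> 2). cmod (pairing f \<phi>) \<le> k * fnorm (Lp \<Omega> 2) f"
proof -
  obtain B where B: "B \<ge> 0" "\<And>z. cmod (\<phi> z) \<le> B" using test_function_bounded[OF \<phi>] by blast
  have "cmod (pairing f \<phi>) \<le> (B * (measure lebesgue \<Omega> + 1)) * fnorm (Lp \<Omega> 2) f"
    if f: "f \<in> members (Lp \<Omega> 2)" for f
  proof -
    let ?N = "fnorm (Lp \<Omega> 2) f"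
    have fi: "integrable Leb f" by (rule Lp_2_integrable[OF f])
    have f2: "integrable Leb (\<lambda>z. (cmod (f z))\<^sup>2)" using f by (simp add: members_Lp_2)
    have N: "?N\<^sup>2 = (LINT z|Leb. (cmod (f z))\<^sup>2)" "0 \<le> ?N"
      by (simp_all add: fnorm_Lp_2 integral_nonneg_AE)
    have "cmod (pairing f \<phi>) \<le> (LINT z|Leb. B * cmod (f z))"
    proof (rule integral_norm_bound[THEN order_trans], rule integral_mono)
      show "integrable Leb (\<lambda>z. cmod (f z * \<phi> z))"
        using \<phi> fi by (intro integrable_norm locally_integrable_times_test locally_integrable_if_integrable)
      show "integrable Leb (\<lambda>z. B * cmod (f z))"
        using fi by (intro integrable_mult_right integrable_norm)
      show "cmod (f z * \<phi> z) \<le> B * cmod (f z)" for z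
        using B(2)[of z] by (simp add: norm_mult mult.commute mult_right_mono)
    qed
    also have "\<dots> = B * (LINT z|Leb. cmod (f z))" by simp
    also have "(LINT z|Leb. cmod (f z)) \<le> (measure lebesgue \<Omega> + 1) * ?N"
    proof (cases "?N = 0")
      case True
      then have "AE z in Leb. (cmod (f z))\<^sup>2 = 0"
        using N(1) integral_nonneg_eq_0_iff_AE[OF f2] by simp
      then have "(LINT z|Leb. cmod (f z)) = (LINT z|Leb. 0)"
        using fi by (intro integral_cong_AE) auto
      then show ?thesis using True by simp
    next
      case False
      then have pos: "?N > 0" using N(2) by simp
      have "(LINT z|Leb. cmod (f z)) \<le> (LINT z|Leb. ?N + (cmod (f z))\<^sup>2 / ?N)"
      proof (rule integral_mono)
        show "cmod (f z) \<le> ?N + (cmod (f z))\<^sup>2 / ?N" for z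
        proof -
          have "cmod (f z) * ?N \<le> ?N * ?N + (cmod (f z))\<^sup>2"
            using sum_squares_bound[of "cmod (f z)" ?N] mult_nonneg_nonneg[of "cmod (f z)" ?N, OF norm_ge_zero N(2)]
            unfolding power2_eq_square by linarith
          then show ?thesis using pos by (simp add: field_simps)
        qed
      qed (use fi f2 in auto)
      also have "\<dots> = ?N * measure lebesgue \<Omega> + ?N\<^sup>2 / ?N"
        using f2 by (simp add: N(1) measure_restrict_space)
      finally show ?thesis using pos by (simp add: power2_eq_square algebra_simps)
    qed
    finally show ?thesis using B(1) by (simp add: mult_left_mono mult.assoc)
  qed
  then show ?thesis by blast
qed

end

lemma members_Sobolev: "members (Sobolev \<Omega> k p) = {f \<in> members (Lp \<Omega> p).
      \<forall>i j. i + j \<le> k \<longrightarrow> (\<exists>g \<in> members (Lp \<Omega> p). is_weak_deriv \<Omega> i j f g)}"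
  and fnorm_Sobolev: "fnorm (Sobolev \<Omega> k p) f =
      (\<Sum>i\<le>k. \<Sum>j\<le>k - i. fnorm (Lp \<Omega> p) (weak_deriv \<Omega> i j f))"
  by (simp_all add: Sobolev_def)

context rectangle
begin

lemma is_weak_deriv_add:
  assumes 1: "is_weak_deriv \<Omega> i j f1 g1" and 2: "is_weak_deriv \<Omega> i j f2 g2"
  shows "is_weak_deriv \<Omega> i j (\<lambda>z. f1 z + f2 z) (\<lambda>z. g1 z + g2 z)"
proof -
  have li: "locally_integrable \<Omega> f1" "locally_integrable \<Omega> f2" "locally_integrable \<Omega> g1" "locally_integrable \<Omega> g2"
    using 1 2 by (auto simp: is_weak_deriv_def)
  have add: "locally_integrable \<Omega> (\<lambda>z. f z + g z)" if "locally_integrable \<Omega> f" "locally_integrable \<Omega> g" for f g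
    using that set_integral_add(1) unfolding locally_integrable_def by blast
  have "(\<integral>z. (f1 z + f2 z) * pd i j \<phi> z \<partial>Leb)
      = (-1) ^ (i + j) * (\<integral>z. (g1 z + g2 z) * \<phi> z \<partial>Leb)" if \<phi>: "\<phi> \<in> test_functions \<Omega>" for \<phi>
  proof -
    have "(\<integral>z. f1 z * pd i j \<phi> z \<partial>Leb) = (-1) ^ (i + j) * (\<integral>z. g1 z * \<phi> z \<partial>Leb)"
      "(\<integral>z. f2 z * pd i j \<phi> z \<partial>Leb) = (-1) ^ (i + j) * (\<integral>z. g2 z * \<phi> z \<partial>Leb)"
      using 1 2 \<phi> unfolding is_weak_deriv_def by blast+
    then show ?thesis using li \<phi>
      by (simp add: distrib_right locally_integrable_times_pd locally_integrable_times_test distrib_left)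
  qed
  with li add show ?thesis unfolding is_weak_deriv_def by blast
qed

lemma is_weak_deriv_cmult:
  assumes 1: "is_weak_deriv \<Omega> i j f g"
  shows "is_weak_deriv \<Omega> i j (\<lambda>z. k * f z) (\<lambda>z. k * g z)"
proof -
  have li: "locally_integrable \<Omega> f" "locally_integrable \<Omega> g"
    using 1 by (auto simp: is_weak_deriv_def)
  have sc: "locally_integrable \<Omega> (\<lambda>z. k * f z)" if "locally_integrable \<Omega> f" for f
    using that unfolding locally_integrable_def by simp
  have "(\<integral>z. (k * f z) * pd i j \<phi> z \<partial>Leb)
      = (-1) ^ (i + j) * (\<integral>z. (k * g z) * \<phi> z \<partial>Leb)" if \<phi>: "\<phi> \<in> test_functions \<Omega>" for \<phi>
  proof -
    have "(\<integral>z. f z * pd i j \<phi> z \<partial>Leb) = (-1) ^ (i + j) * (\<integral>z. g z * \<phi> z \<partial>Leb)"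
      using 1 \<phi> unfolding is_weak_deriv_def by blast
    then show ?thesis by (simp add: mult.assoc)
  qed
  with li sc show ?thesis unfolding is_weak_deriv_def by blast
qed

lemma quasi_norm_Lp: "p = 2 \<or> p = \<infinity> \<Longrightarrow> quasi_norm_on (members (Lp \<Omega> p)) (fnorm (Lp \<Omega> p))"
  using quasi_norm_Lp_2 quasi_norm_Lp_infty by auto

lemma Lp_AE_cong:
  assumes p: "p = 2 \<or> p = \<infinity>" and f: "f \<in> members (Lp \<Omega> p)"
    and g: "g \<in> borel_measurable Leb" and eq: "AE z in Leb. f z = g z"
  shows "g \<in> members (Lp \<Omega> p)" and "fnorm (Lp \<Omega> p) g = fnorm (Lp \<Omega> p) f"
proof -
  have "g \<in> members (Lp \<Omega> p) \<and> fnorm (Lp \<Omega> p) g = fnorm (Lp \<Omega> p) f"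
    using p
  proof
    assume p: "p = 2"
    have fm: "f \<in> borel_measurable Leb" and i: "integrable Leb (\<lambda>z. (cmod (f z))\<^sup>2)"
      using f by (auto simp: p members_Lp_2)
    have "integrable Leb (\<lambda>z. (cmod (g z))\<^sup>2)"
      by (rule integrable_cong_AE_imp[OF i]) (use eq g in auto)
    moreover have "(LINT z|Leb. (cmod (g z))\<^sup>2) = (LINT z|Leb. (cmod (f z))\<^sup>2)"
      by (rule integral_cong_AE) (use eq g fm in auto)
    ultimately show ?thesis using g by (simp add: p members_Lp_2 fnorm_Lp_2)
  next
    assume p: "p = \<infinity>"
    have fm: "f \<in> borel_measurable Leb" using f by (auto simp: p members_Lp_infty)
    have "esssup Leb (\<lambda>z. ereal (cmod (f z))) = esssup Leb (\<lambda>z. ereal (cmod (g z)))"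
      by (rule esssup_AE_cong) (use eq g fm in auto)
    then show ?thesis using f g by (simp add: p members_Lp_infty fnorm_Lp_infty)
  qed
  then show "g \<in> members (Lp \<Omega> p)" "fnorm (Lp \<Omega> p) g = fnorm (Lp \<Omega> p) f" by auto
qed

lemma
  assumes p: "p = 2 \<or> p = \<infinity>" and g: "g \<in> members (Lp \<Omega> p)" "is_weak_deriv \<Omega> i j f g"
  shows is_weak_deriv_weak_deriv: "is_weak_deriv \<Omega> i j f (weak_deriv \<Omega> i j f)"
    and weak_deriv_members: "weak_deriv \<Omega> i j f \<in> members (Lp \<Omega> p)"
    and fnorm_weak_deriv: "fnorm (Lp \<Omega> p) (weak_deriv \<Omega> i j f) = fnorm (Lp \<Omega> p) g"
proof -
  show w: "is_weak_deriv \<Omega> i j f (weak_deriv \<Omega> i j f)"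
    unfolding weak_deriv_def by (rule someI[of "is_weak_deriv \<Omega> i j f" g]) (rule g)
  have m: "weak_deriv \<Omega> i j f \<in> borel_measurable Leb"
    using w by (intro locally_integrable_measurable) (auto simp: is_weak_deriv_def)
  note * = Lp_AE_cong[OF p g(1) m weak_deriv_unique[OF g(2) w]]
  show "weak_deriv \<Omega> i j f \<in> members (Lp \<Omega> p)" by (rule *)
  show "fnorm (Lp \<Omega> p) (weak_deriv \<Omega> i j f) = fnorm (Lp \<Omega> p) g" by (rule *)
qed

text \<open>Membership in the Sobolev space provides some weak derivative in the Lebesgue space; by uniqueness the chosen one
lies there too, so that the summands of the Sobolev norm have their intended meaning.\<close>

lemma Sobolev_weak_deriv:
  assumes p: "p = 2 \<or> p = \<infinity>" and f: "f \<in> members (Sobolev \<Omega> k p)" and ij: "i + j \<le> k"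
  shows "is_weak_deriv \<Omega> i j f (weak_deriv \<Omega> i j f)" "weak_deriv \<Omega> i j f \<in> members (Lp \<Omega> p)"
    "0 \<le> fnorm (Lp \<Omega> p) (weak_deriv \<Omega> i j f)"
proof -
  obtain g where g: "g \<in> members (Lp \<Omega> p)" "is_weak_deriv \<Omega> i j f g"
    using f ij unfolding members_Sobolev by blast
  show "is_weak_deriv \<Omega> i j f (weak_deriv \<Omega> i j f)" "weak_deriv \<Omega> i j f \<in> members (Lp \<Omega> p)"
    using is_weak_deriv_weak_deriv[OF p g] weak_deriv_members[OF p g] .
  then show "0 \<le> fnorm (Lp \<Omega> p) (weak_deriv \<Omega> i j f)"
    using quasi_norm_onD(4)[OF quasi_norm_Lp[OF p]] by blast
qed

lemma quasi_norm_Sobolev: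
  assumes p: "p = 2 \<or> p = \<infinity>"
  shows "quasi_norm_on (members (Sobolev \<Omega> k p)) (fnorm (Sobolev \<Omega> k p))"
  unfolding quasi_norm_on_def
proof (intro conjI ballI allI)
  note q = quasi_norm_onD[OF quasi_norm_Lp[OF p]]
  fix f g assume f: "f \<in> members (Sobolev \<Omega> k p)" and g: "g \<in> members (Sobolev \<Omega> k p)"
  have w: "is_weak_deriv \<Omega> i j (\<lambda>z. f z + g z) (\<lambda>z. weak_deriv \<Omega> i j f z + weak_deriv \<Omega> i j g z)"
    "(\<lambda>z. weak_deriv \<Omega> i j f z + weak_deriv \<Omega> i j g z) \<in> members (Lp \<Omega> p)" if "i + j \<le> k" for i j
    using Sobolev_weak_deriv[OF p f that] Sobolev_weak_deriv[OF p g that]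
    by (auto intro: is_weak_deriv_add q(1))
  then show "(\<lambda>z. f z + g z) \<in> members (Sobolev \<Omega> k p)"
    using f g q(1) unfolding members_Sobolev by blast
  have le: "fnorm (Lp \<Omega> p) (weak_deriv \<Omega> i j (\<lambda>z. f z + g z))
      \<le> 2 * (fnorm (Lp \<Omega> p) (weak_deriv \<Omega> i j f) + fnorm (Lp \<Omega> p) (weak_deriv \<Omega> i j g))" if "i + j \<le> k" for i j
    unfolding fnorm_weak_deriv[OF p w(2,1)[OF that]]
    using Sobolev_weak_deriv[OF p f that] Sobolev_weak_deriv[OF p g that] by (intro q(2)) auto
  show "fnorm (Sobolev \<Omega> k p) (\<lambda>z. f z + g z) \<le> 2 * (fnorm (Sobolev \<Omega> k p) f + fnorm (Sobolev \<Omega> k p) g)"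
    unfolding fnorm_Sobolev sum.distrib[symmetric] sum_distrib_left
    by (intro sum_mono le) auto
next
  fix f and l :: complex assume f: "f \<in> members (Sobolev \<Omega> k p)"
  have "is_weak_deriv \<Omega> i j (\<lambda>z. l * f z) (\<lambda>z. l * weak_deriv \<Omega> i j f z)"
    "(\<lambda>z. l * weak_deriv \<Omega> i j f z) \<in> members (Lp \<Omega> p)" if "i + j \<le> k" for i j
    using Sobolev_weak_deriv[OF p f that] quasi_norm_onD(3)[OF quasi_norm_Lp[OF p]]
    by (auto intro: is_weak_deriv_cmult)
  then show "(\<lambda>z. l * f z) \<in> members (Sobolev \<Omega> k p)"
    using f quasi_norm_onD(3)[OF quasi_norm_Lp[OF p]] unfolding members_Sobolev by blast
next
  fix f assume f: "f \<in> members (Sobolev \<Omega> k p)"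
  show "0 \<le> fnorm (Sobolev \<Omega> k p) f"
    unfolding fnorm_Sobolev using Sobolev_weak_deriv(3)[OF p f] by (intro sum_nonneg) auto
qed

text \<open>How Sobolev regularity enters the estimates: derivatives of the test function are moved to \<open>f\<close>, and the
test function then enters only through its integral.\<close>

lemma Sobolev_test_bound:
  assumes f: "f \<in> members (Sobolev \<Omega> k \<infinity>)" and ij: "i + j \<le> k" and \<phi>: "\<phi> \<in> test_functions \<Omega>"
  shows "cmod (pairing f (pd i j \<phi>)) \<le> L1_norm \<phi> * fnorm (Sobolev \<Omega> k \<infinity>) f"
proof -
  note w = Sobolev_weak_deriv[OF disjI2[OF refl] f]
  have "cmod (pairing f (pd i j \<phi>))
      = cmod (pairing (weak_deriv \<Omega> i j f) \<phi>)"
    using w(1)[OF ij] \<phi> unfolding is_weak_deriv_def by (simp add: norm_mult norm_power)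
  also have "\<dots> \<le> L1_norm \<phi> * fnorm (Lp \<Omega> \<infinity>) (weak_deriv \<Omega> i j f)"
    by (rule Lp_infty_test_bound[OF w(2)[OF ij] \<phi>])
  also have "\<dots> \<le> L1_norm \<phi> * fnorm (Sobolev \<Omega> k \<infinity>) f"
  proof (rule mult_left_mono)
    have "fnorm (Lp \<Omega> \<infinity>) (weak_deriv \<Omega> i j f) \<le> (\<Sum>j\<le>k - i. fnorm (Lp \<Omega> \<infinity>) (weak_deriv \<Omega> i j f))"
      using ij w(3) by (intro member_le_sum) auto
    also have "\<dots> \<le> (\<Sum>i\<le>k. \<Sum>j\<le>k - i. fnorm (Lp \<Omega> \<infinity>) (weak_deriv \<Omega> i j f))"
      using ij w(3) by (intro member_le_sum[where f = "\<lambda>i. \<Sum>j\<le>k - i. fnorm (Lp \<Omega> \<infinity>) (weak_deriv \<Omega> i j f)"])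
        (auto intro!: sum_nonneg)
    finally show "fnorm (Lp \<Omega> \<infinity>) (weak_deriv \<Omega> i j f) \<le> fnorm (Sobolev \<Omega> k \<infinity>) f"
      by (simp add: fnorm_Sobolev)
    show "0 \<le> L1_norm \<phi>" by (simp add: L1_norm_def integral_nonneg_AE)
  qed
  finally show ?thesis .
qed

end

section \<open>Taylor expansion of translated pairings\<close>

lemma taylor_cubic_remainder:
  fixes G :: "nat \<Rightarrow> real \<Rightarrow> complex"
  assumes der: "\<And>i s. i < 4 \<Longrightarrow> s \<in> {0..h} \<Longrightarrow> (G i has_vector_derivative G (Suc i) s) (at s)"
    and bd: "\<And>s. s \<in> {0..h} \<Longrightarrow> cmod (G 4 s) \<le> M" and h: "0 \<le> h"
  shows "cmod (G 0 h - (\<Sum>i<4. (h ^ i / fact i) *\<^sub>R G i 0)) \<le> M * h ^ 4"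
proof -
  have M: "0 \<le> M" using bd[of 0] h order_trans[OF norm_ge_zero] by simp
  have I: "((\<lambda>s. ((h - s) ^ (4 - 1) / fact (4 - 1)) *\<^sub>R G 4 s) has_integral
      G 0 h - (\<Sum>i<4. ((h - 0) ^ i / fact i) *\<^sub>R G i 0)) {0..h}"
    by (rule Taylor_has_integral) (use h der in \<open>auto intro: has_vector_derivative_at_within\<close>)
  have "norm (G 0 h - (\<Sum>i<4. ((h - 0) ^ i / fact i) *\<^sub>R G i 0)) \<le> (h ^ 3 * M) * measure lborel {0..h}"
  proof (rule has_integral_bound_real[OF _ _ I, where S = "{}"])
    show "norm (((h - s) ^ (4 - 1) / fact (4 - 1)) *\<^sub>R G 4 s) \<le> h ^ 3 * M" if "s \<in> {0..h} - {}" for s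
    proof -
      have "(h - s) ^ 3 / fact 3 \<le> (h - s) ^ 3 / 1"
        using that by (intro divide_left_mono) auto
      also have "\<dots> \<le> h ^ 3" using that by (simp add: power_mono)
      finally have "(h - s) ^ 3 / fact 3 * cmod (G 4 s) \<le> h ^ 3 * M"
        using bd[of s] that h by (intro mult_mono) auto
      then show ?thesis using that by simp
    qed
  qed (use h M in auto)
  then show ?thesis using h by (simp add: eval_nat_numeral mult_ac)
qed

text \<open>The cubic Taylor polynomials at \<open>h\<close> and \<open>-h\<close> add up to \<open>2 G(0) + h\<^sup>2 G''(0)\<close>, so only the two remainders
of fourth order are left.\<close>

lemma symmetric_taylor:
  fixes G :: "nat \<Rightarrow> real \<Rightarrow> complex"
  assumes der: "\<And>i s. i < 4 \<Longrightarrow> s \<in> {-h..h} \<Longrightarrow> (G i has_vector_derivative G (Suc i) s) (at s)"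
    and bd: "\<And>s. s \<in> {-h..h} \<Longrightarrow> cmod (G 4 s) \<le> M" and h: "0 \<le> h"
  shows "cmod (G 0 h - 2 * G 0 0 + G 0 (-h) - of_real (h\<^sup>2) * G 2 0) \<le> 2 * M * h ^ 4"
proof -
  define G' where "G' i s = (-1) ^ i * G i (- s)" for i s
  have der': "(G' i has_vector_derivative G' (Suc i) s) (at s)" if "i < 4" "s \<in> {0..h}" for i s
  proof -
    have "(uminus has_vector_derivative -1) (at s)" by (auto intro!: derivative_eq_intros)
    from vector_diff_chain_at[OF this, of "G i" "G (Suc i) (-s)"] der[of i "-s"] that
    have "((\<lambda>s. G i (- s)) has_vector_derivative - G (Suc i) (- s)) (at s)" by (simp add: o_def)
    from has_vector_derivative_mult_right[OF this, of "(-1) ^ i"]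
    show ?thesis unfolding G'_def by simp
  qed
  have 1: "cmod (G 0 h - (\<Sum>i<4. (h ^ i / fact i) *\<^sub>R G i 0)) \<le> M * h ^ 4"
    by (rule taylor_cubic_remainder) (use der bd h in auto)
  have 2: "cmod (G' 0 h - (\<Sum>i<4. (h ^ i / fact i) *\<^sub>R G' i 0)) \<le> M * h ^ 4"
    by (rule taylor_cubic_remainder[of h G' M, OF der' _ h]) (use bd in \<open>simp_all add: G'_def norm_mult norm_power\<close>)
  have eq: "G 0 h - 2 * G 0 0 + G 0 (-h) - of_real (h\<^sup>2) * G 2 0
    = (G 0 h - (\<Sum>i<4. (h ^ i / fact i) *\<^sub>R G i 0)) + (G' 0 h - (\<Sum>i<4. (h ^ i / fact i) *\<^sub>R G' i 0))"
    by (simp add: G'_def eval_nat_numeral scaleR_conv_of_real algebra_simps)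
  show ?thesis
    unfolding eq by (rule order_trans[OF norm_triangle_le[OF add_mono[OF 1 2]]]) simp
qed

lemma second_order_remainder:
  assumes f: "flat_alg f" and C: "\<And>x. \<bar>deriv (deriv f) x\<bar> \<le> C"
  shows "\<bar>f y - f x - (y - x) * deriv f x\<bar> \<le> C * (y - x)\<^sup>2"
proof -
  have b1: "\<bar>deriv f t - deriv f x\<bar> \<le> C * \<bar>t - x\<bar>" for t
  proof -
    have "norm (deriv f t - deriv f x) \<le> C * norm (t - x)"
      by (rule field_differentiable_bound[where S = UNIV and f' = "deriv (deriv f)"])
        (use C flat_alg_has_derivative[OF flat_alg_deriv[OF f]] in auto)
    then show ?thesis by simp
  qed
  have C0: "0 \<le> C" using C[of 0] by linarith
  let ?S = "{min x y..max x y}"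
  have "norm ((f y - y * deriv f x) - (f x - x * deriv f x)) \<le> (C * \<bar>y - x\<bar>) * norm (y - x)"
  proof (rule field_differentiable_bound[where S = ?S and f' = "\<lambda>t. deriv f t - deriv f x"])
    fix t assume t: "t \<in> ?S"
    show "((\<lambda>t. f t - t * deriv f x) has_real_derivative deriv f t - deriv f x) (at t within ?S)"
      using flat_alg_has_derivative[OF f, of t]
      by (auto intro!: derivative_eq_intros intro: has_field_derivative_at_within)
    have "\<bar>t - x\<bar> \<le> \<bar>y - x\<bar>" using t by auto
    then show "norm (deriv f t - deriv f x) \<le> C * \<bar>y - x\<bar>"
      using b1[of t] C0 by (auto intro: order_trans mult_left_mono)
  qed auto
  then show ?thesis by (simp add: algebra_simps power2_eq_square abs_mult_self_eq)
qed

lemma vector_derivative_if_quadratic: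
  fixes F :: "real \<Rightarrow> complex"
  assumes "\<And>r. cmod (F r - F s - of_real (r - s) * D) \<le> C * (r - s)\<^sup>2"
  shows "(F has_vector_derivative D) (at s)"
proof -
  have "((\<lambda>r. norm (F r - F s - (r - s) *\<^sub>R D) / norm (r - s)) \<longlongrightarrow> 0) (at s)"
  proof (rule Lim_null_comparison)
    show "\<forall>\<^sub>F r in at s. norm (norm (F r - F s - (r - s) *\<^sub>R D) / norm (r - s)) \<le> C * \<bar>r - s\<bar>"
    proof (rule eventually_at_filter[THEN iffD2], rule always_eventually, intro allI impI)
      fix r assume "r \<noteq> s"
      then show "norm (norm (F r - F s - (r - s) *\<^sub>R D) / norm (r - s)) \<le> C * \<bar>r - s\<bar>"
        using assms[of r] by (simp add: scaleR_conv_of_real divide_le_eq power2_eq_square mult.assoc)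
    qed
    have "((\<lambda>r. C * \<bar>r - s\<bar>) \<longlongrightarrow> C * \<bar>s - s\<bar>) (at s)" by (intro tendsto_intros)
    then show "((\<lambda>r. C * \<bar>r - s\<bar>) \<longlongrightarrow> 0) (at s)" by simp
  qed
  then show ?thesis
    unfolding has_vector_derivative_def has_derivative_iff_norm
    by (simp add: bounded_linear_scaleR_left)
qed

context rectangle
begin

lemma integrable_times_smooth:
  assumes u: "integrable Leb u"
    and f: "flat_alg f" "vanishes_off {\<alpha>..\<beta>} f" and g: "flat_alg g" "vanishes_off {\<gamma>..\<delta>} g"
  shows "integrable Leb (\<lambda>z. u z * tensor f g z)"
proof -
  have tp: "test_pair UNIV f g" unfolding test_pair_def using f g by auto
  obtain B where B: "B \<ge> 0" "\<And>z. cmod (tensor f g z) \<le> B" using tensor_bounded[OF tp] by metis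
  have "integrable Leb (\<lambda>z. of_real B * u z)" using u by simp
  then show ?thesis
  proof (rule Bochner_Integration.integrable_bound)
    show "AE z in Leb. norm (u z * tensor f g z) \<le> norm (of_real B * u z)"
      using B by (auto simp: norm_mult mult.commute[of B] intro!: mult_left_mono)
  qed (intro borel_measurable_times borel_measurable_integrable[OF u] tensor_measurable(3)[OF tp])
qed

lemma pairing_derivative_parameter:
  fixes \<psi> :: "real \<Rightarrow> cfun"
  assumes u: "integrable Leb u"
    and i: "\<And>r. integrable Leb (\<lambda>z. u z * \<psi> r z)" "integrable Leb (\<lambda>z. u z * \<psi>' z)"
    and rem: "\<And>r z. cmod (\<psi> r z - \<psi> s z - of_real (r - s) * \<psi>' z) \<le> C * (r - s)\<^sup>2"
  shows "((\<lambda>s. pairing u (\<psi> s)) has_vector_derivative (pairing u \<psi>')) (at s)"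
proof (rule vector_derivative_if_quadratic[where C = "C * (LINT z|Leb. cmod (u z))"])
  fix r
  let ?R = "\<lambda>z. u z * (\<psi> r z - \<psi> s z - of_real (r - s) * \<psi>' z)"
  have eq: "?R z = u z * \<psi> r z - u z * \<psi> s z - of_real (r - s) * (u z * \<psi>' z)" for z
    by (simp add: algebra_simps)
  have iR: "integrable Leb ?R"
    unfolding eq using i by (intro Bochner_Integration.integrable_diff integrable_mult_right)
  have "pairing u (\<psi> r) - pairing u (\<psi> s) - of_real (r - s) * pairing u \<psi>' = (LINT z|Leb. ?R z)"
    unfolding eq using i by simp
  also have "cmod \<dots> \<le> (LINT z|Leb. cmod (u z) * (C * (r - s)\<^sup>2))"
  proof (rule integral_norm_bound[THEN order_trans], rule integral_mono)
    show "integrable Leb (\<lambda>z. cmod (?R z))" by (rule integrable_norm[OF iR])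
    show "integrable Leb (\<lambda>z. cmod (u z) * (C * (r - s)\<^sup>2))"
      using u by (intro integrable_mult_left integrable_norm)
    show "cmod (?R z) \<le> cmod (u z) * (C * (r - s)\<^sup>2)" for z
      unfolding norm_mult by (intro mult_left_mono rem) auto
  qed
  finally show "cmod (pairing u (\<psi> r) - pairing u (\<psi> s) - of_real (r - s) * pairing u \<psi>')
      \<le> C * (LINT z|Leb. cmod (u z)) * (r - s)\<^sup>2"
    by (simp add: mult_ac)
qed

text \<open>Translating the test function, rather than \<open>u\<close>, lets a merely integrable \<open>u\<close> be differentiated in space. The
quadratic remainder of the translated factor is uniform because its second derivative is bounded.\<close>

lemma translated_testing_derivative:
  assumes u: "integrable Leb u"
    and f: "flat_alg f" "vanishes_off {\<alpha>..\<beta>} f" and g: "flat_alg g" "vanishes_off {\<gamma>..\<delta>} g"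
  shows "((\<lambda>s. pairing u (tensor (\<lambda>x. f (x - s)) g)) has_vector_derivative
      - pairing u (tensor (\<lambda>x. deriv f (x - s)) g)) (at s)" (is ?X)
    and "((\<lambda>s. pairing u (tensor g (\<lambda>x. f (x - s)))) has_vector_derivative
      - pairing u (tensor g (\<lambda>x. deriv f (x - s)))) (at s)" (is ?Y)
proof -
  have f': "flat_alg (deriv f)" "vanishes_off {\<alpha>..\<beta>} (deriv f)"
    and f'': "flat_alg (deriv (deriv f))" "vanishes_off {\<alpha>..\<beta>} (deriv (deriv f))"
    using f by (auto intro!: flat_alg_deriv vanishes_off_deriv)
  obtain C where C: "\<And>x. \<bar>deriv (deriv f) x\<bar> \<le> C" using flat_alg_bounded[OF f''] by metis
  obtain B where B: "B \<ge> 0" "\<And>x. \<bar>g x\<bar> \<le> B" using flat_alg_bounded[OF g] by metis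
  have tr: "flat_alg (\<lambda>x. k (x - s))" "vanishes_off {\<alpha> + s..\<beta> + s} (\<lambda>x. k (x - s))"
    if "flat_alg k" "vanishes_off {\<alpha>..\<beta>} k" for k s
    using that flat_alg_translate by (auto simp: vanishes_off_def)
  have rem: "\<bar>(f (x - r) - f (x - s) - (r - s) * (- deriv f (x - s))) * g y\<bar> \<le> C * B * (r - s)\<^sup>2" for x y r s
  proof -
    have "\<bar>f (x - r) - f (x - s) - (r - s) * (- deriv f (x - s))\<bar> \<le> C * (r - s)\<^sup>2"
      using second_order_remainder[OF f(1) C, of "x - r" "x - s"] by (simp add: algebra_simps power2_commute)
    then have "\<bar>f (x - r) - f (x - s) - (r - s) * (- deriv f (x - s))\<bar> * \<bar>g y\<bar> \<le> (C * (r - s)\<^sup>2) * B"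
      using B C[of 0] by (intro mult_mono) auto
    then show ?thesis by (simp add: abs_mult mult_ac)
  qed
  have neg: "pairing u (\<lambda>z. - \<phi> z) = - pairing u \<phi>" for \<phi> by simp
  have ineg: "integrable Leb (\<lambda>z. u z * - \<phi> z)" if "integrable Leb (\<lambda>z. u z * \<phi> z)" for \<phi>
    using that by simp
  show ?X
    unfolding neg[symmetric]
  proof (rule pairing_derivative_parameter[OF u integrable_times_smooth[OF u tr[OF f] g]
        ineg[OF integrable_times_smooth[OF u tr[OF f'] g]]])
    fix r z
    have "tensor (\<lambda>x. f (x - r)) g z - tensor (\<lambda>x. f (x - s)) g z - of_real (r - s) * - tensor (\<lambda>x. deriv f (x - s)) g z
      = of_real ((f (fst z - r) - f (fst z - s) - (r - s) * (- deriv f (fst z - s))) * g (snd z))"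
      by (simp add: tensor_def case_prod_unfold algebra_simps)
    then show "cmod (tensor (\<lambda>x. f (x - r)) g z - tensor (\<lambda>x. f (x - s)) g z
        - of_real (r - s) * - tensor (\<lambda>x. deriv f (x - s)) g z) \<le> C * B * (r - s)\<^sup>2"
      using rem by (simp only: norm_of_real)
  qed
  show ?Y
    unfolding neg[symmetric]
  proof (rule pairing_derivative_parameter[OF u integrable_times_smooth[OF u g tr[OF f]]
        ineg[OF integrable_times_smooth[OF u g tr[OF f']]]])
    fix r z
    have "tensor g (\<lambda>x. f (x - r)) z - tensor g (\<lambda>x. f (x - s)) z - of_real (r - s) * - tensor g (\<lambda>x. deriv f (x - s)) z
      = of_real ((f (snd z - r) - f (snd z - s) - (r - s) * (- deriv f (snd z - s))) * g (fst z))"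
      by (simp add: tensor_def case_prod_unfold algebra_simps)
    then show "cmod (tensor g (\<lambda>x. f (x - r)) z - tensor g (\<lambda>x. f (x - s)) z
        - of_real (r - s) * - tensor g (\<lambda>x. deriv f (x - s)) z) \<le> C * B * (r - s)\<^sup>2"
      using rem by (simp only: norm_of_real)
  qed
qed

end

section \<open>Point values from shrinking bumps\<close>

lemma bump_translate: "(\<lambda>x. bump n \<alpha> \<beta> (x - s)) = bump n (\<alpha> + s) (\<beta> + s)"
  by (simp add: bump_def algebra_simps fun_eq_iff)

definition spot :: "real \<Rightarrow> real \<times> real \<Rightarrow> cfun" where
  "spot \<eta> p = tensor (bump 1 (fst p - \<eta>) (fst p + \<eta>)) (bump 1 (snd p - \<eta>) (snd p + \<eta>))"

definition square :: "real \<Rightarrow> real \<times> real \<Rightarrow> (real \<times> real) set" where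
  "square \<eta> p = {fst p - \<eta>..fst p + \<eta>} \<times> {snd p - \<eta>..snd p + \<eta>}"

lemma spot_test_pair:
  "square \<eta> p \<subseteq> \<Omega> \<Longrightarrow>
    test_pair \<Omega> (bump 1 (fst p - \<eta>) (fst p + \<eta>)) (bump 1 (snd p - \<eta>) (snd p + \<eta>))"
  unfolding test_pair_def square_def using bump_smooth bump_vanishes zero_less_one by metis

lemma spot_test_function: "square \<eta> p \<subseteq> \<Omega> \<Longrightarrow> spot \<eta> p \<in> test_functions \<Omega>"
  unfolding spot_def by (intro test_pair_test_function spot_test_pair)

lemma spot_off: "z \<notin> square \<eta> p \<Longrightarrow> spot \<eta> p z = 0"
  using bump_vanishes[of 1]
  by (cases z) (auto simp: spot_def tensor_def square_def vanishes_off_def)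

lemma spot_nonneg: "spot \<eta> p z = complex_of_real (cmod (spot \<eta> p z))"
  by (simp add: spot_def tensor_def case_prod_unfold norm_mult bump_nonneg abs_of_nonneg)

lemma spot_measurable: "spot \<eta> p \<in> borel_measurable borel"
  unfolding spot_def
  by (intro borel_measurable_continuous_onI continuous_on_tensor bump_smooth)

lemma flog_norm_bound: "cmod (flog z) \<le> 2 * sqrt (cmod z)" if "cmod z \<le> 1"
proof (cases "z = 0")
  case False
  let ?r = "cmod z"
  have r: "0 < ?r" using False by simp
  have "ln (1 / sqrt ?r) \<le> 1 / sqrt ?r"
    using r ln_le_minus_one[of "1 / sqrt ?r"] by simp
  then have "- ln ?r \<le> 2 / sqrt ?r"
    using r by (simp add: ln_div ln_sqrt)
  then have "\<bar>ln ?r\<bar> \<le> 2 / sqrt ?r" using r that by (simp add: abs_if)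
  then have "?r * \<bar>ln ?r\<bar> \<le> ?r * (2 / sqrt ?r)" using r by (intro mult_left_mono) auto
  also have "\<dots> = 2 * sqrt ?r" using r by (simp add: field_simps)
  finally show ?thesis by (simp add: flog_def norm_mult)
qed (simp add: flog_def)

lemma continuous_flog: "continuous_on UNIV flog"
proof (rule continuous_at_imp_continuous_on, rule ballI)
  fix z :: complex
  show "isCont flog z"
  proof (cases "z = 0")
    case True
    have "(flog \<longlongrightarrow> 0) (at 0)"
    proof (rule Lim_null_comparison)
      show "\<forall>\<^sub>F z in at 0. norm (flog z) \<le> 2 * sqrt (cmod z)"
        using flog_norm_bound by (auto simp: eventually_at intro!: exI[of _ 1])
      have "((\<lambda>z. 2 * sqrt (cmod z)) \<longlongrightarrow> 2 * sqrt (cmod (0::complex))) (at 0)"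
        by (intro tendsto_intros)
      then show "((\<lambda>z::complex. 2 * sqrt (cmod z)) \<longlongrightarrow> 0) (at 0)" by simp
    qed
    then show ?thesis using True by (simp add: isCont_def flog_def[of 0])
  next
    case False
    then show ?thesis unfolding flog_def by (intro continuous_intros) auto
  qed
qed

text \<open>The arithmetic that turns pairings into point values. Here \<open>I\<close> is the integral of the bump; capital letters are pairings
with the bump and its translates, small letters the corresponding point values, and \<open>e I\<close> bounds the error of
replacing a pairing by the point value times \<open>I\<close>. The hypothesis \<open>pde\<close> is the equation tested with the bump at the earlier time.\<close>

lemma combine_errors:
  fixes u0 u1 vp vm wp wm n0 A0 A1 Xp Xm Yp Ym Nl P Q P' Q' D :: complex
  assumes I: "I > 0" and \<tau>: "\<tau> > 0" and k: "k > 0" and l: "l > 0"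
    and time: "cmod (A1 - A0 - of_real \<tau> * D) \<le> (I * m1) * \<tau>\<^sup>2"
    and x: "cmod (Xp - 2 * A1 + Xm - of_real (k\<^sup>2) * P') \<le> 2 * (I * m3) * k ^ 4"
    and y: "cmod (Yp - 2 * A1 + Ym - of_real (l\<^sup>2) * Q') \<le> 2 * (I * m3) * l ^ 4"
    and p: "cmod (P' - P) \<le> (I * m2) * \<tau>" and q: "cmod (Q' - Q) \<le> (I * m2) * \<tau>"
    and pde: "\<i> * D + (P + Q) = 2 * of_real lam * Nl"
    and e: "cmod (A0 - u0 * of_real I) \<le> e * I" "cmod (A1 - u1 * of_real I) \<le> e * I"
      "cmod (Xp - vp * of_real I) \<le> e * I" "cmod (Xm - vm * of_real I) \<le> e * I"
      "cmod (Yp - wp * of_real I) \<le> e * I" "cmod (Ym - wm * of_real I) \<le> e * I"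
      "cmod (Nl - n0 * of_real I) \<le> e * I"
  shows "cmod (\<i> * ((u1 - u0) / of_real \<tau>) + ((vp - 2 * u1 + vm) / of_real (k\<^sup>2)
      + (wp - 2 * u1 + wm) / of_real (l\<^sup>2)) - 2 * of_real lam * n0)
    \<le> (m1 * \<tau> + 2 * m2 * \<tau> + 2 * m3 * (k\<^sup>2 + l\<^sup>2)) + (2 / \<tau> + 4 / k\<^sup>2 + 4 / l\<^sup>2 + 2 * \<bar>lam\<bar>) * e"
    (is "cmod ?R \<le> ?B + ?K * e")
proof -
  define e0 e1 exp exm eyp eym en where ed: "e0 = A0 - u0 * of_real I" "e1 = A1 - u1 * of_real I"
      "exp = Xp - vp * of_real I" "exm = Xm - vm * of_real I"
      "eyp = Yp - wp * of_real I" "eym = Ym - wm * of_real I" "en = Nl - n0 * of_real I"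
  define t1 t2 t3 where td: "t1 = A1 - A0 - of_real \<tau> * D" "t2 = Xp - 2 * A1 + Xm - of_real (k\<^sup>2) * P'"
    "t3 = Yp - 2 * A1 + Ym - of_real (l\<^sup>2) * Q'"
  have nz: "complex_of_real \<tau> \<noteq> 0" "complex_of_real (k\<^sup>2) \<noteq> 0" "complex_of_real (l\<^sup>2) \<noteq> 0"
    using \<tau> k l by auto
  have r1: "(u1 - u0) * of_real I = t1 + of_real \<tau> * D - (e1 - e0)"
    by (simp add: ed td algebra_simps)
  have r2: "(vp - 2 * u1 + vm) * of_real I = t2 + of_real (k\<^sup>2) * P' - (exp - 2 * e1 + exm)"
    by (simp add: ed td algebra_simps)
  have r3: "(wp - 2 * u1 + wm) * of_real I = t3 + of_real (l\<^sup>2) * Q' - (eyp - 2 * e1 + eym)"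
    by (simp add: ed td algebra_simps)
  have r4: "2 * of_real lam * n0 * of_real I = \<i> * D + (P + Q) - 2 * of_real lam * en"
    unfolding pde by (simp add: ed algebra_simps)
  have s: "?R * of_real I = \<i> * (((u1 - u0) * of_real I) / of_real \<tau>)
      + (((vp - 2 * u1 + vm) * of_real I) / of_real (k\<^sup>2)
      + ((wp - 2 * u1 + wm) * of_real I) / of_real (l\<^sup>2)) - 2 * of_real lam * n0 * of_real I"
    by (simp add: algebra_simps add_divide_distrib diff_divide_distrib)
  have "?R * of_real I = \<i> * (t1 / of_real \<tau>) + t2 / of_real (k\<^sup>2) + t3 / of_real (l\<^sup>2) + (P' - P) + (Q' - Q)
      - \<i> * ((e1 - e0) / of_real \<tau>) - (exp - 2 * e1 + exm) / of_real (k\<^sup>2)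
      - (eyp - 2 * e1 + eym) / of_real (l\<^sup>2) + 2 * of_real lam * en"
    unfolding s r1 r2 r3 r4 using nz by (simp add: add_divide_distrib diff_divide_distrib algebra_simps)
  also have "cmod \<dots> \<le> cmod (\<i> * (t1 / of_real \<tau>)) + cmod (t2 / of_real (k\<^sup>2)) + cmod (t3 / of_real (l\<^sup>2))
      + cmod (P' - P) + cmod (Q' - Q) + cmod (\<i> * ((e1 - e0) / of_real \<tau>)) + cmod ((exp - 2 * e1 + exm) / of_real (k\<^sup>2))
      + cmod ((eyp - 2 * e1 + eym) / of_real (l\<^sup>2)) + cmod (2 * of_real lam * en)"
    by (intro order_trans[OF norm_triangle_ineq] order_trans[OF norm_triangle_ineq4] add_mono order_refl)
  also have "\<dots> \<le> (I * m1) * \<tau> + 2 * (I * m3) * k\<^sup>2 + 2 * (I * m3) * l\<^sup>2 + (I * m2) * \<tau> + (I * m2) * \<tau>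
      + (2 * (e * I)) / \<tau> + (4 * (e * I)) / k\<^sup>2 + (4 * (e * I)) / l\<^sup>2 + 2 * \<bar>lam\<bar> * (e * I)"
  proof (intro add_mono)
    have nk: "cmod (complex_of_real (k\<^sup>2)) = k\<^sup>2" and nl: "cmod (complex_of_real (l\<^sup>2)) = l\<^sup>2"
      by (simp_all only: norm_of_real abs_power2)
    show "cmod (\<i> * (t1 / of_real \<tau>)) \<le> (I * m1) * \<tau>"
      using time \<tau> by (simp add: td norm_mult norm_divide divide_le_eq power2_eq_square mult_ac)
    show "cmod (t2 / of_real (k\<^sup>2)) \<le> 2 * (I * m3) * k\<^sup>2"
      using x k unfolding td(2)[symmetric] unfolding norm_divide nk by (simp add: divide_le_eq eval_nat_numeral mult_ac)
    show "cmod (t3 / of_real (l\<^sup>2)) \<le> 2 * (I * m3) * l\<^sup>2"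
      using y l unfolding td(3)[symmetric] unfolding norm_divide nl by (simp add: divide_le_eq eval_nat_numeral mult_ac)
    have "cmod (e1 - e0) \<le> 2 * (e * I)"
      using norm_triangle_ineq4[of e1 e0] e(1,2) by (simp add: ed)
    then show "cmod (\<i> * ((e1 - e0) / of_real \<tau>)) \<le> (2 * (e * I)) / \<tau>"
      using \<tau> by (simp add: norm_mult norm_divide divide_right_mono)
    have e1: "cmod (2 * e1) \<le> 2 * (e * I)" using e(2) unfolding ed(2)[symmetric] by (simp add: norm_mult)
    have tri: "cmod (f - 2 * e1 + g) \<le> 4 * (e * I)" if "cmod f \<le> e * I" "cmod g \<le> e * I" for f g
      using norm_triangle_ineq[of "f - 2 * e1" g] norm_triangle_ineq4[of f "2 * e1"] that e1 by linarith
    show "cmod ((exp - 2 * e1 + exm) / of_real (k\<^sup>2)) \<le> (4 * (e * I)) / k\<^sup>2"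
      using tri[of exp exm] e(3,4) k unfolding ed(3,4)[symmetric] by (simp add: norm_divide norm_power divide_right_mono)
    show "cmod ((eyp - 2 * e1 + eym) / of_real (l\<^sup>2)) \<le> (4 * (e * I)) / l\<^sup>2"
      using tri[of eyp eym] e(5,6) l unfolding ed(5,6)[symmetric] by (simp add: norm_divide norm_power divide_right_mono)
    show "cmod (2 * of_real lam * en) \<le> 2 * \<bar>lam\<bar> * (e * I)"
      using e(7) unfolding ed(7)[symmetric] by (simp add: norm_mult mult_left_mono)
  qed (use p q in auto)
  also have "\<dots> = (?B + ?K * e) * I" by (simp add: algebra_simps add_divide_distrib)
  finally have "cmod ?R * I \<le> (?B + ?K * e) * I" using I by (simp add: norm_mult)
  then show ?thesis using I by simp
qed

context rectangle
begin

text \<open>All bumps of the same width have the same integral, wherever they are centred, by translation invariance.\<close>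

lemma L1_norm_spot_lborel:
  assumes "square \<eta> p \<subseteq> \<Omega>"
  shows "L1_norm (spot \<eta> p) = (LINT z|lborel. cmod (spot \<eta> 0 z))"
proof -
  have m: "(\<lambda>z. cmod (spot \<eta> q z)) \<in> borel_measurable borel" for q
    by (rule measurable_compose[OF spot_measurable borel_measurable_norm])
  have "L1_norm (spot \<eta> p) = (LINT z|lebesgue. indicator \<Omega> z *\<^sub>R cmod (spot \<eta> p z))"
    by (simp add: L1_norm_def integral_restrict_space)
  also have "\<dots> = (LINT z|lebesgue. cmod (spot \<eta> p z))"
    by (rule Bochner_Integration.integral_cong) (use subsetD[OF assms] spot_off[of _ \<eta> p] in \<open>auto simp: indicator_def\<close>)
  also have "\<dots> = (LINT z|lborel. cmod (spot \<eta> p z))"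
    using m by (intro integral_completion) simp
  also have "\<dots> = (LINT z|distr lborel borel ((+) p). cmod (spot \<eta> p z))"
    by (simp add: lborel_distr_plus)
  also have "\<dots> = (LINT z|lborel. cmod (spot \<eta> p (p + z)))"
    using m by (intro integral_distr) auto
  also have "(\<lambda>z. spot \<eta> p (p + z)) = spot \<eta> 0"
    by (cases p) (auto simp: spot_def tensor_def bump_def fun_eq_iff algebra_simps)
  finally show ?thesis by (simp add: fun_eq_iff)
qed

lemma L1_norm_spot_eq: "square \<eta> p \<subseteq> \<Omega> \<Longrightarrow> square \<eta> q \<subseteq> \<Omega> \<Longrightarrow> L1_norm (spot \<eta> p) = L1_norm (spot \<eta> q)"
  by (simp add: L1_norm_spot_lborel)

lemma L1_norm_spot_pos:
  assumes "square \<eta> p \<subseteq> \<Omega>" and \<eta>: "0 < \<eta>"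
  shows "0 < L1_norm (spot \<eta> p)"
proof (rule ccontr)
  assume "\<not> 0 < L1_norm (spot \<eta> p)"
  moreover have "0 \<le> L1_norm (spot \<eta> p)" by (simp add: L1_norm_def integral_nonneg_AE)
  ultimately have "L1_norm (spot \<eta> p) = 0" by linarith
  then have "(LINT z|Leb. cmod (spot \<eta> p z)) = 0" by (simp only: L1_norm_def)
  moreover have "integrable Leb (\<lambda>z. cmod (spot \<eta> p z))"
    by (intro integrable_norm test_integrable spot_test_function assms(1))
  ultimately have "AE z in Leb. cmod (spot \<eta> p z) = 0"
    by (subst (asm) integral_nonneg_eq_0_iff_AE) auto
  then have ae: "AE z in lebesgue. z \<in> \<Omega> \<longrightarrow> cmod (spot \<eta> p z) = 0"
    by (simp add: AE_restrict_space_iff)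
  define B where "B = box (fst p - \<eta>, snd p - \<eta>) (fst p + \<eta>, snd p + \<eta>)"
  have B: "z \<in> \<Omega> \<and> spot \<eta> p z \<noteq> 0" if "z \<in> B" for z
  proof -
    have z: "fst p - \<eta> < fst z" "fst z < fst p + \<eta>" "snd p - \<eta> < snd z" "snd z < snd p + \<eta>"
      using that by (cases z; auto simp: B_def box_def Basis_prod_def)+
    then have "z \<in> square \<eta> p" by (cases z) (auto simp: square_def)
    moreover have "spot \<eta> p z \<noteq> 0"
      using bump_pos[of 1, OF _ z(1,2)] bump_pos[of 1, OF _ z(3,4)]
      by (simp add: spot_def tensor_def case_prod_unfold)
    ultimately show ?thesis using assms(1) by auto
  qed
  obtain N where N: "{z \<in> space lebesgue. \<not> (z \<in> \<Omega> \<longrightarrow> cmod (spot \<eta> p z) = 0)} \<subseteq> N" "N \<in> null_sets lebesgue"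
    using ae unfolding eventually_ae_filter by blast
  have "B \<subseteq> N"
  proof
    fix z assume "z \<in> B"
    then show "z \<in> N" using B[of z] by (intro subsetD[OF N(1)]) simp
  qed
  then have "negligible B" using N(2) negligible_iff_null_sets negligible_subset by blast
  moreover have "p \<in> B" using \<eta> by (cases p) (auto simp: B_def box_def Basis_prod_def)
  ultimately show False using open_not_negligible[of B] by (auto simp: B_def)
qed

lemma continuous_locally_integrable:
  assumes "continuous_on \<Omega> v"
  shows "locally_integrable \<Omega> (v :: cfun)"
  unfolding locally_integrable_def
proof safe
  fix K assume K: "compact K" "K \<subseteq> \<Omega>"
  have i: "integrable lborel (\<lambda>z. indicator K z *\<^sub>R v z)"
    using K continuous_on_subset[OF assms] by (intro borel_integrable_compact)
  then show "set_integrable lebesgue K v"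
    unfolding set_integrable_def
    by (subst integrable_completion) (auto dest: borel_measurable_integrable)
qed

text \<open>The bump is nonnegative, so pairing with it is an average times its integral.\<close>

lemma spot_eval:
  assumes v: "continuous_on \<Omega> v" and sq: "square \<eta> p \<subseteq> \<Omega>"
    and e: "\<And>z. z \<in> square \<eta> p \<Longrightarrow> cmod (v z - w) \<le> e"
  shows "cmod (pairing v (spot \<eta> p) - w * of_real (L1_norm (spot \<eta> p))) \<le> e * L1_norm (spot \<eta> p)"
proof -
  note \<phi> = spot_test_function[OF sq]
  have i: "integrable Leb (\<lambda>z. v z * spot \<eta> p z)"
    by (intro locally_integrable_times_test[OF \<phi>] continuous_locally_integrable v)
  have i2: "integrable Leb (\<lambda>z. w * spot \<eta> p z)"
    by (intro integrable_mult_right test_integrable[OF \<phi>])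
  have i3: "integrable Leb (\<lambda>z. (v z - w) * spot \<eta> p z)"
    using i i2 by (simp add: left_diff_distrib)
  have "(LINT z|Leb. spot \<eta> p z) = (LINT z|Leb. complex_of_real (cmod (spot \<eta> p z)))"
    by (intro Bochner_Integration.integral_cong spot_nonneg refl)
  also have "\<dots> = of_real (L1_norm (spot \<eta> p))" by (simp only: L1_norm_def integral_complex_of_real)
  finally have 1: "(LINT z|Leb. spot \<eta> p z) = of_real (L1_norm (spot \<eta> p))" .
  have "pairing v (spot \<eta> p) - w * of_real (L1_norm (spot \<eta> p))
      = (LINT z|Leb. (v z - w) * spot \<eta> p z)"
    unfolding left_diff_distrib Bochner_Integration.integral_diff[OF i i2] by (simp add: 1)
  also have "cmod \<dots> \<le> (LINT z|Leb. e * cmod (spot \<eta> p z))"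
  proof (rule integral_norm_bound[THEN order_trans], rule integral_mono)
    show "integrable Leb (\<lambda>z. cmod ((v z - w) * spot \<eta> p z))" by (rule integrable_norm[OF i3])
    show "integrable Leb (\<lambda>z. e * cmod (spot \<eta> p z))"
      by (intro integrable_mult_right integrable_norm test_integrable[OF \<phi>])
    show "cmod ((v z - w) * spot \<eta> p z) \<le> e * cmod (spot \<eta> p z)" for z
      using e[of z] spot_off[of z \<eta> p] by (cases "z \<in> square \<eta> p") (auto simp: norm_mult mult_right_mono)
  qed
  finally show ?thesis by (simp add: L1_norm_def)
qed

lemma eventually_square_small:
  assumes v: "continuous_on \<Omega> v" and p: "p \<in> \<Omega>" and e: "e > 0"
  shows "\<forall>\<^sub>F \<eta> in at_right 0. square \<eta> p \<subseteq> \<Omega> \<and> (\<forall>z\<in>square \<eta> p. cmod (v z - v p) \<le> e)"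
proof -
  obtain d1 where d1: "d1 > 0" "ball p d1 \<subseteq> \<Omega>" using open_\<Omega> p open_contains_ball by metis
  obtain d2 where d2: "d2 > 0" "\<And>z. z \<in> \<Omega> \<Longrightarrow> dist z p < d2 \<Longrightarrow> dist (v z) (v p) < e"
    using v p e unfolding continuous_on_iff by metis
  have "square \<eta> p \<subseteq> \<Omega> \<and> (\<forall>z\<in>square \<eta> p. cmod (v z - v p) \<le> e)" if \<eta>: "0 < \<eta>" "\<eta> < min d1 d2 / 2" for \<eta>
  proof -
    have near: "dist z p < min d1 d2" if "z \<in> square \<eta> p" for z
    proof -
      have "dist z p \<le> \<bar>fst z - fst p\<bar> + \<bar>snd z - snd p\<bar>"
        by (simp add: dist_prod_def dist_real_def) (rule sqrt_sum_squares_le_sum_abs)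
      also have "\<dots> \<le> 2 * \<eta>" using that by (auto simp: square_def)
      finally show ?thesis using \<eta> by simp
    qed
    have sub: "square \<eta> p \<subseteq> \<Omega>"
      using near d1(2) by (auto simp: subset_iff dist_commute)
    have "cmod (v z - v p) \<le> e" if "z \<in> square \<eta> p" for z
      using d2(2)[of z] near[OF that] sub that by (auto simp: dist_norm)
    with sub show ?thesis by blast
  qed
  then show ?thesis
    using d1(1) d2(1) unfolding eventually_at_right_field by (intro exI[of _ "min d1 d2 / 2"]) auto
qed

lemma second_difference_family:
  fixes \<psi> :: "nat \<Rightarrow> real \<Rightarrow> cfun"
  assumes der: "\<And>i s. ((\<lambda>s. pairing V (\<psi> i s)) has_vector_derivative - pairing V (\<psi> (Suc i) s)) (at s)"
    and bd: "\<And>s. s \<in> {-k..k} \<Longrightarrow> cmod (pairing V (\<psi> 4 s)) \<le> M" and k: "0 \<le> k"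
  shows "cmod (pairing V (\<psi> 0 k) - 2 * pairing V (\<psi> 0 0) + pairing V (\<psi> 0 (-k)) - of_real (k\<^sup>2) * pairing V (\<psi> 2 0))
    \<le> 2 * M * k ^ 4"
proof -
  define H where "H i s = (-1) ^ i * pairing V (\<psi> i s)" for i s
  have "cmod (H 0 k - 2 * H 0 0 + H 0 (-k) - of_real (k\<^sup>2) * H 2 0) \<le> 2 * M * k ^ 4"
  proof (rule symmetric_taylor[OF _ _ k])
    fix i s
    have "(H i has_vector_derivative (-1) ^ i * - pairing V (\<psi> (Suc i) s)) (at s)"
      unfolding H_def by (rule has_vector_derivative_mult_right[OF der])
    then show "(H i has_vector_derivative H (Suc i) s) (at s)" by (simp add: H_def)
  qed (use bd in \<open>simp add: H_def norm_mult norm_power\<close>)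
  then show ?thesis by (simp add: H_def)
qed

text \<open>Pairing \<open>V\<close> with the bump translated by \<open>s\<close> is a function of \<open>s\<close> with four derivatives; the fourth one is bounded by
the \<open>W\<^sup>4\<^sup>,\<^sup>\<infinity>\<close> norm. The symmetric Taylor expansion then compares second differences with second derivatives.\<close>

lemma second_difference_testing:
  assumes V: "V \<in> members (Sobolev \<Omega> 4 \<infinity>)" and m: "fnorm (Sobolev \<Omega> 4 \<infinity>) V \<le> m" and k: "0 \<le> k"
  shows "(\<And>s. s \<in> {-k..k} \<Longrightarrow> square \<eta> (x + s, y) \<subseteq> \<Omega>) \<Longrightarrow>
    cmod (pairing V (spot \<eta> (x + k, y)) - 2 * pairing V (spot \<eta> (x, y)) + pairing V (spot \<eta> (x - k, y))
      - of_real (k\<^sup>2) * pairing V (pd 2 0 (spot \<eta> (x, y)))) \<le> 2 * (L1_norm (spot \<eta> (x, y)) * m) * k ^ 4"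
    and "(\<And>s. s \<in> {-k..k} \<Longrightarrow> square \<eta> (x, y + s) \<subseteq> \<Omega>) \<Longrightarrow>
    cmod (pairing V (spot \<eta> (x, y + k)) - 2 * pairing V (spot \<eta> (x, y)) + pairing V (spot \<eta> (x, y - k))
      - of_real (k\<^sup>2) * pairing V (pd 0 2 (spot \<eta> (x, y)))) \<le> 2 * (L1_norm (spot \<eta> (x, y)) * m) * k ^ 4"
proof -
  have Vi: "integrable Leb V"
    using V by (intro Lp_infty_integrable) (simp add: members_Sobolev)
  define f g where "f = bump 1 (x - \<eta>) (x + \<eta>)" and "g = bump 1 (y - \<eta>) (y + \<eta>)"
  have f: "flat_alg f" "vanishes_off {x - \<eta>..x + \<eta>} f" and g: "flat_alg g" "vanishes_off {y - \<eta>..y + \<eta>} g"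
    by (auto simp: f_def g_def bump_smooth bump_vanishes)
  note F = flat_alg_deriv_funpow[OF f(1)] vanishes_off_deriv_funpow[OF f(2) closed_atLeastAtMost]
  note G = flat_alg_deriv_funpow[OF g(1)] vanishes_off_deriv_funpow[OF g(2) closed_atLeastAtMost]
  have sx: "spot \<eta> (x + s, y) = tensor (\<lambda>x. f (x - s)) g" for s
    by (simp add: spot_def f_def g_def bump_translate algebra_simps)
  have sy: "spot \<eta> (x, y + s) = tensor f (\<lambda>y. g (y - s))" for s
    by (simp add: spot_def f_def g_def bump_translate algebra_simps)
  have pdx: "pd i 0 (spot \<eta> (x + s, y)) = tensor (\<lambda>x. (deriv ^^ i) f (x - s)) g" for i s
    unfolding sx using f g by (simp add: pd_tensor flat_alg_translate deriv_funpow_translate)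
  have pdy: "pd 0 j (spot \<eta> (x, y + s)) = tensor f (\<lambda>y. (deriv ^^ j) g (y - s))" for j s
    unfolding sy using f g by (simp add: pd_tensor flat_alg_translate deriv_funpow_translate)
  have bd: "cmod (pairing V (pd i j (spot \<eta> p))) \<le> L1_norm (spot \<eta> (x, y)) * m"
    if "i + j \<le> 4" "square \<eta> p \<subseteq> \<Omega>" "square \<eta> (x, y) \<subseteq> \<Omega>" for i j p
  proof -
    have "cmod (pairing V (pd i j (spot \<eta> p))) \<le> L1_norm (spot \<eta> p) * fnorm (Sobolev \<Omega> 4 \<infinity>) V"
      by (rule Sobolev_test_bound[OF V that(1) spot_test_function[OF that(2)]])
    also have "\<dots> \<le> L1_norm (spot \<eta> p) * m" by (rule mult_left_mono[OF m]) (simp add: L1_norm_def integral_nonneg_AE)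
    finally show ?thesis using L1_norm_spot_eq[OF that(2,3)] by simp
  qed
  show "cmod (pairing V (spot \<eta> (x + k, y)) - 2 * pairing V (spot \<eta> (x, y)) + pairing V (spot \<eta> (x - k, y))
      - of_real (k\<^sup>2) * pairing V (pd 2 0 (spot \<eta> (x, y)))) \<le> 2 * (L1_norm (spot \<eta> (x, y)) * m) * k ^ 4"
    if sq: "\<And>s. s \<in> {-k..k} \<Longrightarrow> square \<eta> (x + s, y) \<subseteq> \<Omega>"
    using second_difference_family[of V "\<lambda>i s. tensor (\<lambda>x. (deriv ^^ i) f (x - s)) g" k "L1_norm (spot \<eta> (x, y)) * m", OF _ _ k]
      translated_testing_derivative(1)[OF Vi F g] bd[of 4 0, OF _ sq] sq[of 0] k pdx[of 2 0] sx[of k] sx[of "-k"] sx[of 0]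
    by (simp add: pdx)
  show "cmod (pairing V (spot \<eta> (x, y + k)) - 2 * pairing V (spot \<eta> (x, y)) + pairing V (spot \<eta> (x, y - k))
      - of_real (k\<^sup>2) * pairing V (pd 0 2 (spot \<eta> (x, y)))) \<le> 2 * (L1_norm (spot \<eta> (x, y)) * m) * k ^ 4"
    if sq: "\<And>s. s \<in> {-k..k} \<Longrightarrow> square \<eta> (x, y + s) \<subseteq> \<Omega>"
    using second_difference_family[of V "\<lambda>i s. tensor f (\<lambda>y. (deriv ^^ i) g (y - s))" k "L1_norm (spot \<eta> (x, y)) * m", OF _ _ k]
      translated_testing_derivative(2)[OF Vi G f] bd[of 0 4, OF _ sq] sq[of 0] k pdy[of 2 0] sy[of k] sy[of "-k"] sy[of 0]
    by (simp add: pdy)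
qed

end

section \<open>Consistency of the scheme\<close>

lemma vector_derivative_bound:
  fixes F :: "real \<Rightarrow> complex"
  assumes S: "convex S" and der: "\<And>s. s \<in> S \<Longrightarrow> (F has_vector_derivative F' s) (at s within S)"
    and bd: "\<And>s. s \<in> S \<Longrightarrow> cmod (F' s) \<le> B" and xy: "x \<in> S" "y \<in> S"
  shows "cmod (F x - F y) \<le> B * \<bar>x - y\<bar>"
proof -
  have "norm (F x - F y) \<le> B * norm (x - y)"
  proof (rule differentiable_bound[OF S, where f' = "\<lambda>r t. t *\<^sub>R F' r"])
    fix r assume r: "r \<in> S"
    show "(F has_derivative (\<lambda>t. t *\<^sub>R F' r)) (at r within S)"
      using der[OF r] by (simp add: has_vector_derivative_def)
    show "onorm (\<lambda>t. t *\<^sub>R F' r) \<le> B"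
      using bd[OF r] by (simp add: onorm_scaleR_left bounded_linear_ident onorm_id)
  qed (use xy in auto)
  then show ?thesis by simp
qed

lemma taylor_first_order:
  fixes F :: "real \<Rightarrow> complex"
  assumes der: "\<And>s. s \<in> {0..T} \<Longrightarrow> (F has_vector_derivative F' s) (at s within {0..T})"
    and der': "\<And>s. s \<in> {0..T} \<Longrightarrow> (F' has_vector_derivative F'' s) (at s within {0..T})"
    and bd: "\<And>s. s \<in> {0..T} \<Longrightarrow> cmod (F'' s) \<le> M" and rt: "t \<in> {0..T}" "r \<in> {0..T}"
  shows "cmod (F r - F t - of_real (r - t) * F' t) \<le> M * (r - t)\<^sup>2"
proof -
  have b1: "cmod (F' s - F' t) \<le> M * \<bar>s - t\<bar>" if "s \<in> {0..T}" for s
    using vector_derivative_bound[OF _ der' bd that rt(1)] by simp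
  have M: "0 \<le> M" using bd[OF rt(1)] norm_ge_zero order_trans by blast
  let ?S = "{min r t..max r t}"
  have sub: "?S \<subseteq> {0..T}" using rt by auto
  have "cmod ((F r - of_real r * F' t) - (F t - of_real t * F' t)) \<le> (M * \<bar>r - t\<bar>) * \<bar>r - t\<bar>"
  proof (rule vector_derivative_bound[where S = ?S and F' = "\<lambda>s. F' s - F' t"])
    fix s assume s: "s \<in> ?S"
    have "((\<lambda>s. complex_of_real s * F' t) has_vector_derivative of_real 1 * F' t) (at s within ?S)"
      by (intro has_vector_derivative_mult_left has_vector_derivative_of_real) auto
    moreover have "(F has_vector_derivative F' s) (at s within ?S)"
      using der[of s] s sub has_vector_derivative_within_subset by blast
    ultimately show "((\<lambda>s. F s - of_real s * F' t) has_vector_derivative F' s - F' t) (at s within ?S)"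
      using has_vector_derivative_diff by fastforce
    have "\<bar>s - t\<bar> \<le> \<bar>r - t\<bar>" using s by auto
    then have "M * \<bar>s - t\<bar> \<le> M * \<bar>r - t\<bar>" using M by (rule mult_left_mono)
    then show "cmod (F' s - F' t) \<le> M * \<bar>r - t\<bar>"
      using order_trans[OF b1[OF subsetD[OF sub s]]] by simp
  qed auto
  then show ?thesis by (simp add: algebra_simps power2_eq_square abs_mult_self_eq)
qed

locale smooth_solution = rectangle +
  fixes T lam :: real and u0 :: cfun and u :: "real \<Rightarrow> cfun" and X :: fspace
  assumes T: "0 < T" and sol: "log_schroedinger_solution \<Omega> lam u0 T u"
    and X_def: "X = inter_space (Sobolev \<Omega> 4 \<infinity>) (H10 \<Omega>)"
    and C2: "C_time 2 T (Lp \<Omega> \<infinity>) u" and C1: "C_time 1 T (Sobolev \<Omega> 2 \<infinity>) u" and C0: "C_time 0 T X u"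
begin

definition "m1 = C_time_norm 2 T (Lp \<Omega> \<infinity>) u"
definition "m2 = C_time_norm 1 T (Sobolev \<Omega> 2 \<infinity>) u"
definition "m3 = C_time_norm 0 T X u"

lemma Lp_bound: "i \<le> 2 \<Longrightarrow> t \<in> {0..T} \<Longrightarrow> fnorm (Lp \<Omega> \<infinity>) ((time_deriv T (Lp \<Omega> \<infinity>) ^^ i) u t) \<le> m1"
  unfolding m1_def by (rule fnorm_le_C_time_norm[OF quasi_norm_Lp_infty order_refl C2])

lemma Sobolev_bound:
  "i \<le> 1 \<Longrightarrow> t \<in> {0..T} \<Longrightarrow> fnorm (Sobolev \<Omega> 2 \<infinity>) ((time_deriv T (Sobolev \<Omega> 2 \<infinity>) ^^ i) u t) \<le> m2"
  unfolding m2_def by (rule fnorm_le_C_time_norm[OF quasi_norm_Sobolev order_refl C1]) auto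

lemma u_mem4: "t \<in> {0..T} \<Longrightarrow> u t \<in> members (Sobolev \<Omega> 4 \<infinity>)"
  using C_time_members[OF C0, of 0 t] by (simp add: X_def)

text \<open>The norm of the intersection space is the sum of two Sobolev norms, which is a quasi-norm on the intersection
of the two Sobolev spaces; the functions \<open>u(t)\<close> lie in that larger linear space.\<close>

lemma X_bound:
  assumes t: "t \<in> {0..T}"
  shows "fnorm (Sobolev \<Omega> 4 \<infinity>) (u t) \<le> m3"
proof -
  let ?M = "members (Sobolev \<Omega> 4 \<infinity>) \<inter> members (Sobolev \<Omega> 1 2)"
  note q4 = quasi_norm_onD[OF quasi_norm_Sobolev[of \<infinity> 4]]
  note q1 = quasi_norm_onD[OF quasi_norm_Sobolev[of 2 1]]
  have fX: "fnorm X f = fnorm (Sobolev \<Omega> 4 \<infinity>) f + fnorm (Sobolev \<Omega> 1 2) f" for f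
    by (simp add: X_def H10_def)
  have q: "quasi_norm_on ?M (fnorm X)"
    unfolding quasi_norm_on_def
  proof (intro conjI ballI allI)
    fix f g assume f: "f \<in> ?M" and g: "g \<in> ?M"
    then show "(\<lambda>z. f z + g z) \<in> ?M" using q4(1) q1(1) by auto
    have "fnorm (Sobolev \<Omega> 4 \<infinity>) (\<lambda>z. f z + g z) \<le> 2 * (fnorm (Sobolev \<Omega> 4 \<infinity>) f + fnorm (Sobolev \<Omega> 4 \<infinity>) g)"
      "fnorm (Sobolev \<Omega> 1 2) (\<lambda>z. f z + g z) \<le> 2 * (fnorm (Sobolev \<Omega> 1 2) f + fnorm (Sobolev \<Omega> 1 2) g)"
      using f g q4(2) q1(2) by auto
    then show "fnorm X (\<lambda>z. f z + g z) \<le> 2 * (fnorm X f + fnorm X g)" by (simp add: fX)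
  next
    fix f and k :: complex assume "f \<in> ?M"
    then show "(\<lambda>z. k * f z) \<in> ?M" using q4(3) q1(3) by auto
  next
    fix f assume "f \<in> ?M"
    then show "0 \<le> fnorm X f" using q4(4) q1(4) by (simp add: fX)
  qed
  have sub: "members X \<subseteq> ?M" by (auto simp: X_def H10_def)
  have "fnorm X (u t) \<le> m3"
    unfolding m3_def using fnorm_le_C_time_norm[OF q sub C0, of 0 t] t by simp
  moreover have "u t \<in> members (Sobolev \<Omega> 1 2)"
    using C_time_members[OF C0, of 0 t] t by (simp add: X_def H10_def)
  ultimately show ?thesis using q1(4)[of "u t"] by (simp add: fX)
qed

lemmas sol_conjs = sol[unfolded log_schroedinger_solution_def closure_\<Omega>]

lemma u_continuous: "t \<in> {0..T} \<Longrightarrow> continuous_on ({a..b} \<times> {c..d}) (u t)"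
  using sol_conjs[THEN conjunct2, THEN conjunct2, THEN conjunct1] by (rule bspec)

lemma \<Omega>_subset: "\<Omega> \<subseteq> {a..b} \<times> {c..d}"
  unfolding \<Omega>_eq by auto

lemma u_continuous_\<Omega>: "t \<in> {0..T} \<Longrightarrow> continuous_on \<Omega> (u t)"
  using u_continuous continuous_on_subset \<Omega>_subset by blast

lemma u_boundary: "t \<in> {0..T} \<Longrightarrow> z \<in> {a..b} \<times> {c..d} \<Longrightarrow> z \<notin> \<Omega> \<Longrightarrow> u t z = 0"
  using sol_conjs[THEN conjunct2, THEN conjunct2, THEN conjunct2, THEN conjunct2, THEN conjunct1]
  by (simp add: frontier_def closure_\<Omega> interior_open open_\<Omega>)

lemma u_initial: "z \<in> {a..b} \<times> {c..d} \<Longrightarrow> u 0 z = u0 z"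
  using sol_conjs[THEN conjunct2, THEN conjunct2, THEN conjunct2, THEN conjunct2, THEN conjunct2]
  by (rule bspec)

lemma u_Lp_infty: "i \<le> 2 \<Longrightarrow> t \<in> {0..T} \<Longrightarrow> (time_deriv T (Lp \<Omega> \<infinity>) ^^ i) u t \<in> members (Lp \<Omega> \<infinity>)"
  by (rule C_time_members[OF C2])

text \<open>The time derivative in which the equation is formulated. It is a limit in \<open>L\<^sup>2\<close>, whereas the second order
regularity concerns the derivative in \<open>L\<^sup>\<infinity>\<close>; the two have the same pairings because both give the derivative of the
same scalar function.\<close>

definition "dt_u t = time_deriv T (Lp \<Omega> 2) u t"

lemma C1_L2: "C_time 1 T (Lp \<Omega> 2) u"
  using sol by (simp add: log_schroedinger_solution_def)

lemma dt_u_mem: "t \<in> {0..T} \<Longrightarrow> dt_u t \<in> members (Lp \<Omega> 2)"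
  using C_time_members[OF C1_L2, of 1 t] by (simp add: dt_u_def)

lemma test_derivative_Lp_infty:
  assumes \<phi>: "\<phi> \<in> test_functions \<Omega>" and i: "i < 2" and t: "t \<in> {0..T}"
  shows "((\<lambda>t. pairing ((time_deriv T (Lp \<Omega> \<infinity>) ^^ i) u t) \<phi>) has_vector_derivative
      (pairing ((time_deriv T (Lp \<Omega> \<infinity>) ^^ Suc i) u t) \<phi>)) (at t within {0..T})"
proof (rule has_time_deriv_testing[OF quasi_norm_Lp_infty order_refl _ Lp_infty_test_bound[OF _ \<phi>]])
  show "integrable Leb (\<lambda>z. f z * \<phi> z)" if "f \<in> members (Lp \<Omega> \<infinity>)" for f
    using that by (intro locally_integrable_times_test[OF \<phi>] locally_integrable_if_integrable Lp_infty_integrable)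
qed (use u_Lp_infty[of i] i t C_time_has_time_deriv[OF C2] in auto)

lemma test_derivative_L2:
  assumes \<phi>: "\<phi> \<in> test_functions \<Omega>" and t: "t \<in> {0..T}"
  shows "((\<lambda>t. pairing (u t) \<phi>) has_vector_derivative
      (pairing (dt_u t) \<phi>)) (at t within {0..T})"
proof -
  obtain k where k: "\<And>f. f \<in> members (Lp \<Omega> 2) \<Longrightarrow> cmod (pairing f \<phi>) \<le> k * fnorm (Lp \<Omega> 2) f"
    using Lp_2_test_bound[OF \<phi>] by blast
  show ?thesis
  proof (rule has_time_deriv_testing[OF quasi_norm_Lp_2 order_refl _ k])
    show "integrable Leb (\<lambda>z. f z * \<phi> z)" if "f \<in> members (Lp \<Omega> 2)" for f
      using that by (intro locally_integrable_times_test[OF \<phi>] locally_integrable_if_integrable Lp_2_integrable)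
    show "u t \<in> members (Lp \<Omega> 2)" if "t \<in> {0..T}" for t
      using C_time_members[OF C1_L2 _ that, of 0] by simp
    show "has_time_deriv T (Lp \<Omega> 2) u dt_u"
      using C_time_has_time_deriv[OF C1_L2, of 0] by (simp add: dt_u_def[abs_def])
  qed (use t in auto)
qed

text \<open>The pairing \<open>t \<mapsto> \<integral> u(t) \<phi>\<close> is twice differentiable with second derivative bounded by \<open>m1\<close> times the integral of \<open>|\<phi>|\<close>.\<close>

lemma time_remainder:
  assumes \<phi>: "\<phi> \<in> test_functions \<Omega>" and t: "t \<in> {0..T}" and r: "r \<in> {0..T}"
  shows "cmod (pairing (u r) \<phi> - pairing (u t) \<phi>
      - of_real (r - t) * pairing (dt_u t) \<phi>) \<le> (L1_norm \<phi> * m1) * (r - t)\<^sup>2"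
proof -
  let ?F = "\<lambda>i t. pairing ((time_deriv T (Lp \<Omega> \<infinity>) ^^ i) u t) \<phi>"
  have "pairing (dt_u t) \<phi> = ?F 1 t"
    using vector_derivative_unique_within_closed_interval[of 0 T t, unfolded cbox_interval, OF T t test_derivative_L2[OF \<phi> t]]
      test_derivative_Lp_infty[OF \<phi>, of 0 t] t by simp
  moreover have "cmod (?F 0 r - ?F 0 t - of_real (r - t) * ?F 1 t) \<le> (L1_norm \<phi> * m1) * (r - t)\<^sup>2"
  proof (rule taylor_first_order[where F'' = "?F 2"])
    fix s assume s: "s \<in> {0..T}"
    show "(?F 0 has_vector_derivative ?F 1 s) (at s within {0..T})"
      using test_derivative_Lp_infty[OF \<phi>, of 0 s] s by simp
    show "(?F 1 has_vector_derivative ?F 2 s) (at s within {0..T})"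
      using test_derivative_Lp_infty[OF \<phi>, of 1 s] s by (simp add: numeral_2_eq_2)
    have "cmod (?F 2 s) \<le> L1_norm \<phi> * fnorm (Lp \<Omega> \<infinity>) ((time_deriv T (Lp \<Omega> \<infinity>) ^^ 2) u s)"
      by (rule Lp_infty_test_bound[OF u_Lp_infty \<phi>]) (use s in auto)
    also have "\<dots> \<le> L1_norm \<phi> * m1"
      using Lp_bound[of 2 s] s by (intro mult_left_mono) (auto simp: L1_norm_def integral_nonneg_AE)
    finally show "cmod (?F 2 s) \<le> L1_norm \<phi> * m1" .
  qed (use t r in auto)
  ultimately show ?thesis by simp
qed

text \<open>This replaces an estimate of \<open>f(u(t\<^sub>n\<^sub>+\<^sub>1)) - f(u(t\<^sub>n))\<close>: second weak derivatives of \<open>u\<close> are Lipschitz in time.\<close>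

lemma weak_time_difference:
  assumes \<phi>: "\<phi> \<in> test_functions \<Omega>" and ij: "i + j \<le> 2" and t: "t \<in> {0..T}" and r: "r \<in> {0..T}"
  shows "cmod (pairing (u r) (pd i j \<phi>) - pairing (u t) (pd i j \<phi>))
     \<le> (L1_norm \<phi> * m2) * \<bar>r - t\<bar>"
proof (rule vector_derivative_bound[where S = "{0..T}"])
  let ?S = "Sobolev \<Omega> 2 \<infinity>"
  fix s assume s: "s \<in> {0..T}"
  show "((\<lambda>s. pairing (u s) (pd i j \<phi>)) has_vector_derivative
      (pairing (time_deriv T ?S u s) (pd i j \<phi>))) (at s within {0..T})"
  proof (rule has_time_deriv_testing[OF quasi_norm_Sobolev order_refl _ Sobolev_test_bound[OF _ ij \<phi>]])
    show "integrable Leb (\<lambda>z. f z * pd i j \<phi> z)" if "f \<in> members ?S" for f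
      using that by (intro locally_integrable_times_pd[OF \<phi>] locally_integrable_if_integrable Lp_infty_integrable)
        (simp add: members_Sobolev)
    show "u t \<in> members ?S" if "t \<in> {0..T}" for t
      using C_time_members[OF C1 _ that, of 0] by simp
    show "has_time_deriv T ?S u (time_deriv T ?S u)"
      using C_time_has_time_deriv[OF C1, of 0] by simp
  qed (use s in auto)
  have "cmod (pairing (time_deriv T ?S u s) (pd i j \<phi>)) \<le> L1_norm \<phi> * fnorm ?S (time_deriv T ?S u s)"
    using C_time_members[OF C1 _ s, of 1] by (intro Sobolev_test_bound ij \<phi>) simp
  also have "\<dots> \<le> L1_norm \<phi> * m2"
    using Sobolev_bound[of 1 s] s by (intro mult_left_mono) (auto simp: L1_norm_def integral_nonneg_AE)
  finally show "cmod (pairing (time_deriv T ?S u s) (pd i j \<phi>)) \<le> L1_norm \<phi> * m2" .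
qed (use t r in auto)

lemma equation_tested:
  assumes \<phi>: "\<phi> \<in> test_functions \<Omega>" and t: "t \<in> {0..T}"
  shows "\<i> * pairing (dt_u t) \<phi>
      + (pairing (u t) (pd 2 0 \<phi>) + pairing (u t) (pd 0 2 \<phi>))
    = 2 * complex_of_real lam * (LINT z|Leb. flog (u t z) * \<phi> z)"
proof -
  have w: "is_weak_deriv \<Omega> i j (u t) (weak_deriv \<Omega> i j (u t))" if "i + j \<le> 4" for i j
    using Sobolev_weak_deriv(1)[OF _ u_mem4[OF t] that] by simp
  have li: "locally_integrable \<Omega> (weak_deriv \<Omega> i j (u t))" if "i + j \<le> 4" for i j
    using w[OF that] by (simp add: is_weak_deriv_def)
  have ii: "integrable Leb (\<lambda>z. weak_deriv \<Omega> i j (u t) z * \<phi> z)" if "i + j \<le> 4" for i j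
    by (rule locally_integrable_times_test[OF \<phi> li[OF that]])
  have iD: "integrable Leb (\<lambda>z. dt_u t z * \<phi> z)"
    by (intro locally_integrable_times_test[OF \<phi>] locally_integrable_if_integrable Lp_2_integrable dt_u_mem t)
  have cf: "continuous_on \<Omega> (\<lambda>z. flog (u t z))"
    using continuous_on_compose2[OF continuous_flog u_continuous_\<Omega>[OF t]] by simp
  have "integrable Leb (\<lambda>z. flog (u t z) * \<phi> z)"
    by (intro locally_integrable_times_test[OF \<phi>] continuous_locally_integrable cf)
  note iF = borel_measurable_integrable[OF this]
  have pw: "pairing (u t) (pd i j \<phi>) = pairing (weak_deriv \<Omega> i j (u t)) \<phi>"
    if "(i, j) \<in> {(2, 0), (0, 2)}" for i j
    using w[of i j] that \<phi> unfolding is_weak_deriv_def by auto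
  have iL: "integrable Leb
      (\<lambda>z. \<i> * (dt_u t z * \<phi> z) + (weak_deriv \<Omega> 2 0 (u t) z * \<phi> z + weak_deriv \<Omega> 0 2 (u t) z * \<phi> z))"
    using iD ii[of 2 0] ii[of 0 2] by simp
  have AE: "AE z in Leb. \<i> * (dt_u t z * \<phi> z) + (weak_deriv \<Omega> 2 0 (u t) z * \<phi> z + weak_deriv \<Omega> 0 2 (u t) z * \<phi> z)
      = 2 * complex_of_real lam * (flog (u t z) * \<phi> z)"
  proof -
    have "AE z in Leb. \<i> * dt_u t z + (weak_deriv \<Omega> 2 0 (u t) z + weak_deriv \<Omega> 0 2 (u t) z)
          = complex_of_real lam * u t z * complex_of_real (ln ((cmod (u t z))\<^sup>2))"
      using bspec[OF sol_conjs[THEN conjunct2, THEN conjunct2, THEN conjunct2, THEN conjunct1] t]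
      unfolding dt_u_def .
    then show ?thesis
    proof eventually_elim
      case (elim z)
      have "complex_of_real lam * u t z * complex_of_real (ln ((cmod (u t z))\<^sup>2)) = 2 * complex_of_real lam * flog (u t z)"
        by (cases "u t z = 0") (auto simp: flog_def ln_realpow)
      with elim have "(\<i> * dt_u t z + (weak_deriv \<Omega> 2 0 (u t) z + weak_deriv \<Omega> 0 2 (u t) z)) * \<phi> z
          = (2 * complex_of_real lam * flog (u t z)) * \<phi> z" by simp
      then show ?case by (simp add: algebra_simps)
    qed
  qed
  have "\<i> * pairing (dt_u t) \<phi>
      + (pairing (u t) (pd 2 0 \<phi>) + pairing (u t) (pd 0 2 \<phi>))
    = (LINT z|Leb. \<i> * (dt_u t z * \<phi> z) + (weak_deriv \<Omega> 2 0 (u t) z * \<phi> z + weak_deriv \<Omega> 0 2 (u t) z * \<phi> z))"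
    using iD ii[of 2 0] ii[of 0 2] by (simp add: pw)
  also have "\<dots> = (LINT z|Leb. 2 * complex_of_real lam * (flog (u t z) * \<phi> z))"
    by (rule integral_cong_AE[OF _ _ AE])
      (use iF in \<open>auto intro!: borel_measurable_integrable[OF iL]\<close>)
  finally show ?thesis by simp
qed

lemma u_bounded:
  assumes t: "t \<in> {0..T}" and z: "z \<in> \<Omega>"
  shows "cmod (u t z) \<le> m1"
proof (rule field_le_epsilon)
  fix e :: real assume e: "e > 0"
  have "\<forall>\<^sub>F \<eta> in at_right 0. \<eta> > 0 \<and> square \<eta> z \<subseteq> \<Omega> \<and> (\<forall>w\<in>square \<eta> z. cmod (u t w - u t z) \<le> e)"
    by (intro eventually_conj eventually_square_small u_continuous_\<Omega> t z e eventually_at_right_less)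
  then obtain \<eta> where \<eta>: "\<eta> > 0" "square \<eta> z \<subseteq> \<Omega>" "\<And>w. w \<in> square \<eta> z \<Longrightarrow> cmod (u t w - u t z) \<le> e"
    using eventually_happens'[OF trivial_limit_at_right_real] by blast
  let ?I = "L1_norm (spot \<eta> z)"
  have I: "?I > 0" by (rule L1_norm_spot_pos[OF \<eta>(2,1)])
  have "cmod (LINT w|Leb. u t w * spot \<eta> z w) \<le> ?I * fnorm (Lp \<Omega> \<infinity>) (u t)"
    using u_Lp_infty[of 0 t] t by (intro Lp_infty_test_bound spot_test_function \<eta>) simp
  also have "\<dots> \<le> ?I * m1" using Lp_bound[of 0 t] t I by (intro mult_left_mono) auto
  finally have 1: "cmod (LINT w|Leb. u t w * spot \<eta> z w) \<le> ?I * m1" .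
  have "cmod ((LINT w|Leb. u t w * spot \<eta> z w) - u t z * of_real ?I) \<le> e * ?I"
    by (rule spot_eval[OF u_continuous_\<Omega>[OF t] \<eta>(2,3)])
  with 1 have "cmod (u t z * of_real ?I) \<le> ?I * m1 + e * ?I"
    using norm_triangle_ineq2[of "u t z * of_real ?I" "LINT w|Leb. u t w * spot \<eta> z w"]
    by (simp only: norm_minus_commute)
  then have "cmod (u t z) * ?I \<le> (m1 + e) * ?I" using I by (simp add: norm_mult algebra_simps)
  then show "cmod (u t z) \<le> m1 + e" using I by simp
qed

text \<open>The stencil has to stay strictly inside the rectangle, so that the translated bumps are still test functions.\<close>

lemma consistency_interior:
  assumes t: "t \<in> {0..T}" and r: "t + \<tau> \<in> {0..T}" and \<tau>: "\<tau> > 0" and k: "k > 0" and l: "l > 0"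
    and x: "a < x - k" "x + k < b" and y: "c < y - l" "y + l < d"
  shows "cmod (\<i> * ((u (t + \<tau>) (x, y) - u t (x, y)) / of_real \<tau>)
      + ((u (t + \<tau>) (x + k, y) - 2 * u (t + \<tau>) (x, y) + u (t + \<tau>) (x - k, y)) / of_real (k\<^sup>2)
      + (u (t + \<tau>) (x, y + l) - 2 * u (t + \<tau>) (x, y) + u (t + \<tau>) (x, y - l)) / of_real (l\<^sup>2))
      - 2 * of_real lam * flog (u t (x, y)))
    \<le> m1 * \<tau> + 2 * m2 * \<tau> + 2 * m3 * (k\<^sup>2 + l\<^sup>2)" (is "?L \<le> ?B")
proof (rule field_le_epsilon)
  fix e :: real assume e: "e > 0"
  define K where "K = 2 / \<tau> + 4 / k\<^sup>2 + 4 / l\<^sup>2 + 2 * \<bar>lam\<bar>"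
  have K: "K > 0" unfolding K_def using \<tau> k l by (intro add_pos_nonneg) auto
  \<comment> \<open>K is the total factor with which the averaging error enters in combine_errors\<close>
  define e' where "e' = e / K"
  have e': "e' > 0" using e K by (simp add: e'_def)
  let ?V = "u (t + \<tau>)" and ?n = "\<lambda>z. flog (u t z)"
  have mem: "(x, y) \<in> \<Omega>" "(x + k, y) \<in> \<Omega>" "(x - k, y) \<in> \<Omega>" "(x, y + l) \<in> \<Omega>" "(x, y - l) \<in> \<Omega>"
    using x y k l unfolding \<Omega>_eq by auto
  have cf: "continuous_on \<Omega> ?n"
    using continuous_on_compose2[OF continuous_flog u_continuous_\<Omega>[OF t]] by simp
  note cV = u_continuous_\<Omega>[OF r]
  define small where "small v p \<eta> \<longleftrightarrow> square \<eta> p \<subseteq> \<Omega> \<and> (\<forall>z\<in>square \<eta> p. cmod (v z - v p) \<le> e')"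
    for v :: cfun and p \<eta>
  have ev_small: "\<forall>\<^sub>F \<eta> in at_right 0. small v p \<eta>" if "continuous_on \<Omega> v" "p \<in> \<Omega>" for v p
    unfolding small_def by (rule eventually_square_small[OF that e'])
  have "\<forall>\<^sub>F \<eta> in at_right 0. \<eta> > 0 \<and> small (u t) (x, y) \<eta> \<and> small ?V (x, y) \<eta>
      \<and> small ?V (x + k, y) \<eta> \<and> small ?V (x - k, y) \<eta> \<and> small ?V (x, y + l) \<eta> \<and> small ?V (x, y - l) \<eta>
      \<and> small ?n (x, y) \<eta>"
    by (intro eventually_conj eventually_at_right_less ev_small cf cV u_continuous_\<Omega>[OF t] mem)
  then obtain \<eta> where \<eta>: "\<eta> > 0" "small (u t) (x, y) \<eta>" "small ?V (x, y) \<eta>"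
      "small ?V (x + k, y) \<eta>" "small ?V (x - k, y) \<eta>" "small ?V (x, y + l) \<eta>" "small ?V (x, y - l) \<eta>"
      "small ?n (x, y) \<eta>"
    using eventually_happens'[OF trivial_limit_at_right_real] by blast
  have sq: "square \<eta> (x, y) \<subseteq> \<Omega>" "square \<eta> (x + k, y) \<subseteq> \<Omega>" "square \<eta> (x - k, y) \<subseteq> \<Omega>"
    "square \<eta> (x, y + l) \<subseteq> \<Omega>" "square \<eta> (x, y - l) \<subseteq> \<Omega>"
    using \<eta> by (simp_all add: small_def)
  have corner: "(x + k + \<eta>, y) \<in> \<Omega>" "(x - k - \<eta>, y) \<in> \<Omega>" "(x, y + l + \<eta>) \<in> \<Omega>" "(x, y - l - \<eta>) \<in> \<Omega>"
    "(x, y + \<eta>) \<in> \<Omega>" "(x, y - \<eta>) \<in> \<Omega>" "(x + \<eta>, y) \<in> \<Omega>" "(x - \<eta>, y) \<in> \<Omega>"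
    by (rule subsetD[OF sq(2)] subsetD[OF sq(3)] subsetD[OF sq(4)] subsetD[OF sq(5)] subsetD[OF sq(1)],
        use \<eta>(1) in \<open>simp add: square_def; fail\<close>)+
  have sqx: "square \<eta> (x + s, y) \<subseteq> \<Omega>" if "s \<in> {-k..k}" for s
    using that corner unfolding square_def \<Omega>_eq by auto
  have sqy: "square \<eta> (x, y + s) \<subseteq> \<Omega>" if "s \<in> {-l..l}" for s
    using that corner unfolding square_def \<Omega>_eq by auto
  let ?\<phi> = "spot \<eta> (x, y)"
  have \<phi>: "?\<phi> \<in> test_functions \<Omega>" by (rule spot_test_function[OF sq(1)])
  let ?I = "L1_norm ?\<phi>"
  have I: "?I > 0" by (rule L1_norm_spot_pos[OF sq(1) \<eta>(1)])
  have ev: "cmod (pairing v (spot \<eta> p) - v p * of_real ?I) \<le> e' * ?I"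
    if "continuous_on \<Omega> v" "small v p \<eta>" for v p
    using spot_eval[OF that(1), of \<eta> p "v p" e'] L1_norm_spot_eq[of \<eta> p "(x, y)"] that(2) sq(1)
    by (simp add: small_def)
  have "?L \<le> ?B + K * e'"
    unfolding K_def
  proof (rule combine_errors[OF I \<tau> k l])
    show "cmod (pairing ?V ?\<phi> - pairing (u t) ?\<phi>
        - of_real \<tau> * pairing (dt_u t) ?\<phi>) \<le> (?I * m1) * \<tau>\<^sup>2"
      using time_remainder[OF \<phi> t r] by simp
    show "cmod (pairing ?V (spot \<eta> (x + k, y)) - 2 * pairing ?V ?\<phi>
        + pairing ?V (spot \<eta> (x - k, y))
        - of_real (k\<^sup>2) * pairing ?V (pd 2 0 ?\<phi>)) \<le> 2 * (?I * m3) * k ^ 4"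
      using k by (intro second_difference_testing(1) u_mem4[OF r] X_bound[OF r] sqx) auto
    show "cmod (pairing ?V (spot \<eta> (x, y + l)) - 2 * pairing ?V ?\<phi>
        + pairing ?V (spot \<eta> (x, y - l))
        - of_real (l\<^sup>2) * pairing ?V (pd 0 2 ?\<phi>)) \<le> 2 * (?I * m3) * l ^ 4"
      using l by (intro second_difference_testing(2) u_mem4[OF r] X_bound[OF r] sqy) auto
    show "cmod (pairing ?V (pd 2 0 ?\<phi>) - pairing (u t) (pd 2 0 ?\<phi>))
        \<le> (?I * m2) * \<tau>"
      using weak_time_difference[OF \<phi> _ t r, of 2 0] \<tau> by simp
    show "cmod (pairing ?V (pd 0 2 ?\<phi>) - pairing (u t) (pd 0 2 ?\<phi>))
        \<le> (?I * m2) * \<tau>"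
      using weak_time_difference[OF \<phi> _ t r, of 0 2] \<tau> by simp
    show "\<i> * pairing (dt_u t) ?\<phi>
      + (pairing (u t) (pd 2 0 ?\<phi>) + pairing (u t) (pd 0 2 ?\<phi>))
      = 2 * complex_of_real lam * (LINT z|Leb. flog (u t z) * ?\<phi> z)"
      by (rule equation_tested[OF \<phi> t])
  qed (intro ev cf cV u_continuous_\<Omega>[OF t] \<eta>)+
  also have "K * e' = e" using K by (simp add: e'_def)
  finally show "?L \<le> ?B + e" .
qed

text \<open>A stencil that touches the boundary is the limit of the stencils shortened by a factor \<open>s < 1\<close>, because \<open>u(t)\<close> is
continuous up to the boundary.\<close>

lemma consistency:
  assumes t: "t \<in> {0..T}" and r: "t + \<tau> \<in> {0..T}" and \<tau>: "\<tau> > 0" and k: "k > 0" and l: "l > 0"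
    and x: "a \<le> x - k" "x + k \<le> b" and y: "c \<le> y - l" "y + l \<le> d"
  shows "cmod (\<i> * ((u (t + \<tau>) (x, y) - u t (x, y)) / of_real \<tau>)
      + ((u (t + \<tau>) (x + k, y) - 2 * u (t + \<tau>) (x, y) + u (t + \<tau>) (x - k, y)) / of_real (k\<^sup>2)
      + (u (t + \<tau>) (x, y + l) - 2 * u (t + \<tau>) (x, y) + u (t + \<tau>) (x, y - l)) / of_real (l\<^sup>2))
      - 2 * of_real lam * flog (u t (x, y)))
    \<le> m1 * \<tau> + 2 * m2 * \<tau> + 2 * m3 * (k\<^sup>2 + l\<^sup>2)"
proof -
  let ?V = "u (t + \<tau>)"
  let ?f = "\<lambda>s. cmod (\<i> * ((?V (x, y) - u t (x, y)) / of_real \<tau>)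
      + ((?V (x + s * k, y) - 2 * ?V (x, y) + ?V (x - s * k, y)) / of_real ((s * k)\<^sup>2)
      + (?V (x, y + s * l) - 2 * ?V (x, y) + ?V (x, y - s * l)) / of_real ((s * l)\<^sup>2))
      - 2 * of_real lam * flog (u t (x, y)))"
  let ?g = "\<lambda>s. m1 * \<tau> + 2 * m2 * \<tau> + 2 * m3 * ((s * k)\<^sup>2 + (s * l)\<^sup>2)"
  have mx: "(x + s * k, y) \<in> {a..b} \<times> {c..d}" "(x, y + s * l) \<in> {a..b} \<times> {c..d}" if "s \<in> {-1..1}" for s
  proof -
    have "s * k \<le> 1 * k" "(-1) * k \<le> s * k" "s * l \<le> 1 * l" "(-1) * l \<le> s * l"
      using that k l by (intro mult_right_mono; simp)+
    then have "a \<le> x + s * k" "x + s * k \<le> b" "a \<le> x" "x \<le> b" "c \<le> y + s * l" "y + s * l \<le> d" "c \<le> y" "y \<le> d"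
      using x y k l by linarith+
    then show "(x + s * k, y) \<in> {a..b} \<times> {c..d}" "(x, y + s * l) \<in> {a..b} \<times> {c..d}" by simp_all
  qed
  have mx': "(x - s * k, y) \<in> {a..b} \<times> {c..d}" "(x, y - s * l) \<in> {a..b} \<times> {c..d}" if "s \<in> {-1..1}" for s
    using mx[of "- s"] that by auto
  have cx: "continuous_on {1/2..1} (\<lambda>s. ?V (x + s * k, y))" "continuous_on {1/2..1} (\<lambda>s. ?V (x, y + s * l))"
    "continuous_on {1/2..1} (\<lambda>s. ?V (x - s * k, y))" "continuous_on {1/2..1} (\<lambda>s. ?V (x, y - s * l))"
  proof -
    have s: "s \<in> {1/2..1} \<Longrightarrow> s \<in> {-1..1::real}" for s by auto
    show "continuous_on {1/2..1} (\<lambda>s. ?V (x + s * k, y))"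
      by (rule continuous_on_compose2[OF u_continuous[OF r]]) (intro continuous_intros, use mx(1) s in blast)
    show "continuous_on {1/2..1} (\<lambda>s. ?V (x, y + s * l))"
      by (rule continuous_on_compose2[OF u_continuous[OF r]]) (intro continuous_intros, use mx(2) s in blast)
    show "continuous_on {1/2..1} (\<lambda>s. ?V (x - s * k, y))"
      by (rule continuous_on_compose2[OF u_continuous[OF r]]) (intro continuous_intros, use mx'(1) s in blast)
    show "continuous_on {1/2..1} (\<lambda>s. ?V (x, y - s * l))"
      by (rule continuous_on_compose2[OF u_continuous[OF r]]) (intro continuous_intros, use mx'(2) s in blast)
  qed
  have one: "(1::real) \<in> {1/2..1}" by simp
  have "continuous_on {1/2..1} ?f"
    using k l by (intro continuous_intros cx) auto
  from bspec[OF continuous_on_def[THEN iffD1, OF this] one]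
  have lim: "(?f \<longlongrightarrow> ?f 1) (at 1 within {1/2..1})" .
  have nt: "at (1::real) within {1/2..1} \<noteq> bot"
    by (simp add: at_within_Icc_at_left)
  have "continuous_on {1/2..1} ?g" by (intro continuous_intros)
  from bspec[OF continuous_on_def[THEN iffD1, OF this] one]
  have limg: "(?g \<longlongrightarrow> ?g 1) (at 1 within {1/2..1})" .
  have "?f 1 \<le> ?g 1"
  proof (rule tendsto_le[OF nt limg lim])
    have "?f s \<le> ?g s" if s: "s \<in> {1/2..1}" "s \<noteq> 1" for s
    proof (rule consistency_interior[OF t r \<tau>])
      have "s * k < 1 * k" "s * l < 1 * l" using s k l by (intro mult_strict_right_mono; simp)+
      then show "a < x - s * k" "x + s * k < b" "c < y - s * l" "y + s * l < d" using x y by linarith+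
      show "s * k > 0" "s * l > 0" using s k l by auto
    qed
    then show "\<forall>\<^sub>F s in at 1 within {1/2..1}. ?f s \<le> ?g s"
      by (auto simp: eventually_at_filter)
  qed
  then show ?thesis by simp
qed

end

section \<open>The logarithmic nonlinearity\<close>

text \<open>The logarithm is evaluated at the larger of the two points. The remaining part is Lipschitz, since
\<open>ln |z| - ln |w| \<le> |z| / |w| - 1\<close>.\<close>

lemma flog_diff:
  assumes "cmod w \<le> cmod z" "z \<noteq> 0"
  obtains r where "flog z - flog w = (z - w) * of_real (ln (cmod z)) + r" "cmod r \<le> cmod (z - w)"
proof -
  define r where "r = w * of_real (ln (cmod z) - ln (cmod w))"
  have "flog z - flog w = (z - w) * of_real (ln (cmod z)) + r"
    by (simp add: flog_def r_def algebra_simps)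
  moreover have "cmod r \<le> cmod (z - w)"
  proof (cases "w = 0")
    case False
    have "ln (cmod z) - ln (cmod w) = ln (cmod z / cmod w)"
      using False assms by (simp add: ln_div)
    also have "\<dots> \<le> cmod z / cmod w - 1"
      using False assms by (intro ln_le_minus_one) simp
    finally have "cmod w * (ln (cmod z) - ln (cmod w)) \<le> cmod w * (cmod z / cmod w - 1)"
      by (intro mult_left_mono) auto
    also have "\<dots> = cmod z - cmod w" using False by (simp add: field_simps)
    also have "\<dots> \<le> cmod (z - w)" by (rule norm_triangle_ineq2)
    finally have "cmod w * (ln (cmod z) - ln (cmod w)) \<le> cmod (z - w)" .
    moreover have "0 \<le> ln (cmod z) - ln (cmod w)" using False assms by simp
    ultimately show ?thesis unfolding r_def norm_mult norm_of_real by simp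
  qed (simp add: r_def)
  ultimately show ?thesis using that by blast
qed

text \<open>The singular part of the difference is a real multiple of \<open>z - w\<close> and drops out of the imaginary part.\<close>

lemma flog_monotone: "\<bar>Im ((flog z - flog w) * cnj (z - w))\<bar> \<le> (cmod (z - w))\<^sup>2"
proof -
  have *: "\<bar>Im ((flog z - flog w) * cnj (z - w))\<bar> \<le> (cmod (z - w))\<^sup>2"
    if le: "cmod w \<le> cmod z" for z w
  proof (cases "z = 0")
    case False
    obtain r where r: "flog z - flog w = (z - w) * of_real (ln (cmod z)) + r" "cmod r \<le> cmod (z - w)"
      using flog_diff[OF le False] by metis
    have "(flog z - flog w) * cnj (z - w) = of_real (ln (cmod z)) * ((z - w) * cnj (z - w)) + r * cnj (z - w)"
      unfolding r(1) by (simp add: algebra_simps)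
    also have "(z - w) * cnj (z - w) = of_real ((cmod (z - w))\<^sup>2)"
      by (simp only: complex_norm_square)
    finally have "Im ((flog z - flog w) * cnj (z - w)) = Im (r * cnj (z - w))" by simp
    also have "\<bar>\<dots>\<bar> \<le> cmod (r * cnj (z - w))" by (rule abs_Im_le_cmod)
    also have "\<dots> \<le> cmod (z - w) * cmod (z - w)"
      unfolding norm_mult complex_mod_cnj using r(2) by (intro mult_right_mono) auto
    finally show ?thesis by (simp add: power2_eq_square)
  qed (use le in auto)
  show ?thesis
  proof (cases "cmod w \<le> cmod z")
    case False
    have "(flog z - flog w) * cnj (z - w) = (flog w - flog z) * cnj (w - z)" by (simp add: algebra_simps)
    then show ?thesis using *[of z w] False by (simp add: norm_minus_commute)
  qed (rule *)
qed

text \<open>Here \<open>m\<close> is the larger of two moduli whose points have distance \<open>e\<close>, hence at least \<open>e / 2\<close>. The minimum keeps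
the logarithm on the right nonnegative.\<close>

lemma abs_ln_bound:
  fixes m e M :: real
  assumes m: "0 < m" "e \<le> 2 * m" "m \<le> M + e" and e: "0 < e" and M: "0 \<le> M"
  shows "\<bar>ln m\<bar> \<le> M + e + ln (2 / min e 2)"
proof (cases "1 \<le> m")
  case True
  have "0 \<le> ln (2 / min e 2)" using e by (intro ln_ge_zero) (auto simp: min_def field_simps)
  moreover have "ln m \<le> m - 1" using m by (intro ln_le_minus_one)
  moreover have "0 \<le> ln m" using True by simp
  ultimately show ?thesis using m by simp
next
  case False
  have "ln (1 / m) \<le> ln (2 / min e 2)"
    using m e False by (subst ln_le_cancel_iff) (auto simp: field_simps min_def)
  moreover have "ln m \<le> 0" using False m by simp
  ultimately show ?thesis using m e M by (simp add: ln_div)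
qed

lemma flog_diff_bound:
  fixes z w :: complex
  assumes z: "cmod z \<le> M"
  defines "e \<equiv> cmod (z - w)"
  shows "cmod (flog z - flog w) \<le> e * (1 + M + e + ln (2 / min e 2))"
proof (cases "e = 0")
  case False
  then have e: "0 < e" by (simp add: e_def)
  have M: "0 \<le> M" using z norm_ge_zero order_trans by blast
  have tri: "e \<le> cmod z + cmod w" "cmod w \<le> M + e"
    using norm_triangle_ineq4[of z w] norm_triangle_ineq2[of w z] z
    by (auto simp: e_def norm_minus_commute)
  have gen: "cmod (flog p - flog q) \<le> e * (1 + M + e + ln (2 / min e 2))"
    if pq: "cmod q \<le> cmod p" "cmod (p - q) = e" "e \<le> cmod p + cmod q" "cmod p \<le> M + e" for p q
  proof -
    have p: "p \<noteq> 0" using pq e by auto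
    obtain r where r: "flog p - flog q = (p - q) * of_real (ln (cmod p)) + r" "cmod r \<le> cmod (p - q)"
      using flog_diff[OF pq(1) p] by metis
    have "cmod (flog p - flog q) \<le> cmod ((p - q) * of_real (ln (cmod p))) + cmod r"
      unfolding r(1) by (rule norm_triangle_ineq)
    also have "\<dots> \<le> e * \<bar>ln (cmod p)\<bar> + e" using r(2) pq(2) by (simp add: norm_mult)
    also have "\<dots> \<le> e * (M + e + ln (2 / min e 2)) + e"
      using abs_ln_bound[of "cmod p" e M] p pq e M by (intro add_right_mono mult_left_mono) auto
    finally show ?thesis by (simp add: algebra_simps)
  qed
  show ?thesis
  proof (cases "cmod w \<le> cmod z")
    case True
    have "cmod z \<le> M + e" using z e by simp
    moreover have "cmod (z - w) = e" by (simp add: e_def)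
    ultimately show ?thesis using gen[OF True _ tri(1)] by blast
  next
    case False
    then have "cmod (flog w - flog z) \<le> e * (1 + M + e + ln (2 / min e 2))"
      using gen[of z w] tri by (simp add: e_def norm_minus_commute add.commute)
    then show ?thesis by (simp add: norm_minus_commute)
  qed
qed (simp add: e_def)

text \<open>The singular part contributes \<open>\<tau> e\<^sup>2 ln\<^sup>2 (2 / e) \<le> 8 \<tau> e\<close>, by \<open>ln y \<le> 2 \<surd>y\<close>, and this is at most \<open>4 (e\<^sup>2 + \<tau>\<^sup>2)\<close>. So one
factor \<open>\<tau>\<close> turns the logarithmic singularity into a Lipschitz bound with a defect of the order of the time step.\<close>

lemma scaled_flog_diff_bound:
  assumes z: "cmod z \<le> M" and \<tau>: "0 < \<tau>" "3 * \<tau> * (1 + M)\<^sup>2 \<le> 1"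
  shows "\<tau> * (cmod (flog z - flog w))\<^sup>2 \<le> 25 * (cmod (z - w))\<^sup>2 + 3 * \<tau> * (cmod (z - w)) ^ 4 + 24 * \<tau>\<^sup>2"
proof -
  define e where "e = cmod (z - w)"
  define l where "l = ln (2 / min e 2)"
  have M: "0 \<le> M" using z norm_ge_zero order_trans by blast
  have e0: "0 \<le> e" by (simp add: e_def)
  have bl: "\<tau> * (e * l)\<^sup>2 \<le> 8 * (e\<^sup>2 + \<tau>\<^sup>2)"
  proof (cases "0 < e \<and> e < 2")
    case True
    have l: "l = 2 * ln (sqrt (2 / e))" using True by (simp add: l_def min_def ln_sqrt)
    have "ln (sqrt (2 / e)) \<le> sqrt (2 / e)" using True ln_le_minus_one[of "sqrt (2 / e)"] by simp
    then have "l \<le> 2 * sqrt (2 / e)" using l by simp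
    moreover have "0 \<le> l" using True by (auto simp: l_def min_def intro: ln_ge_zero)
    ultimately have "l\<^sup>2 \<le> (2 * sqrt (2 / e))\<^sup>2" by (intro power_mono)
    also have "\<dots> = 8 / e" using True by (simp add: power_mult_distrib)
    finally have "e\<^sup>2 * l\<^sup>2 \<le> e\<^sup>2 * (8 / e)" by (intro mult_left_mono) auto
    also have "\<dots> = 8 * e" using True by (simp add: power2_eq_square)
    finally have "\<tau> * (e * l)\<^sup>2 \<le> \<tau> * (8 * e)" using \<tau> by (simp add: power_mult_distrib)
    also have "\<dots> \<le> 8 * (e\<^sup>2 + \<tau>\<^sup>2)"
    proof -
      have "0 \<le> e * \<tau>" using e0 \<tau> by simp
      then show ?thesis using sum_squares_bound[of e \<tau>] by (simp add: algebra_simps)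
    qed
    finally show ?thesis .
  next
    case False
    then have "e * l = 0" using e0 by (auto simp: l_def min_def)
    show ?thesis unfolding \<open>e * l = 0\<close> by simp
  qed
  have "cmod (flog z - flog w) \<le> e * (1 + M) + e\<^sup>2 + e * l"
    using flog_diff_bound[OF z, of w] by (simp add: e_def l_def algebra_simps power2_eq_square)
  then have "(cmod (flog z - flog w))\<^sup>2 \<le> (e * (1 + M) + e\<^sup>2 + e * l)\<^sup>2" by (intro power_mono) auto
  also have "\<dots> \<le> 3 * ((e * (1 + M))\<^sup>2 + (e\<^sup>2)\<^sup>2 + (e * l)\<^sup>2)"
  proof -
    have "3 * (p\<^sup>2 + q\<^sup>2 + r\<^sup>2) - (p + q + r)\<^sup>2 = (p - q)\<^sup>2 + (q - r)\<^sup>2 + (p - r)\<^sup>2" for p q r :: real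
      by (simp add: power2_eq_square algebra_simps)
    then show ?thesis by (metis diff_ge_0_iff_ge add_nonneg_nonneg zero_le_power2)
  qed
  finally have "\<tau> * (cmod (flog z - flog w))\<^sup>2 \<le> \<tau> * (3 * ((e * (1 + M))\<^sup>2 + (e\<^sup>2)\<^sup>2 + (e * l)\<^sup>2))"
    using \<tau> by (intro mult_left_mono) auto
  also have "\<dots> = (3 * \<tau> * (1 + M)\<^sup>2) * e\<^sup>2 + 3 * \<tau> * e ^ 4 + 3 * (\<tau> * (e * l)\<^sup>2)"
  proof -
    have "(e * (1 + M))\<^sup>2 = (1 + M)\<^sup>2 * e\<^sup>2" "(e\<^sup>2)\<^sup>2 = e ^ 4"
      by (simp_all add: power_mult_distrib flip: power_mult)
    then show ?thesis by (simp only:) (simp add: algebra_simps)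
  qed
  also have "\<dots> \<le> 1 * e\<^sup>2 + 3 * \<tau> * e ^ 4 + 3 * (8 * (e\<^sup>2 + \<tau>\<^sup>2))"
    using \<tau>(2) bl by (intro add_mono mult_right_mono mult_left_mono) auto
  finally show ?thesis by (simp add: e_def)
qed

section \<open>Summation by parts and the discrete Ladyzhenskaya inequality\<close>

text \<open>Keeping the boundary term at \<open>J\<close> makes the identity provable by induction.\<close>

lemma summation_by_parts_1d:
  fixes v :: "nat \<Rightarrow> complex"
  assumes v: "v 0 = 0"
  shows "J \<ge> 1 \<Longrightarrow> (\<Sum>j=1..<J. (v (j + 1) - 2 * v j + v (j - 1)) * cnj (v j))
      + of_real (\<Sum>j<J. (cmod (v (j + 1) - v j))\<^sup>2) = (v J - v (J - 1)) * cnj (v J)"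
proof (induction J rule: nat_induct_at_least)
  case base
  have "of_real ((cmod (v 1))\<^sup>2) = v 1 * cnj (v 1)" by (rule complex_norm_square)
  then show ?case by (simp add: v)
next
  case (Suc n)
  have sq: "of_real ((cmod (v (n + 1) - v n))\<^sup>2) = (v (n + 1) - v n) * cnj (v (n + 1) - v n)"
    by (rule complex_norm_square)
  have "(\<Sum>j=1..<Suc n. (v (j + 1) - 2 * v j + v (j - 1)) * cnj (v j))
      + of_real (\<Sum>j<Suc n. (cmod (v (j + 1) - v j))\<^sup>2)
    = ((\<Sum>j=1..<n. (v (j + 1) - 2 * v j + v (j - 1)) * cnj (v j)) + of_real (\<Sum>j<n. (cmod (v (j + 1) - v j))\<^sup>2))
      + (v (n + 1) - 2 * v n + v (n - 1)) * cnj (v n) + of_real ((cmod (v (n + 1) - v n))\<^sup>2)"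
    using Suc.hyps by simp
  also have "\<dots> = (v n - v (n - 1)) * cnj (v n) + (v (n + 1) - 2 * v n + v (n - 1)) * cnj (v n)
      + (v (n + 1) - v n) * cnj (v (n + 1) - v n)"
    unfolding Suc.IH sq ..
  also have "\<dots> = (v (Suc n) - v (Suc n - 1)) * cnj (v (Suc n))"
    by (simp add: algebra_simps)
  finally show ?case .
qed

lemma summation_by_parts_1d_zero:
  fixes v :: "nat \<Rightarrow> complex"
  assumes "v 0 = 0" "v J = 0" "J \<ge> 1"
  shows "(\<Sum>j=1..<J. (v (j + 1) - 2 * v j + v (j - 1)) * cnj (v j)) = - of_real (\<Sum>j<J. (cmod (v (j + 1) - v j))\<^sup>2)"
  using summation_by_parts_1d[of v J] assms by (simp add: add_eq_0_iff2)

text \<open>Telescoping \<open>|v|\<^sup>2\<close> from the boundary; the discrete form of \<open>|v(x)|\<^sup>2 \<le> \<integral> |(v\<^sup>2)'|\<close>.\<close>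

lemma discrete_max_bound:
  fixes v :: "nat \<Rightarrow> complex"
  assumes v: "v 0 = 0" and n: "n \<le> J"
  shows "(cmod (v n))\<^sup>2 \<le> (\<Sum>j<J. cmod (v (j + 1) - v j) * (cmod (v (j + 1)) + cmod (v j)))"
proof -
  have "(cmod (v n))\<^sup>2 \<le> (\<Sum>j<n. cmod (v (j + 1) - v j) * (cmod (v (j + 1)) + cmod (v j)))"
  proof (induction n)
    case (Suc n)
    have "(cmod (v (Suc n)))\<^sup>2 - (cmod (v n))\<^sup>2 = (cmod (v (Suc n)) - cmod (v n)) * (cmod (v (Suc n)) + cmod (v n))"
      by (simp add: power2_eq_square algebra_simps)
    also have "\<dots> \<le> cmod (v (Suc n) - v n) * (cmod (v (Suc n)) + cmod (v n))"
      by (intro mult_right_mono norm_triangle_ineq2) auto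
    finally show ?case using Suc by simp
  qed (simp add: v)
  also have "\<dots> \<le> (\<Sum>j<J. cmod (v (j + 1) - v j) * (cmod (v (j + 1)) + cmod (v j)))"
    using n by (intro sum_mono2) auto
  finally show ?thesis .
qed

lemma norm_h_power2: "0 \<le> hx * hy \<Longrightarrow> (norm_h J K hx hy v)\<^sup>2 = hx * hy * (\<Sum>j=1..<J. \<Sum>k=1..<K. (cmod (v j k))\<^sup>2)"
  by (simp add: norm_h_def sum_nonneg)

lemma seminorm1_h_power2:
  "0 \<le> hx * hy \<Longrightarrow> (seminorm1_h J K hx hy v)\<^sup>2
    = hx * hy * (\<Sum>j<J. \<Sum>k<K. (cmod (dxp hx v j k))\<^sup>2 + (cmod (dyp hy v j k))\<^sup>2)"
  by (simp add: seminorm1_h_def sum_nonneg)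

lemma X0_D:
  assumes "v \<in> X0 J K"
  shows "k \<le> K \<Longrightarrow> v 0 k = 0" "k \<le> K \<Longrightarrow> v J k = 0" "j \<le> J \<Longrightarrow> v j 0 = 0" "j \<le> J \<Longrightarrow> v j K = 0"
  using assms by (auto simp: X0_def)

lemma lap_h_by_parts:
  assumes v: "v \<in> X0 J K" and J: "J \<ge> 1" and K: "K \<ge> 1" and h: "hx > 0" "hy > 0"
  shows "of_real (hx * hy) * (\<Sum>j=1..<J. \<Sum>k=1..<K. lap_h hx hy v j k * cnj (v j k))
    = - complex_of_real ((seminorm1_h J K hx hy v)\<^sup>2)"
proof -
  have x: "(\<Sum>j=1..<J. (v (j + 1) k - 2 * v j k + v (j - 1) k) * cnj (v j k))
      = - of_real (\<Sum>j<J. (cmod (v (j + 1) k - v j k))\<^sup>2)" if "k \<le> K" for k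
    using summation_by_parts_1d_zero[of "\<lambda>j. v j k" J] X0_D[OF v] that J by simp
  have y: "(\<Sum>k=1..<K. (v j (k + 1) - 2 * v j k + v j (k - 1)) * cnj (v j k))
      = - of_real (\<Sum>k<K. (cmod (v j (k + 1) - v j k))\<^sup>2)" if "j \<le> J" for j
    using summation_by_parts_1d_zero[of "\<lambda>k. v j k" K] X0_D[OF v] that K by simp
  have Ksplit: "{..<K} = insert 0 {1..<K}" "{..<J} = insert 0 {1..<J}" using J K by auto
  have "(\<Sum>j=1..<J. \<Sum>k=1..<K. lap_h hx hy v j k * cnj (v j k))
    = (\<Sum>j=1..<J. \<Sum>k=1..<K. (v (j + 1) k - 2 * v j k + v (j - 1) k) * cnj (v j k)) / of_real (hx\<^sup>2)
      + (\<Sum>j=1..<J. \<Sum>k=1..<K. (v j (k + 1) - 2 * v j k + v j (k - 1)) * cnj (v j k)) / of_real (hy\<^sup>2)"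
  proof -
    have "lap_h hx hy v j k * cnj (v j k)
      = (v (j + 1) k - 2 * v j k + v (j - 1) k) * cnj (v j k) / of_real (hx\<^sup>2)
        + (v j (k + 1) - 2 * v j k + v j (k - 1)) * cnj (v j k) / of_real (hy\<^sup>2)" for j k
      unfolding lap_h_def by (rule trans[OF distrib_right]) simp
    then show ?thesis by (simp only: sum.distrib sum_divide_distrib)
  qed
  also have "(\<Sum>j=1..<J. \<Sum>k=1..<K. (v (j + 1) k - 2 * v j k + v (j - 1) k) * cnj (v j k))
    = (\<Sum>k=1..<K. \<Sum>j=1..<J. (v (j + 1) k - 2 * v j k + v (j - 1) k) * cnj (v j k))"
    by (rule sum.swap)
  also have "\<dots> = (\<Sum>k=1..<K. - of_real (\<Sum>j<J. (cmod (v (j + 1) k - v j k))\<^sup>2))"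
    by (intro sum.cong refl x) simp
  also have "\<dots> = - of_real (\<Sum>k=1..<K. \<Sum>j<J. (cmod (v (j + 1) k - v j k))\<^sup>2)"
    by (simp add: sum_negf)
  also have "(\<Sum>k=1..<K. \<Sum>j<J. (cmod (v (j + 1) k - v j k))\<^sup>2) = (\<Sum>k<K. \<Sum>j<J. (cmod (v (j + 1) k - v j k))\<^sup>2)"
    unfolding Ksplit(1) using X0_D(3)[OF v] J by (subst sum.insert) (auto intro!: sum.neutral)
  also have "\<dots> = (\<Sum>j<J. \<Sum>k<K. (cmod (v (j + 1) k - v j k))\<^sup>2)" by (rule sum.swap)
  also have "(\<Sum>j=1..<J. \<Sum>k=1..<K. (v j (k + 1) - 2 * v j k + v j (k - 1)) * cnj (v j k))
    = (\<Sum>j=1..<J. - of_real (\<Sum>k<K. (cmod (v j (k + 1) - v j k))\<^sup>2))"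
    by (intro sum.cong refl y) simp
  also have "\<dots> = - of_real (\<Sum>j=1..<J. \<Sum>k<K. (cmod (v j (k + 1) - v j k))\<^sup>2)"
    by (simp add: sum_negf)
  also have "(\<Sum>j=1..<J. \<Sum>k<K. (cmod (v j (k + 1) - v j k))\<^sup>2) = (\<Sum>j<J. \<Sum>k<K. (cmod (v j (k + 1) - v j k))\<^sup>2)"
    unfolding Ksplit(2) using X0_D(1)[OF v] K by (subst sum.insert) (auto intro!: sum.neutral)
  finally have 1: "(\<Sum>j=1..<J. \<Sum>k=1..<K. lap_h hx hy v j k * cnj (v j k))
    = - of_real ((\<Sum>j<J. \<Sum>k<K. (cmod (v (j + 1) k - v j k))\<^sup>2) / hx\<^sup>2 + (\<Sum>j<J. \<Sum>k<K. (cmod (v j (k + 1) - v j k))\<^sup>2) / hy\<^sup>2)"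
    by simp
  have 2: "(\<Sum>j<J. \<Sum>k<K. (cmod (dxp hx v j k))\<^sup>2 + (cmod (dyp hy v j k))\<^sup>2)
    = (\<Sum>j<J. \<Sum>k<K. (cmod (v (j + 1) k - v j k))\<^sup>2) / hx\<^sup>2 + (\<Sum>j<J. \<Sum>k<K. (cmod (v j (k + 1) - v j k))\<^sup>2) / hy\<^sup>2"
    by (simp add: dxp_def dyp_def norm_divide power_divide sum.distrib sum_divide_distrib)
  have "0 \<le> hx * hy" using h by simp
  then show ?thesis unfolding seminorm1_h_power2[OF \<open>0 \<le> hx * hy\<close>] 1 2
    by (simp only: of_real_mult mult_minus_right)
qed

lemma Cauchy_Schwarz_difference_sum:
  fixes p q r :: "nat \<Rightarrow> nat \<Rightarrow> real"
  assumes "\<And>j k. 0 \<le> q j k" "\<And>j k. 0 \<le> r j k"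
    and h: "h > 0" and \<mu>: "\<mu> \<ge> 0"
    and P: "\<mu> * (\<Sum>j\<in>A. \<Sum>k\<in>B. (p j k / h)\<^sup>2) \<le> S\<^sup>2"
    and Q: "\<mu> * (\<Sum>j\<in>A. \<Sum>k\<in>B. (q j k)\<^sup>2) \<le> N\<^sup>2" and R: "\<mu> * (\<Sum>j\<in>A. \<Sum>k\<in>B. (r j k)\<^sup>2) \<le> N\<^sup>2"
    and S: "0 \<le> S" and N: "0 \<le> N"
  shows "(\<mu> / h) * (\<Sum>j\<in>A. \<Sum>k\<in>B. p j k * (q j k + r j k)) \<le> 2 * N * S"
proof -
  let ?C = "A \<times> B"
  have "((\<mu> / h) * (\<Sum>j\<in>A. \<Sum>k\<in>B. p j k * (q j k + r j k)))\<^sup>2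
    = \<mu>\<^sup>2 * (\<Sum>i\<in>?C. (p (fst i) (snd i) / h) * (q (fst i) (snd i) + r (fst i) (snd i)))\<^sup>2"
    by (simp add: sum.cartesian_product case_prod_unfold power_mult_distrib power_divide sum_divide_distrib[symmetric])
  also have "\<dots> \<le> \<mu>\<^sup>2 * ((\<Sum>i\<in>?C. (p (fst i) (snd i) / h)\<^sup>2) * (\<Sum>i\<in>?C. (q (fst i) (snd i) + r (fst i) (snd i))\<^sup>2))"
    by (intro mult_left_mono Cauchy_Schwarz_ineq_sum) auto
  also have "\<dots> = (\<mu> * (\<Sum>j\<in>A. \<Sum>k\<in>B. (p j k / h)\<^sup>2)) * (\<mu> * (\<Sum>j\<in>A. \<Sum>k\<in>B. (q j k + r j k)\<^sup>2))"
    by (simp add: sum.cartesian_product case_prod_unfold power2_eq_square)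
  also have "\<dots> \<le> S\<^sup>2 * (4 * N\<^sup>2)"
  proof (rule mult_mono[OF P])
    have "(\<Sum>j\<in>A. \<Sum>k\<in>B. (q j k + r j k)\<^sup>2) \<le> (\<Sum>j\<in>A. \<Sum>k\<in>B. 2 * (q j k)\<^sup>2 + 2 * (r j k)\<^sup>2)"
      by (intro sum_mono) (smt (verit) power2_sum sum_squares_bound)
    also have "\<dots> = 2 * (\<Sum>j\<in>A. \<Sum>k\<in>B. (q j k)\<^sup>2) + 2 * (\<Sum>j\<in>A. \<Sum>k\<in>B. (r j k)\<^sup>2)"
      by (simp add: sum.distrib sum_distrib_left)
    finally have "\<mu> * (\<Sum>j\<in>A. \<Sum>k\<in>B. (q j k + r j k)\<^sup>2)
        \<le> \<mu> * (2 * (\<Sum>j\<in>A. \<Sum>k\<in>B. (q j k)\<^sup>2) + 2 * (\<Sum>j\<in>A. \<Sum>k\<in>B. (r j k)\<^sup>2))"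
      using \<mu> by (intro mult_left_mono)
    also have "\<dots> \<le> 4 * N\<^sup>2" using Q R by (simp add: algebra_simps)
    finally show "\<mu> * (\<Sum>j\<in>A. \<Sum>k\<in>B. (q j k + r j k)\<^sup>2) \<le> 4 * N\<^sup>2" .
  qed (use \<mu> in \<open>auto intro!: mult_nonneg_nonneg sum_nonneg\<close>)
  also have "\<dots> = (2 * N * S)\<^sup>2" by (simp add: power_mult_distrib)
  finally show ?thesis by (rule power2_le_imp_le) (use S N in auto)
qed

text \<open>Ladyzhenskaya's argument: one factor \<open>|v|\<^sup>2\<close> is bounded by a sum along the row, the other by a sum along the column, so
the double sum factorises; each factor, scaled by a mesh width, is at most
\<open>2 \<parallel>v\<parallel> |v|\<^sub>1\<close> by Cauchy-Schwarz.\<close>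

lemma discrete_Ladyzhenskaya:
  assumes v: "v \<in> X0 J K" and J: "J \<ge> 1" and K: "K \<ge> 1" and h: "hx > 0" "hy > 0"
  shows "hx * hy * (\<Sum>j=1..<J. \<Sum>k=1..<K. (cmod (v j k)) ^ 4)
    \<le> 4 * (norm_h J K hx hy v)\<^sup>2 * (seminorm1_h J K hx hy v)\<^sup>2"
proof -
  let ?\<mu> = "hx * hy" and ?N = "norm_h J K hx hy v" and ?S = "seminorm1_h J K hx hy v"
  have \<mu>: "?\<mu> \<ge> 0" using h by simp
  have N0: "0 \<le> ?N" and S0: "0 \<le> ?S"
    using \<mu> by (auto simp: norm_h_def seminorm1_h_def intro!: mult_nonneg_nonneg sum_nonneg)
  define Px where "Px k = (\<Sum>j<J. cmod (v (j + 1) k - v j k) * (cmod (v (j + 1) k) + cmod (v j k)))" for k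
  define Py where "Py j = (\<Sum>k<K. cmod (v j (k + 1) - v j k) * (cmod (v j (k + 1)) + cmod (v j k)))" for j
  have Px: "(cmod (v j k))\<^sup>2 \<le> Px k" if "j \<le> J" "k \<le> K" for j k
    using discrete_max_bound[of "\<lambda>j. v j k" j J] X0_D(1)[OF v] that by (simp add: Px_def)
  have Py: "(cmod (v j k))\<^sup>2 \<le> Py j" if "j \<le> J" "k \<le> K" for j k
    using discrete_max_bound[of "\<lambda>k. v j k" k K] X0_D(3)[OF v] that by (simp add: Py_def)
  have P0: "0 \<le> Px k" "0 \<le> Py j" for j k by (auto simp: Px_def Py_def intro!: sum_nonneg)
  have lo: "(\<Sum>j<n. f j) = (\<Sum>j=1..<n. f j)" if "f 0 = (0::real)" "n \<ge> 1" for f :: "nat \<Rightarrow> real" and n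
  proof -
    have "{..<n} = insert 0 {1..<n}" using that by auto
    then show ?thesis using that by simp
  qed
  have hi: "(\<Sum>j<n. f (j + 1)) = (\<Sum>j=1..<n. f j)" if "f n = (0::real)" "n \<ge> 1" for f :: "nat \<Rightarrow> real" and n
  proof -
    have "(\<Sum>j<n. f (j + 1)) = (\<Sum>j=1..n. f j)"
      using sum.shift_bounds_Suc_ivl[of f 0 n] by (simp add: atLeast0LessThan atLeastLessThanSuc_atLeastAtMost)
    also have "{1..n} = insert n {1..<n}" using that by auto
    finally show ?thesis using that by simp
  qed
  have NN: "?\<mu> * (\<Sum>j=1..<J. \<Sum>k=1..<K. (cmod (v j k))\<^sup>2) = ?N\<^sup>2" by (simp add: norm_h_power2[OF \<mu>])
  have Sx: "?\<mu> * (\<Sum>j<J. \<Sum>k=1..<K. (cmod (v (j + 1) k - v j k) / hx)\<^sup>2) \<le> ?S\<^sup>2"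
    and Sy: "?\<mu> * (\<Sum>j=1..<J. \<Sum>k<K. (cmod (v j (k + 1) - v j k) / hy)\<^sup>2) \<le> ?S\<^sup>2"
  proof -
    have "(\<Sum>j<J. \<Sum>k=1..<K. (cmod (v (j + 1) k - v j k) / hx)\<^sup>2)
      \<le> (\<Sum>j<J. \<Sum>k<K. (cmod (v (j + 1) k - v j k) / hx)\<^sup>2)"
      by (intro sum_mono sum_mono2) auto
    also have "\<dots> \<le> (\<Sum>j<J. \<Sum>k<K. (cmod (dxp hx v j k))\<^sup>2 + (cmod (dyp hy v j k))\<^sup>2)"
      using h by (intro sum_mono) (simp add: dxp_def norm_divide)
    finally show "?\<mu> * (\<Sum>j<J. \<Sum>k=1..<K. (cmod (v (j + 1) k - v j k) / hx)\<^sup>2) \<le> ?S\<^sup>2"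
      using \<mu> by (simp add: seminorm1_h_power2[OF \<mu>] mult_left_mono)
    have "(\<Sum>j=1..<J. \<Sum>k<K. (cmod (v j (k + 1) - v j k) / hy)\<^sup>2)
      \<le> (\<Sum>j<J. \<Sum>k<K. (cmod (v j (k + 1) - v j k) / hy)\<^sup>2)"
      by (intro sum_mono2) (auto intro!: sum_nonneg)
    also have "\<dots> \<le> (\<Sum>j<J. \<Sum>k<K. (cmod (dxp hx v j k))\<^sup>2 + (cmod (dyp hy v j k))\<^sup>2)"
      using h by (intro sum_mono) (simp add: dyp_def norm_divide)
    finally show "?\<mu> * (\<Sum>j=1..<J. \<Sum>k<K. (cmod (v j (k + 1) - v j k) / hy)\<^sup>2) \<le> ?S\<^sup>2"
      using \<mu> by (simp add: seminorm1_h_power2[OF \<mu>] mult_left_mono)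
  qed
  have A: "hy * (\<Sum>k=1..<K. Px k) \<le> 2 * ?N * ?S"
  proof -
    have "(?\<mu> / hx) * (\<Sum>j<J. \<Sum>k=1..<K. cmod (v (j + 1) k - v j k) * (cmod (v (j + 1) k) + cmod (v j k))) \<le> 2 * ?N * ?S"
    proof (rule Cauchy_Schwarz_difference_sum[OF _ _ h(1) \<mu> Sx _ _ S0 N0])
      have "(\<Sum>j<J. \<Sum>k=1..<K. (cmod (v (j + 1) k))\<^sup>2) = (\<Sum>j=1..<J. \<Sum>k=1..<K. (cmod (v j k))\<^sup>2)"
        by (rule hi[OF _ J]) (simp add: X0_D(2)[OF v])
      then show "?\<mu> * (\<Sum>j<J. \<Sum>k=1..<K. (cmod (v (j + 1) k))\<^sup>2) \<le> ?N\<^sup>2" using NN by simp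
      have "(\<Sum>j<J. \<Sum>k=1..<K. (cmod (v j k))\<^sup>2) = (\<Sum>j=1..<J. \<Sum>k=1..<K. (cmod (v j k))\<^sup>2)"
        by (rule lo[OF _ J]) (simp add: X0_D(1)[OF v])
      then show "?\<mu> * (\<Sum>j<J. \<Sum>k=1..<K. (cmod (v j k))\<^sup>2) \<le> ?N\<^sup>2" using NN by simp
    qed auto
    also have "(\<Sum>j<J. \<Sum>k=1..<K. cmod (v (j + 1) k - v j k) * (cmod (v (j + 1) k) + cmod (v j k))) = (\<Sum>k=1..<K. Px k)"
      unfolding Px_def by (rule sum.swap)
    finally show ?thesis using h by simp
  qed
  have B: "hx * (\<Sum>j=1..<J. Py j) \<le> 2 * ?N * ?S"
  proof -
    have "(?\<mu> / hy) * (\<Sum>j=1..<J. \<Sum>k<K. cmod (v j (k + 1) - v j k) * (cmod (v j (k + 1)) + cmod (v j k))) \<le> 2 * ?N * ?S"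
    proof (rule Cauchy_Schwarz_difference_sum[OF _ _ h(2) \<mu> Sy _ _ S0 N0])
      have "(\<Sum>j=1..<J. \<Sum>k<K. (cmod (v j (k + 1)))\<^sup>2) = (\<Sum>j=1..<J. \<Sum>k=1..<K. (cmod (v j k))\<^sup>2)"
        by (intro sum.cong refl hi[OF _ K]) (simp add: X0_D(4)[OF v])
      then show "?\<mu> * (\<Sum>j=1..<J. \<Sum>k<K. (cmod (v j (k + 1)))\<^sup>2) \<le> ?N\<^sup>2" using NN by simp
      have "(\<Sum>j=1..<J. \<Sum>k<K. (cmod (v j k))\<^sup>2) = (\<Sum>j=1..<J. \<Sum>k=1..<K. (cmod (v j k))\<^sup>2)"
        by (intro sum.cong refl lo[OF _ K]) (simp add: X0_D(3)[OF v])
      then show "?\<mu> * (\<Sum>j=1..<J. \<Sum>k<K. (cmod (v j k))\<^sup>2) \<le> ?N\<^sup>2" using NN by simp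
    qed auto
    also have "(\<Sum>j=1..<J. \<Sum>k<K. cmod (v j (k + 1) - v j k) * (cmod (v j (k + 1)) + cmod (v j k))) = (\<Sum>j=1..<J. Py j)"
      by (simp add: Py_def)
    finally show ?thesis using h by simp
  qed
  have "(\<Sum>j=1..<J. \<Sum>k=1..<K. (cmod (v j k)) ^ 4) \<le> (\<Sum>j=1..<J. \<Sum>k=1..<K. Py j * Px k)"
  proof (intro sum_mono)
    fix j k assume jk: "j \<in> {1..<J}" "k \<in> {1..<K}"
    have "(cmod (v j k)) ^ 4 = (cmod (v j k))\<^sup>2 * (cmod (v j k))\<^sup>2" by (simp flip: power_add)
    also have "\<dots> \<le> Py j * Px k" using Px[of j k] Py[of j k] jk P0 by (intro mult_mono) auto
    finally show "(cmod (v j k)) ^ 4 \<le> Py j * Px k" .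
  qed
  also have "\<dots> = (\<Sum>j=1..<J. Py j) * (\<Sum>k=1..<K. Px k)" by (simp add: sum_product)
  finally have "?\<mu> * (\<Sum>j=1..<J. \<Sum>k=1..<K. (cmod (v j k)) ^ 4)
      \<le> ?\<mu> * ((\<Sum>j=1..<J. Py j) * (\<Sum>k=1..<K. Px k))"
    using \<mu> by (intro mult_left_mono)
  also have "\<dots> = (hx * (\<Sum>j=1..<J. Py j)) * (hy * (\<Sum>k=1..<K. Px k))"
    by (simp only: mult_ac)
  also have "\<dots> \<le> (2 * ?N * ?S) * (2 * ?N * ?S)"
    by (rule mult_mono[OF B A]) (use h N0 S0 P0 in \<open>auto intro!: mult_nonneg_nonneg sum_nonneg\<close>)
  finally show ?thesis by (simp add: power2_eq_square mult_ac)
qed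

section \<open>Stability\<close>

lemma two_mult_le: "2 * (p * q) \<le> p\<^sup>2 + q\<^sup>2" for p q :: real
  using sum_squares_bound[of p q] by (simp add: mult.assoc)

lemma cmod_source_bound: "(cmod (2 * of_real lam * F + \<xi>))\<^sup>2 \<le> 8 * lam\<^sup>2 * (cmod F)\<^sup>2 + 2 * (cmod \<xi>)\<^sup>2"
proof -
  have "(cmod (2 * of_real lam * F + \<xi>))\<^sup>2 \<le> (2 * \<bar>lam\<bar> * cmod F + cmod \<xi>)\<^sup>2"
    using norm_triangle_ineq[of "2 * of_real lam * F" \<xi>] by (intro power_mono) (auto simp: norm_mult)
  also have "\<dots> \<le> 2 * (2 * \<bar>lam\<bar> * cmod F)\<^sup>2 + 2 * (cmod \<xi>)\<^sup>2"
    using two_mult_le[of "2 * \<bar>lam\<bar> * cmod F" "cmod \<xi>"] by (simp add: power2_sum)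
  finally show ?thesis by (simp add: power_mult_distrib)
qed

text \<open>Multiplication by the conjugate of \<open>x'\<close> and the imaginary part. The term \<open>|x' - x|\<^sup>2\<close> produced by the implicit step
absorbs the pairing of the right-hand side with \<open>x' - x\<close>; what is left over carries an additional factor \<open>\<tau>\<close>. The last
term vanishes after summation over the grid.\<close>

lemma pointwise_energy:
  assumes \<tau>: "\<tau> > 0" and eq: "\<i> * ((x' - x) / of_real \<tau>) + L = 2 * of_real lam * F + \<xi>"
    and mono: "\<bar>Im (F * cnj x)\<bar> \<le> (cmod x)\<^sup>2"
  shows "(cmod x')\<^sup>2 \<le> (cmod x)\<^sup>2 + \<tau> * ((4 * \<bar>lam\<bar> + 1) * (cmod x)\<^sup>2 + (1 + 2 * \<tau>) * (cmod \<xi>)\<^sup>2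
      + 8 * lam\<^sup>2 * (\<tau> * (cmod F)\<^sup>2)) - 2 * \<tau> * Im (L * cnj x')"
proof -
  define G where "G = 2 * of_real lam * F + \<xi>"
  have eq': "\<i> * (x' - x) = of_real \<tau> * (G - L)"
    using eq \<tau> by (simp add: G_def field_simps)
  have "2 * Re ((x' - x) * cnj x') = (cmod x')\<^sup>2 - (cmod x)\<^sup>2 + (cmod (x' - x))\<^sup>2"
    unfolding cmod_power2 by (simp add: power2_eq_square algebra_simps)
  moreover have "Re ((x' - x) * cnj x') = Im (\<i> * (x' - x) * cnj x')" by (simp add: algebra_simps)
  moreover have "\<dots> = \<tau> * Im (G * cnj x') - \<tau> * Im (L * cnj x')"
    unfolding eq' by (simp add: algebra_simps)
  moreover have "Im (G * cnj x') = Im (G * cnj x) + Im (G * cnj (x' - x))" by (simp add: algebra_simps)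
  ultimately have 1: "(cmod x')\<^sup>2 = (cmod x)\<^sup>2 - (cmod (x' - x))\<^sup>2 + 2 * \<tau> * Im (G * cnj x)
      + 2 * \<tau> * Im (G * cnj (x' - x)) - 2 * \<tau> * Im (L * cnj x')" by (simp add: algebra_simps)
  have 2: "Im (G * cnj x) \<le> 2 * \<bar>lam\<bar> * (cmod x)\<^sup>2 + ((cmod \<xi>)\<^sup>2 + (cmod x)\<^sup>2) / 2"
  proof -
    have "Im (G * cnj x) = 2 * lam * Im (F * cnj x) + Im (\<xi> * cnj x)" by (simp add: G_def algebra_simps)
    also have "2 * lam * Im (F * cnj x) \<le> 2 * \<bar>lam\<bar> * (cmod x)\<^sup>2"
    proof -
      have "lam * Im (F * cnj x) \<le> \<bar>lam\<bar> * \<bar>Im (F * cnj x)\<bar>" by (metis abs_ge_self abs_mult)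
      also have "\<dots> \<le> \<bar>lam\<bar> * (cmod x)\<^sup>2" using mono by (intro mult_left_mono) auto
      finally show ?thesis by simp
    qed
    also have "Im (\<xi> * cnj x) \<le> cmod (\<xi> * cnj x)" using abs_Im_le_cmod abs_le_D1 by blast
    also have "\<dots> \<le> ((cmod \<xi>)\<^sup>2 + (cmod x)\<^sup>2) / 2" using two_mult_le[of "cmod \<xi>" "cmod x"] by (simp add: norm_mult)
    finally show ?thesis by simp
  qed
  have 3: "2 * \<tau> * Im (G * cnj (x' - x)) \<le> (cmod (x' - x))\<^sup>2 + \<tau>\<^sup>2 * (8 * lam\<^sup>2 * (cmod F)\<^sup>2 + 2 * (cmod \<xi>)\<^sup>2)"
  proof -
    have "Im (G * cnj (x' - x)) \<le> cmod (G * cnj (x' - x))" using abs_Im_le_cmod abs_le_D1 by blast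
    also have "\<dots> = cmod G * cmod (x' - x)" by (simp only: norm_mult complex_mod_cnj)
    finally have "2 * \<tau> * Im (G * cnj (x' - x)) \<le> 2 * \<tau> * (cmod G * cmod (x' - x))"
      using \<tau> by (intro mult_left_mono) auto
    also have "\<dots> = 2 * ((\<tau> * cmod G) * cmod (x' - x))" by simp
    also have "\<dots> \<le> (\<tau> * cmod G)\<^sup>2 + (cmod (x' - x))\<^sup>2" by (rule two_mult_le)
    also have "(\<tau> * cmod G)\<^sup>2 \<le> \<tau>\<^sup>2 * (8 * lam\<^sup>2 * (cmod F)\<^sup>2 + 2 * (cmod \<xi>)\<^sup>2)"
      unfolding power_mult_distrib G_def by (intro mult_left_mono cmod_source_bound) auto
    finally show ?thesis by simp
  qed
  have "2 * \<tau> * Im (G * cnj x) \<le> 2 * \<tau> * (2 * \<bar>lam\<bar> * (cmod x)\<^sup>2 + ((cmod \<xi>)\<^sup>2 + (cmod x)\<^sup>2) / 2)"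
    using 2 \<tau> by (intro mult_left_mono) auto
  with 1 3 have "(cmod x')\<^sup>2 \<le> (cmod x)\<^sup>2 + 2 * \<tau> * (2 * \<bar>lam\<bar> * (cmod x)\<^sup>2 + ((cmod \<xi>)\<^sup>2 + (cmod x)\<^sup>2) / 2)
      + \<tau>\<^sup>2 * (8 * lam\<^sup>2 * (cmod F)\<^sup>2 + 2 * (cmod \<xi>)\<^sup>2) - 2 * \<tau> * Im (L * cnj x')" by linarith
  also have "\<dots> = (cmod x)\<^sup>2 + \<tau> * ((4 * \<bar>lam\<bar> + 1) * (cmod x)\<^sup>2 + (1 + 2 * \<tau>) * (cmod \<xi>)\<^sup>2
      + 8 * lam\<^sup>2 * (\<tau> * (cmod F)\<^sup>2)) - 2 * \<tau> * Im (L * cnj x')"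
    by (simp add: field_simps power2_eq_square[of \<tau>])
  finally show ?thesis .
qed

text \<open>The same multiplication with the real part, which after summation isolates the discrete gradient.\<close>

lemma pointwise_gradient:
  assumes \<tau>: "\<tau> > 0" and eq: "\<i> * ((x' - x) / of_real \<tau>) + L = 2 * of_real lam * F + \<xi>"
  shows "- \<tau> * Re (L * cnj x') \<le> (cmod x)\<^sup>2 / 2 + 2 * (cmod x')\<^sup>2 + \<tau>\<^sup>2 * (4 * lam\<^sup>2 * (cmod F)\<^sup>2 + (cmod \<xi>)\<^sup>2)"
proof -
  define G where "G = 2 * of_real lam * F + \<xi>"
  have "of_real \<tau> * L = of_real \<tau> * G - \<i> * (x' - x)"
    using eq \<tau> by (simp add: G_def field_simps)
  then have "of_real \<tau> * L * cnj x' = of_real \<tau> * G * cnj x' - \<i> * (x' - x) * cnj x'"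
    by (simp add: left_diff_distrib)
  then have "Re (of_real \<tau> * (L * cnj x')) = Re (of_real \<tau> * G * cnj x' - \<i> * (x' - x) * cnj x')"
    by (simp only: mult.assoc)
  then have "- \<tau> * Re (L * cnj x') = Re (\<i> * (x' - x) * cnj x' - of_real \<tau> * G * cnj x')"
    by (simp add: algebra_simps)
  also have "\<dots> \<le> cmod (\<i> * (x' - x) * cnj x' - of_real \<tau> * G * cnj x')" by (rule complex_Re_le_cmod)
  also have "\<dots> \<le> cmod (\<i> * (x' - x) * cnj x') + cmod (of_real \<tau> * G * cnj x')" by (rule norm_triangle_ineq4)
  also have "\<dots> = cmod (x' - x) * cmod x' + (\<tau> * cmod G) * cmod x'"
    using \<tau> by (simp only: norm_mult complex_mod_cnj norm_ii norm_of_real)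
  also have "cmod (x' - x) * cmod x' \<le> (cmod x' + cmod x) * cmod x'"
    by (intro mult_right_mono norm_triangle_ineq4) auto
  also have "(cmod x' + cmod x) * cmod x' \<le> (cmod x)\<^sup>2 / 2 + 3 / 2 * (cmod x')\<^sup>2"
    using two_mult_le[of "cmod x" "cmod x'"] by (simp add: algebra_simps power2_eq_square)
  also have "(\<tau> * cmod G) * cmod x' \<le> (\<tau>\<^sup>2 * (8 * lam\<^sup>2 * (cmod F)\<^sup>2 + 2 * (cmod \<xi>)\<^sup>2)) / 2 + (cmod x')\<^sup>2 / 2"
  proof -
    have "(\<tau> * cmod G)\<^sup>2 \<le> \<tau>\<^sup>2 * (8 * lam\<^sup>2 * (cmod F)\<^sup>2 + 2 * (cmod \<xi>)\<^sup>2)"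
      unfolding power_mult_distrib G_def by (intro mult_left_mono cmod_source_bound) auto
    then show ?thesis using two_mult_le[of "\<tau> * cmod G" "cmod x'"] by simp
  qed
  finally show ?thesis by (simp add: algebra_simps add_divide_distrib)
qed

definition mesh_sum :: "nat \<Rightarrow> nat \<Rightarrow> real \<Rightarrow> real \<Rightarrow> (nat \<Rightarrow> nat \<Rightarrow> real) \<Rightarrow> real" where
  "mesh_sum J K hx hy f = hx * hy * (\<Sum>j=1..<J. \<Sum>k=1..<K. f j k)"

lemma mesh_sum_mono:
  assumes "0 \<le> hx * hy" "\<And>j k. j \<in> {1..<J} \<Longrightarrow> k \<in> {1..<K} \<Longrightarrow> f j k \<le> g j k"
  shows "mesh_sum J K hx hy f \<le> mesh_sum J K hx hy g"
  unfolding mesh_sum_def using assms by (intro mult_left_mono sum_mono) auto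

lemma mesh_sum_add: "mesh_sum J K hx hy (\<lambda>j k. f j k + g j k) = mesh_sum J K hx hy f + mesh_sum J K hx hy g"
  by (simp add: mesh_sum_def sum.distrib distrib_left)

lemma mesh_sum_cmult: "mesh_sum J K hx hy (\<lambda>j k. r * f j k) = r * mesh_sum J K hx hy f"
  by (simp add: mesh_sum_def sum_distrib_left mult_ac)

lemma mesh_sum_diff: "mesh_sum J K hx hy (\<lambda>j k. f j k - g j k) = mesh_sum J K hx hy f - mesh_sum J K hx hy g"
  by (simp add: mesh_sum_def sum_subtractf right_diff_distrib)

lemma mesh_sum_const_le:
  assumes "0 \<le> hx" "0 \<le> hy" "0 \<le> r" "(real J * hx) * (real K * hy) \<le> A"
  shows "mesh_sum J K hx hy (\<lambda>j k. r) \<le> A * r"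
proof -
  have "mesh_sum J K hx hy (\<lambda>j k. r) = ((real (J - 1) * hx) * (real (K - 1) * hy)) * r"
    by (simp add: mesh_sum_def)
  also have "\<dots> \<le> ((real J * hx) * (real K * hy)) * r"
    using assms by (intro mult_right_mono mult_mono) auto
  also have "\<dots> \<le> A * r" using assms by (intro mult_right_mono)
  finally show ?thesis .
qed

lemma mesh_sum_lap:
  assumes v: "v \<in> X0 J K" and J: "J \<ge> 1" and K: "K \<ge> 1" and h: "hx > 0" "hy > 0"
  shows "mesh_sum J K hx hy (\<lambda>j k. Im (lap_h hx hy v j k * cnj (v j k))) = 0"
    and "mesh_sum J K hx hy (\<lambda>j k. Re (lap_h hx hy v j k * cnj (v j k))) = - (seminorm1_h J K hx hy v)\<^sup>2"
proof -
  note p = lap_h_by_parts[OF assms]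
  have "Im (of_real (hx * hy) * (\<Sum>j=1..<J. \<Sum>k=1..<K. lap_h hx hy v j k * cnj (v j k))) = 0"
    "Re (of_real (hx * hy) * (\<Sum>j=1..<J. \<Sum>k=1..<K. lap_h hx hy v j k * cnj (v j k))) = - (seminorm1_h J K hx hy v)\<^sup>2"
    unfolding p by simp_all
  then show "mesh_sum J K hx hy (\<lambda>j k. Im (lap_h hx hy v j k * cnj (v j k))) = 0"
    "mesh_sum J K hx hy (\<lambda>j k. Re (lap_h hx hy v j k * cnj (v j k))) = - (seminorm1_h J K hx hy v)\<^sup>2"
    by (simp_all only: mesh_sum_def Im_complex_of_real Re_complex_of_real Im_sum Re_sum
        times_complex.sel)
qed

lemma stability_step:
  fixes e e' F \<xi> :: "nat \<Rightarrow> nat \<Rightarrow> complex"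
  assumes e': "e' \<in> X0 J K" and J: "J \<ge> 1" and K: "K \<ge> 1" and h: "hx > 0" "hy > 0"
    and \<tau>: "\<tau> > 0" "\<tau> \<le> 1"
    and eq: "\<And>j k. j \<in> {1..<J} \<Longrightarrow> k \<in> {1..<K} \<Longrightarrow>
      \<i> * ((e' j k - e j k) / of_real \<tau>) + lap_h hx hy e' j k = 2 * of_real lam * F j k + \<xi> j k"
    and mono: "\<And>j k. j \<in> {1..<J} \<Longrightarrow> k \<in> {1..<K} \<Longrightarrow> \<bar>Im (F j k * cnj (e j k))\<bar> \<le> (cmod (e j k))\<^sup>2"
    and G: "mesh_sum J K hx hy (\<lambda>j k. \<tau> * (cmod (F j k))\<^sup>2) \<le> G"
    and Z: "mesh_sum J K hx hy (\<lambda>j k. (cmod (\<xi> j k))\<^sup>2) \<le> Z"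
  shows "(norm_h J K hx hy e')\<^sup>2 \<le> (norm_h J K hx hy e)\<^sup>2
      + \<tau> * ((4 * \<bar>lam\<bar> + 1) * (norm_h J K hx hy e)\<^sup>2 + 3 * Z + 8 * lam\<^sup>2 * G)" (is ?L2)
    and "\<tau> * (seminorm1_h J K hx hy e')\<^sup>2
      \<le> (norm_h J K hx hy e)\<^sup>2 / 2 + 2 * (norm_h J K hx hy e')\<^sup>2 + 4 * lam\<^sup>2 * G + Z" (is ?H1)
proof -
  let ?M = "mesh_sum J K hx hy"
  have \<mu>: "0 \<le> hx * hy" using h by simp
  have N: "(norm_h J K hx hy w)\<^sup>2 = ?M (\<lambda>j k. (cmod (w j k))\<^sup>2)" for w
    by (simp add: norm_h_power2[OF \<mu>] mesh_sum_def)
  have Z0: "0 \<le> Z" and G0: "0 \<le> G"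
    using \<tau> by (auto intro!: order_trans[OF _ Z] order_trans[OF _ G] mult_nonneg_nonneg[OF \<mu>] sum_nonneg simp: mesh_sum_def)
  note lap = mesh_sum_lap[OF e' J K h]
  have "?M (\<lambda>j k. (cmod (e' j k))\<^sup>2) \<le> ?M (\<lambda>j k. (cmod (e j k))\<^sup>2 + \<tau> * ((4 * \<bar>lam\<bar> + 1) * (cmod (e j k))\<^sup>2
      + (1 + 2 * \<tau>) * (cmod (\<xi> j k))\<^sup>2 + 8 * lam\<^sup>2 * (\<tau> * (cmod (F j k))\<^sup>2))
      - 2 * \<tau> * Im (lap_h hx hy e' j k * cnj (e' j k)))"
    by (intro mesh_sum_mono \<mu> pointwise_energy \<tau> eq mono)
  also have "\<dots> = ?M (\<lambda>j k. (cmod (e j k))\<^sup>2) + \<tau> * ((4 * \<bar>lam\<bar> + 1) * ?M (\<lambda>j k. (cmod (e j k))\<^sup>2)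
      + (1 + 2 * \<tau>) * ?M (\<lambda>j k. (cmod (\<xi> j k))\<^sup>2) + 8 * lam\<^sup>2 * ?M (\<lambda>j k. \<tau> * (cmod (F j k))\<^sup>2))"
    by (simp only: mesh_sum_add mesh_sum_diff mesh_sum_cmult lap)
  also have "\<dots> \<le> ?M (\<lambda>j k. (cmod (e j k))\<^sup>2) + \<tau> * ((4 * \<bar>lam\<bar> + 1) * ?M (\<lambda>j k. (cmod (e j k))\<^sup>2)
      + 3 * Z + 8 * lam\<^sup>2 * G)"
  proof (intro add_left_mono mult_left_mono add_mono order_refl)
    have "(1 + 2 * \<tau>) * ?M (\<lambda>j k. (cmod (\<xi> j k))\<^sup>2) \<le> (1 + 2 * \<tau>) * Z" using Z \<tau> by (intro mult_left_mono) auto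
    also have "\<dots> \<le> 3 * Z" using Z0 \<tau> by (intro mult_right_mono) auto
    finally show "(1 + 2 * \<tau>) * ?M (\<lambda>j k. (cmod (\<xi> j k))\<^sup>2) \<le> 3 * Z" .
  qed (use G \<tau> in auto)
  finally show ?L2 by (simp only: N)
  have "?M (\<lambda>j k. - \<tau> * Re (lap_h hx hy e' j k * cnj (e' j k))) \<le> ?M (\<lambda>j k. 1 / 2 * (cmod (e j k))\<^sup>2 + 2 * (cmod (e' j k))\<^sup>2
      + (4 * lam\<^sup>2 * \<tau> * (\<tau> * (cmod (F j k))\<^sup>2) + \<tau>\<^sup>2 * (cmod (\<xi> j k))\<^sup>2))"
  proof (rule mesh_sum_mono[OF \<mu>])
    fix j k assume "j \<in> {1..<J}" "k \<in> {1..<K}"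
    from pointwise_gradient[OF \<tau>(1) eq[OF this]]
    show "- \<tau> * Re (lap_h hx hy e' j k * cnj (e' j k)) \<le> 1 / 2 * (cmod (e j k))\<^sup>2 + 2 * (cmod (e' j k))\<^sup>2
      + (4 * lam\<^sup>2 * \<tau> * (\<tau> * (cmod (F j k))\<^sup>2) + \<tau>\<^sup>2 * (cmod (\<xi> j k))\<^sup>2)"
      by (simp add: distrib_left power2_eq_square[of \<tau>] mult_ac)
  qed
  then have "\<tau> * (seminorm1_h J K hx hy e')\<^sup>2 \<le> 1 / 2 * ?M (\<lambda>j k. (cmod (e j k))\<^sup>2) + 2 * ?M (\<lambda>j k. (cmod (e' j k))\<^sup>2)
      + (4 * lam\<^sup>2 * \<tau> * ?M (\<lambda>j k. \<tau> * (cmod (F j k))\<^sup>2) + \<tau>\<^sup>2 * ?M (\<lambda>j k. (cmod (\<xi> j k))\<^sup>2))"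
    by (simp only: mesh_sum_add mesh_sum_cmult lap minus_mult_minus)
  also have "4 * lam\<^sup>2 * \<tau> * ?M (\<lambda>j k. \<tau> * (cmod (F j k))\<^sup>2) \<le> 4 * lam\<^sup>2 * 1 * G"
    using G G0 \<tau> by (intro mult_mono)
      (auto simp: mesh_sum_def intro!: mult_nonneg_nonneg[OF \<mu>] sum_nonneg)
  also have "\<tau>\<^sup>2 * ?M (\<lambda>j k. (cmod (\<xi> j k))\<^sup>2) \<le> 1 * Z"
    using Z Z0 \<tau> by (intro mult_mono) (auto simp: power_le_one mesh_sum_def intro!: mult_nonneg_nonneg[OF \<mu>] sum_nonneg)
  finally show ?H1 by (simp add: N)
qed

text \<open>The constants of the induction: \<open>296 = 8 \<cdot> 37\<close> and \<open>192 = 8 \<cdot> 24\<close>, where \<open>37 \<parallel>e\<parallel>\<^sup>2 + 24 A E\<^sup>2\<close> bounds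
\<open>\<tau> \<parallel>f(v) - f(w)\<parallel>\<^sup>2\<close>. The exponential is the Gronwall factor.\<close>

definition L2_const :: "real \<Rightarrow> real \<Rightarrow> real \<Rightarrow> real \<Rightarrow> real" where
  "L2_const lam A B T = T * (3 * A * B\<^sup>2 + 192 * lam\<^sup>2 * A) * exp (T * (4 * \<bar>lam\<bar> + 1 + 296 * lam\<^sup>2))"

definition H1_const :: "real \<Rightarrow> real \<Rightarrow> real \<Rightarrow> real \<Rightarrow> real" where
  "H1_const lam A B T = 5 / 2 * L2_const lam A B T + 4 * lam\<^sup>2 * (37 * L2_const lam A B T + 24 * A) + A * B\<^sup>2"

text \<open>Induction on \<open>n\<close> with both estimates at once. The \<open>H\<^sup>1\<close> bound at step \<open>n\<close>, together with the smallness of \<open>E\<close>,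
gives \<open>\<tau> |e\<^sup>n|\<^sub>1\<^sup>2 \<le> 1\<close>, which makes the quartic term of the nonlinearity a multiple of \<open>\<parallel>e\<^sup>n\<parallel>\<^sup>2\<close>; this is what the
\<open>L\<^sup>2\<close> bound at step \<open>n + 1\<close> requires, and that in turn gives the next \<open>H\<^sup>1\<close> bound.\<close>

lemma stability:
  fixes v w e \<xi> :: "nat \<Rightarrow> nat \<Rightarrow> nat \<Rightarrow> complex"
  assumes J: "J \<ge> 1" and K: "K \<ge> 1" and h: "hx > 0" "hy > 0" and \<tau>: "\<tau> > 0" "\<tau> \<le> 1"
    and small: "3 * \<tau> * (1 + M)\<^sup>2 \<le> 1" "H1_const lam A B T * E\<^sup>2 \<le> 1" and E: "\<tau> \<le> E"
    and T: "real N * \<tau> \<le> T" and A: "(real J * hx) * (real K * hy) \<le> A" and B: "0 \<le> B"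
    and e: "\<And>n. n \<le> N \<Longrightarrow> e n \<in> X0 J K" and e_eq: "\<And>n j k. e n j k = v n j k - w n j k"
    and init: "\<And>j k. j \<le> J \<Longrightarrow> k \<le> K \<Longrightarrow> e 0 j k = 0"
    and v: "\<And>n j k. n \<le> N \<Longrightarrow> j \<in> {1..<J} \<Longrightarrow> k \<in> {1..<K} \<Longrightarrow> cmod (v n j k) \<le> M"
    and eq: "\<And>n j k. n < N \<Longrightarrow> j \<in> {1..<J} \<Longrightarrow> k \<in> {1..<K} \<Longrightarrow>
      \<i> * ((e (Suc n) j k - e n j k) / of_real \<tau>) + lap_h hx hy (e (Suc n)) j k
        = 2 * of_real lam * (flog (v n j k) - flog (w n j k)) + \<xi> n j k"
    and \<xi>: "\<And>n j k. n < N \<Longrightarrow> j \<in> {1..<J} \<Longrightarrow> k \<in> {1..<K} \<Longrightarrow> cmod (\<xi> n j k) \<le> B * E"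
    and n: "n \<le> N"
  shows "(norm_h J K hx hy (e n))\<^sup>2 \<le> L2_const lam A B T * E\<^sup>2"
    and "\<tau> * (seminorm1_h J K hx hy (e n))\<^sup>2 \<le> H1_const lam A B T * E\<^sup>2"
proof -
  let ?M = "mesh_sum J K hx hy"
  let ?N = "\<lambda>n. (norm_h J K hx hy (e n))\<^sup>2" and ?S = "\<lambda>n. (seminorm1_h J K hx hy (e n))\<^sup>2"
  have \<mu>: "0 \<le> hx * hy" using h by simp
  have A0: "0 \<le> A" using h by (intro order_trans[OF _ A]) auto
  have T0: "0 \<le> T" using \<tau> by (intro order_trans[OF _ T]) auto
  define L where "L = 4 * \<bar>lam\<bar> + 1 + 296 * lam\<^sup>2"
  define R where "R = 3 * A * B\<^sup>2 + 192 * lam\<^sup>2 * A"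
  have L0: "0 \<le> L" and R0: "0 \<le> R" using A0 by (auto simp: L_def R_def)
  let ?Q = "L2_const lam A B T" and ?W = "H1_const lam A B T"
  have Q: "?Q = T * R * exp (T * L)" by (simp add: L2_const_def L_def R_def)
  have Q0: "0 \<le> ?Q" using T0 R0 by (simp add: Q)
  have W0: "0 \<le> ?W" using Q0 A0 by (simp add: H1_const_def)
  have E2: "\<tau>\<^sup>2 \<le> E\<^sup>2" using \<tau> E by (intro power_mono) auto
  have toQ: "real n * \<tau> * R * exp (real n * \<tau> * L) * E\<^sup>2 \<le> ?Q * E\<^sup>2" if "n \<le> N" for n
  proof -
    have "real n * \<tau> \<le> real N * \<tau>" using that \<tau> by (intro mult_right_mono) auto
    then have "real n * \<tau> \<le> T" using T by linarith
    moreover from this have "real n * \<tau> * L \<le> T * L" using L0 by (rule mult_right_mono)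
    ultimately show ?thesis unfolding Q using R0 T0 \<tau> by (intro mult_right_mono mult_mono) auto
  qed
  have main: "?N n \<le> real n * \<tau> * R * exp (real n * \<tau> * L) * E\<^sup>2 \<and> \<tau> * ?S n \<le> ?W * E\<^sup>2" if "n \<le> N" for n
    using that
  proof (induction n)
    case 0
    have "norm_h J K hx hy (e 0) = 0" by (simp add: norm_h_def init)
    moreover have "seminorm1_h J K hx hy (e 0) = 0" by (simp add: seminorm1_h_def init dxp_def dyp_def)
    ultimately show ?case using W0 by simp
  next
    case (Suc n)
    then have n: "n < N" "n \<le> N" by auto
    have IH: "?N n \<le> real n * \<tau> * R * exp (real n * \<tau> * L) * E\<^sup>2" "\<tau> * ?S n \<le> ?W * E\<^sup>2" using Suc by auto
    define F where "F j k = flog (v n j k) - flog (w n j k)" for j k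
    have ev: "e n j k = v n j k - w n j k" for j k by (rule e_eq)
    have "?M (\<lambda>j k. \<tau> * (cmod (F j k))\<^sup>2) \<le> ?M (\<lambda>j k. 25 * (cmod (e n j k))\<^sup>2 + (3 * \<tau>) * (cmod (e n j k)) ^ 4 + 24 * \<tau>\<^sup>2)"
      unfolding F_def ev using scaled_flog_diff_bound[OF v[OF n(2)] \<tau>(1) small(1)]
      by (intro mesh_sum_mono \<mu>) (simp add: mult.assoc)
    also have "\<dots> = 25 * ?N n + (3 * \<tau>) * ?M (\<lambda>j k. (cmod (e n j k)) ^ 4) + ?M (\<lambda>j k. 24 * \<tau>\<^sup>2)"
      by (simp only: mesh_sum_add mesh_sum_cmult norm_h_power2[OF \<mu>] mesh_sum_def[of J K hx hy "\<lambda>j k. (cmod (e n j k))\<^sup>2"])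
    also have "(3 * \<tau>) * ?M (\<lambda>j k. (cmod (e n j k)) ^ 4) \<le> (3 * \<tau>) * (4 * ?N n * ?S n)"
      using discrete_Ladyzhenskaya[OF e[OF n(2)] J K h] \<tau> by (intro mult_left_mono) (auto simp: mesh_sum_def)
    also have "(3 * \<tau>) * (4 * ?N n * ?S n) = 12 * ?N n * (\<tau> * ?S n)" by simp
    also have "\<dots> \<le> 12 * ?N n * 1" using IH(2) small(2) by (intro mult_left_mono) auto
    also have "?M (\<lambda>j k. 24 * \<tau>\<^sup>2) \<le> A * (24 * \<tau>\<^sup>2)" using h by (intro mesh_sum_const_le A) auto
    also have "A * (24 * \<tau>\<^sup>2) \<le> A * (24 * E\<^sup>2)" using E2 A0 by (intro mult_left_mono) auto
    finally have G: "?M (\<lambda>j k. \<tau> * (cmod (F j k))\<^sup>2) \<le> 37 * ?N n + 24 * A * E\<^sup>2" by simp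
    have "?M (\<lambda>j k. (cmod (\<xi> n j k))\<^sup>2) \<le> ?M (\<lambda>j k. (B * E)\<^sup>2)"
      using \<xi>[OF n(1)] by (intro mesh_sum_mono \<mu> power_mono) auto
    also have "\<dots> \<le> A * (B * E)\<^sup>2" using h by (intro mesh_sum_const_le A) auto
    finally have Z: "?M (\<lambda>j k. (cmod (\<xi> n j k))\<^sup>2) \<le> A * B\<^sup>2 * E\<^sup>2" by (simp add: power_mult_distrib mult.assoc)
    have mono: "\<bar>Im (F j k * cnj (e n j k))\<bar> \<le> (cmod (e n j k))\<^sup>2" for j k
      unfolding F_def ev by (rule flog_monotone)
    note step = stability_step[OF e[OF Suc.prems] J K h \<tau> eq[OF n(1), folded F_def] mono G Z]
    have "?N (Suc n) \<le> ?N n + \<tau> * ((4 * \<bar>lam\<bar> + 1) * ?N n + 3 * (A * B\<^sup>2 * E\<^sup>2) + 8 * lam\<^sup>2 * (37 * ?N n + 24 * A * E\<^sup>2))"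
      by (rule step(1))
    also have "\<dots> = ?N n * (1 + \<tau> * L) + \<tau> * R * E\<^sup>2" by (simp add: L_def R_def algebra_simps)
    also have "\<dots> \<le> (real n * \<tau> * R * exp (real n * \<tau> * L) * E\<^sup>2) * exp (\<tau> * L) + \<tau> * R * E\<^sup>2 * exp (real (Suc n) * \<tau> * L)"
    proof (rule add_mono)
      show "?N n * (1 + \<tau> * L) \<le> (real n * \<tau> * R * exp (real n * \<tau> * L) * E\<^sup>2) * exp (\<tau> * L)"
        by (rule mult_mono[OF IH(1) exp_ge_add_one_self]) (use \<tau> R0 L0 in auto)
      have "1 \<le> exp (real (Suc n) * \<tau> * L)" using \<tau> L0 by simp
      then have "\<tau> * R * E\<^sup>2 * 1 \<le> \<tau> * R * E\<^sup>2 * exp (real (Suc n) * \<tau> * L)"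
        by (rule mult_left_mono) (use \<tau> R0 in auto)
      then show "\<tau> * R * E\<^sup>2 \<le> \<tau> * R * E\<^sup>2 * exp (real (Suc n) * \<tau> * L)" by simp
    qed
    also have "\<dots> = real (Suc n) * \<tau> * R * exp (real (Suc n) * \<tau> * L) * E\<^sup>2"
    proof -
      have "exp (real n * \<tau> * L) * exp (\<tau> * L) = exp (real (Suc n) * \<tau> * L)"
        by (simp add: algebra_simps flip: exp_add)
      then have ex: "exp (real (Suc n) * \<tau> * L) = exp (real n * \<tau> * L) * exp (\<tau> * L)" by simp
      have ring: "(real n * \<tau> * R * p * E\<^sup>2) * q + \<tau> * R * E\<^sup>2 * (p * q) = real (Suc n) * \<tau> * R * (p * q) * E\<^sup>2" for p q
        by (simp add: algebra_simps)
      show ?thesis unfolding ex by (rule ring)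
    qed
    finally have N': "?N (Suc n) \<le> real (Suc n) * \<tau> * R * exp (real (Suc n) * \<tau> * L) * E\<^sup>2" .
    have "?N n \<le> ?Q * E\<^sup>2" "?N (Suc n) \<le> ?Q * E\<^sup>2"
      using IH(1) N' toQ[OF n(2)] toQ[OF Suc.prems] by linarith+
    note NQ = this
    have "\<tau> * ?S (Suc n) \<le> ?N n / 2 + 2 * ?N (Suc n) + 4 * lam\<^sup>2 * (37 * ?N n + 24 * A * E\<^sup>2) + A * B\<^sup>2 * E\<^sup>2"
      by (rule step(2))
    also have "\<dots> \<le> (?Q * E\<^sup>2) / 2 + 2 * (?Q * E\<^sup>2) + 4 * lam\<^sup>2 * (37 * (?Q * E\<^sup>2) + 24 * A * E\<^sup>2) + A * B\<^sup>2 * E\<^sup>2"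
      using NQ by (intro add_mono mult_left_mono divide_right_mono order_refl) auto
    also have "\<dots> = ?W * E\<^sup>2" by (simp add: H1_const_def algebra_simps)
    finally show ?case using N' by blast
  qed
  show "(norm_h J K hx hy (e n))\<^sup>2 \<le> ?Q * E\<^sup>2" "\<tau> * (seminorm1_h J K hx hy (e n))\<^sup>2 \<le> ?W * E\<^sup>2"
    using main[OF n] toQ[OF n] by auto
qed

section \<open>Convergence\<close>

text \<open>Absolute values make the constant positive for all real arguments; for those that occur in the theorem both constants
under the roots are nonnegative.\<close>

definition error_const :: "real \<Rightarrow> real \<Rightarrow> real \<Rightarrow> real \<Rightarrow> real \<Rightarrow> real \<Rightarrow> real" where
  "error_const p1 p2 p3 l A S =
     1 + sqrt \<bar>L2_const l A (\<bar>p1\<bar> + 2 * \<bar>p2\<bar> + 4 * \<bar>p3\<bar>) S\<bar>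
       + sqrt \<bar>H1_const l A (\<bar>p1\<bar> + 2 * \<bar>p2\<bar> + 4 * \<bar>p3\<bar>) S\<bar>"

lemma error_const_pos: "0 < error_const p1 p2 p3 l A S"
  unfolding error_const_def by (intro add_pos_nonneg) auto

lemma abs_lam_consts: "L2_const \<bar>lam\<bar> A B T = L2_const lam A B T" "H1_const \<bar>lam\<bar> A B T = H1_const lam A B T"
  by (simp_all add: L2_const_def H1_const_def)

context smooth_solution
begin

definition "trunc_const = \<bar>m1\<bar> + 2 * \<bar>m2\<bar> + 4 * \<bar>m3\<bar>"
definition "area = measure lebesgue \<Omega>"

lemma truncation_error:
  assumes t: "t \<in> {0..T}" and r: "t + \<tau> \<in> {0..T}" and \<tau>: "\<tau> > 0" and h: "hx > 0" "hy > 0"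
    and j: "j \<in> {1..<J}" and k: "k \<in> {1..<K}" and hx: "hx = (b - a) / real J" and hy: "hy = (d - c) / real K"
  defines "g \<equiv> \<lambda>s j k. u s (a + real j * hx, c + real k * hy)"
  shows "cmod (\<i> * ((g (t + \<tau>) j k - g t j k) / of_real \<tau>) + lap_h hx hy (g (t + \<tau>)) j k
      - 2 * of_real lam * flog (g t j k)) \<le> trunc_const * (\<tau> + (max hx hy)\<^sup>2)"
proof -
  define x y where "x = a + real j * hx" and "y = c + real k * hy"
  have jk: "1 \<le> j" "real j + 1 \<le> real J" "1 \<le> k" "real k + 1 \<le> real K" using j k by auto
  have "real J * hx = b - a" "real K * hy = d - c" using hx hy jk by auto
  moreover have "(real j + 1) * hx \<le> real J * hx" "1 * hx \<le> real j * hx"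
    "(real k + 1) * hy \<le> real K * hy" "1 * hy \<le> real k * hy"
    using jk h by (intro mult_right_mono; simp)+
  ultimately have bd: "a \<le> x - hx" "x + hx \<le> b" "c \<le> y - hy" "y + hy \<le> d"
    unfolding x_def y_def by (simp_all add: algebra_simps)
  have pts: "a + real (j + 1) * hx = x + hx" "a + real (j - 1) * hx = x - hx"
    "c + real (k + 1) * hy = y + hy" "c + real (k - 1) * hy = y - hy"
    using jk by (simp_all add: x_def y_def algebra_simps of_nat_diff)
  have "cmod (\<i> * ((g (t + \<tau>) j k - g t j k) / of_real \<tau>) + lap_h hx hy (g (t + \<tau>)) j k
      - 2 * of_real lam * flog (g t j k)) \<le> m1 * \<tau> + 2 * m2 * \<tau> + 2 * m3 * (hx\<^sup>2 + hy\<^sup>2)"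
    using consistency[OF t r \<tau> h bd] unfolding g_def lap_h_def pts x_def[symmetric] y_def[symmetric] .
  also have "\<dots> \<le> \<bar>m1\<bar> * \<tau> + 2 * \<bar>m2\<bar> * \<tau> + 2 * \<bar>m3\<bar> * (2 * (max hx hy)\<^sup>2)"
  proof (intro add_mono)
    have "hx\<^sup>2 \<le> (max hx hy)\<^sup>2" "hy\<^sup>2 \<le> (max hx hy)\<^sup>2" using h by (auto intro!: power_mono)
    then have sq: "hx\<^sup>2 + hy\<^sup>2 \<le> 2 * (max hx hy)\<^sup>2" by simp
    have "2 * m3 * (hx\<^sup>2 + hy\<^sup>2) \<le> 2 * \<bar>m3\<bar> * (hx\<^sup>2 + hy\<^sup>2)" by (rule mult_right_mono) auto
    also have "\<dots> \<le> 2 * \<bar>m3\<bar> * (2 * (max hx hy)\<^sup>2)" using sq by (rule mult_left_mono) auto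
    finally show "2 * m3 * (hx\<^sup>2 + hy\<^sup>2) \<le> 2 * \<bar>m3\<bar> * (2 * (max hx hy)\<^sup>2)" .
  qed (use \<tau> in \<open>auto intro!: mult_right_mono\<close>)
  also have "\<dots> \<le> trunc_const * (\<tau> + (max hx hy)\<^sup>2)"
    using \<tau> by (simp add: trunc_const_def algebra_simps)
  finally show ?thesis .
qed

lemma error_bound:
  fixes uh :: "nat \<Rightarrow> nat \<Rightarrow> nat \<Rightarrow> complex"
  assumes J: "0 < J" and K: "0 < K" and N: "0 < N"
    and hx: "hx = (b - a) / real J" and hy: "hy = (d - c) / real K" and \<tau>: "\<tau> = T / real N"
    and small: "\<tau> \<le> 1" "3 * \<tau> * (1 + m1)\<^sup>2 \<le> 1" "H1_const lam area trunc_const T * (\<tau> + (max hx hy)\<^sup>2)\<^sup>2 \<le> 1"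
    and scheme: "bdf1_solution lam a c J K N hx hy \<tau> u0 uh" and n: "n \<le> N"
  defines "e \<equiv> \<lambda>n j k. u (real n * \<tau>) (a + real j * hx, c + real k * hy) - uh n j k"
  shows "(norm_h J K hx hy (e n))\<^sup>2 \<le> L2_const lam area trunc_const T * (\<tau> + (max hx hy)\<^sup>2)\<^sup>2"
    and "\<tau> * (seminorm1_h J K hx hy (e n))\<^sup>2 \<le> H1_const lam area trunc_const T * (\<tau> + (max hx hy)\<^sup>2)\<^sup>2"
proof -
  have h: "hx > 0" "hy > 0" "\<tau> > 0" using ab cd T J K N by (auto simp: hx hy \<tau>)
  have JK: "J \<ge> 1" "K \<ge> 1" using J K by auto
  have NT: "real N * \<tau> = T" using N by (simp add: \<tau>)
  have time: "real n * \<tau> \<in> {0..T}" if "n \<le> N" for n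
  proof -
    have "real n * \<tau> \<le> real N * \<tau>" using that h by (intro mult_right_mono) auto
    then show ?thesis using h NT by simp
  qed
  have Jhx: "real J * hx = b - a" and Khy: "real K * hy = d - c" using J K by (auto simp: hx hy)
  have grid: "(a + real j * hx, c + real k * hy) \<in> {a..b} \<times> {c..d}" if "j \<le> J" "k \<le> K" for j k
  proof -
    have "real j * hx \<le> real J * hx" "real k * hy \<le> real K * hy" using that h by (intro mult_right_mono; simp)+
    then show ?thesis using h Jhx Khy by auto
  qed
  have X0e: "e n \<in> X0 J K" if "n \<le> N" for n
    unfolding X0_def
  proof (intro CollectI allI impI)
    fix j k assume jk: "j \<le> J" "k \<le> K"
    assume bdry: "j = 0 \<or> j = J \<or> k = 0 \<or> k = K"
    have "(a + real j * hx, c + real k * hy) \<notin> \<Omega>"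
      using bdry Jhx Khy unfolding \<Omega>_eq by auto
    then have "u (real n * \<tau>) (a + real j * hx, c + real k * hy) = 0"
      by (rule u_boundary[OF time[OF that] grid[OF jk]])
    moreover have "uh n j k = 0"
      using scheme that jk bdry unfolding bdf1_solution_def X0_def by blast
    ultimately show "e n j k = 0" by (simp add: e_def)
  qed
  define v where "v n j k = u (real n * \<tau>) (a + real j * hx, c + real k * hy)" for n j k
  define \<xi> where "\<xi> n j k = \<i> * ((v (Suc n) j k - v n j k) / of_real \<tau>) + lap_h hx hy (v (Suc n)) j k
      - 2 * of_real lam * flog (v n j k)" for n j k
  have pE: "\<tau> \<le> \<tau> + (max hx hy)\<^sup>2" by simp
  have pT: "real N * \<tau> \<le> T" by (simp add: NT)
  have pA: "(real J * hx) * (real K * hy) \<le> area" by (simp add: area_def measure_\<Omega> Jhx Khy)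
  have pB: "0 \<le> trunc_const" by (simp add: trunc_const_def)
  have pe: "e n j k = v n j k - uh n j k" for n j k by (simp add: e_def v_def)
  have pi: "e 0 j k = 0" if "j \<le> J" "k \<le> K" for j k
    using scheme that u_initial[OF grid[OF that]] unfolding bdf1_solution_def by (simp add: e_def)
  have pv: "cmod (v n j k) \<le> m1" if "n \<le> N" "j \<in> {1..<J}" "k \<in> {1..<K}" for n j k
    unfolding v_def
  proof (rule u_bounded[OF time[OF that(1)]])
    have "real j * hx < real J * hx" "real k * hy < real K * hy" using that h by (intro mult_strict_right_mono; simp)+
    moreover have "0 < real j * hx" "0 < real k * hy" using that h by auto
    ultimately show "(a + real j * hx, c + real k * hy) \<in> \<Omega>"
      using Jhx Khy unfolding \<Omega>_eq by simp
  qed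
  have peq: "\<i> * ((e (Suc n) j k - e n j k) / of_real \<tau>) + lap_h hx hy (e (Suc n)) j k
      = 2 * of_real lam * (flog (v n j k) - flog (uh n j k)) + \<xi> n j k"
    if "n < N" "j \<in> {1..<J}" "k \<in> {1..<K}" for n j k
  proof -
    have s: "\<i> * ((uh (Suc n) j k - uh n j k) / of_real \<tau>) + lap_h hx hy (uh (Suc n)) j k = 2 * of_real lam * flog (uh n j k)"
      using scheme that unfolding bdf1_solution_def by simp
    have l: "lap_h hx hy (e (Suc n)) j k = lap_h hx hy (v (Suc n)) j k - lap_h hx hy (uh (Suc n)) j k"
      by (simp add: lap_h_def e_def v_def diff_divide_distrib add_divide_distrib algebra_simps)
    have q: "\<i> * ((e (Suc n) j k - e n j k) / of_real \<tau>)
        = \<i> * ((v (Suc n) j k - v n j k) / of_real \<tau>) - \<i> * ((uh (Suc n) j k - uh n j k) / of_real \<tau>)"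
      by (simp add: e_def v_def diff_divide_distrib add_divide_distrib algebra_simps)
    have "2 * of_real lam * (flog (v n j k) - flog (uh n j k)) + \<xi> n j k
      = \<i> * ((v (Suc n) j k - v n j k) / of_real \<tau>) + lap_h hx hy (v (Suc n)) j k - 2 * of_real lam * flog (uh n j k)"
      by (simp add: \<xi>_def algebra_simps)
    then show ?thesis unfolding l q s[symmetric] by simp
  qed
  have pxi: "cmod (\<xi> n j k) \<le> trunc_const * (\<tau> + (max hx hy)\<^sup>2)" if "n < N" "j \<in> {1..<J}" "k \<in> {1..<K}" for n j k
  proof -
    have s: "real n * \<tau> + \<tau> = real (Suc n) * \<tau>" by (simp add: algebra_simps)
    have t: "real n * \<tau> \<in> {0..T}" "real n * \<tau> + \<tau> \<in> {0..T}"
      using time[of n] time[of "Suc n"] that(1) unfolding s by auto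
    from truncation_error[OF t h(3,1,2) that(2,3) hx hy]
    show ?thesis unfolding \<xi>_def v_def[abs_def] s by simp
  qed
  note stab = stability[where v = v and w = uh and e = e and N = N and \<xi> = \<xi>,
      OF JK h small pE pT pA pB X0e pe pi pv peq pxi n]
  show "(norm_h J K hx hy (e n))\<^sup>2 \<le> L2_const lam area trunc_const T * (\<tau> + (max hx hy)\<^sup>2)\<^sup>2"
    by (rule stab(1))
  show "\<tau> * (seminorm1_h J K hx hy (e n))\<^sup>2 \<le> H1_const lam area trunc_const T * (\<tau> + (max hx hy)\<^sup>2)\<^sup>2"
    by (rule stab(2))
qed

lemma convergence:
  "\<exists>h0>0. \<exists>\<tau>0>0. \<forall>(J::nat) (K::nat) (N::nat) (hx::real) (hy::real) (\<tau>::real) (h::real) uh Ce.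
    0 < J \<and> 0 < K \<and> 0 < N \<and> hx = (b - a) / real J \<and> hy = (d - c) / real K \<and> \<tau> = T / real N \<and>
    h = max hx hy \<and> h \<le> C * min hx hy \<and> h \<le> h0 \<and> \<tau> \<le> \<tau>0 \<and> bdf1_solution lam a c J K N hx hy \<tau> u0 uh \<and>
    Ce = error_const m1 m2 m3 \<bar>lam\<bar> area T \<longrightarrow>
    (\<forall>n\<le>N. let e = (\<lambda>j k. u (real n * \<tau>) (a + real j * hx, c + real k * hy) - uh n j k)
      in norm_h J K hx hy e \<le> Ce * (\<tau> + h\<^sup>2) \<and> seminorm1_h J K hx hy e \<le> Ce * \<tau> powr (-1/2) * (\<tau> + h\<^sup>2))"
proof -
  let ?W = "H1_const lam area trunc_const T" and ?Q = "L2_const lam area trunc_const T" and ?C = "error_const m1 m2 m3 \<bar>lam\<bar> area T"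
  have A0: "0 \<le> area" by (simp add: area_def)
  have Q0: "0 \<le> ?Q" using A0 T by (auto simp: L2_const_def intro!: mult_nonneg_nonneg)
  have W0: "0 \<le> ?W" using Q0 A0 by (simp add: H1_const_def)
  have C: "sqrt ?Q \<le> ?C" "sqrt ?W \<le> ?C"
    using Q0 W0 by (simp_all add: error_const_def abs_lam_consts trunc_const_def[symmetric])
  \<comment> \<open>with E = tau + h^2 this gives E at most 1 / (W + 1), hence W E^2 at most 1\<close>
  define h0 where "h0 = min 1 (1 / (2 * (?W + 1)))"
  define \<tau>0 where "\<tau>0 = min h0 (1 / (3 * ((1 + m1)\<^sup>2 + 1)))"
  have pos: "h0 > 0" "\<tau>0 > 0"
    using W0 by (auto simp: h0_def \<tau>0_def intro!: divide_pos_pos add_nonneg_pos mult_pos_pos)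
  show ?thesis
  proof (rule exI[of _ h0], rule conjI[OF pos(1)], rule exI[of _ \<tau>0], rule conjI[OF pos(2)],
      intro allI impI, elim conjE)
    fix J K N :: nat and hx hy \<tau> h Ce :: real and uh n
    assume as: "0 < J" "0 < K" "0 < N" "hx = (b - a) / real J" "hy = (d - c) / real K" "\<tau> = T / real N"
      and h: "h = max hx hy" "h \<le> h0" and \<tau>: "\<tau> \<le> \<tau>0" and scheme: "bdf1_solution lam a c J K N hx hy \<tau> u0 uh"
      and Ce: "Ce = ?C" and n: "n \<le> N"
    have h_pos: "h > 0" "\<tau> > 0" using as(1-3) ab cd T unfolding h as(4-6) by (auto simp: less_max_iff_disj)
    have small1: "\<tau> \<le> 1" using \<tau> by (simp add: \<tau>0_def h0_def)
    have small2: "3 * \<tau> * (1 + m1)\<^sup>2 \<le> 1"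
    proof -
      have "\<tau> \<le> 1 / (3 * ((1 + m1)\<^sup>2 + 1))" using \<tau> by (simp add: \<tau>0_def)
      then have "\<tau> * (3 * ((1 + m1)\<^sup>2 + 1)) \<le> 1"
        by (subst (asm) pos_le_divide_eq) (auto intro: add_nonneg_pos)
      then show ?thesis using h_pos by (simp add: algebra_simps)
    qed
    have small3: "?W * (\<tau> + h\<^sup>2)\<^sup>2 \<le> 1"
    proof -
      have hle: "h \<le> 1" "h \<le> 1 / (2 * (?W + 1))" "\<tau> \<le> 1 / (2 * (?W + 1))"
        using h \<tau> by (simp_all add: h0_def \<tau>0_def)
      have "h\<^sup>2 \<le> h" using hle(1) h_pos by (simp add: power2_eq_square mult_left_le)
      then have E: "\<tau> + h\<^sup>2 \<le> 1 / (2 * (?W + 1)) + 1 / (2 * (?W + 1))" using hle(2,3) by linarith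
      also have "\<dots> = 1 / (?W + 1)" using W0 by (simp add: field_simps)
      finally have E: "\<tau> + h\<^sup>2 \<le> 1 / (?W + 1)" .
      have "?W * (\<tau> + h\<^sup>2)\<^sup>2 \<le> (?W + 1) * (1 / (?W + 1))\<^sup>2"
        using E W0 h_pos by (intro mult_mono power_mono) auto
      also have "\<dots> = 1 / (?W + 1)" using W0 by (simp add: power2_eq_square)
      also have "\<dots> \<le> 1" using W0 by simp
      finally show ?thesis .
    qed
    let ?e = "\<lambda>j k. u (real n * \<tau>) (a + real j * hx, c + real k * hy) - uh n j k"
    note bd = error_bound[OF as small1 small2 small3[unfolded h(1)] scheme n, folded h(1)]
    have E0: "0 \<le> \<tau> + h\<^sup>2" using h_pos by simp
    have "norm_h J K hx hy ?e \<le> sqrt (?Q * (\<tau> + h\<^sup>2)\<^sup>2)"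
      by (rule real_le_rsqrt[OF bd(1)])
    also have "\<dots> = sqrt ?Q * (\<tau> + h\<^sup>2)" using E0 by (simp add: real_sqrt_mult)
    also have "\<dots> \<le> ?C * (\<tau> + h\<^sup>2)" using C(1) E0 by (rule mult_right_mono)
    finally have 1: "norm_h J K hx hy ?e \<le> ?C * (\<tau> + h\<^sup>2)" .
    have "(seminorm1_h J K hx hy ?e)\<^sup>2 \<le> ?W * (\<tau> + h\<^sup>2)\<^sup>2 / \<tau>"
      using bd(2) h_pos by (simp add: pos_le_divide_eq mult.commute)
    then have "seminorm1_h J K hx hy ?e \<le> sqrt (?W * (\<tau> + h\<^sup>2)\<^sup>2 / \<tau>)" by (rule real_le_rsqrt)
    also have "\<dots> = sqrt ?W * (\<tau> powr (-1/2) * (\<tau> + h\<^sup>2))"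
      using E0 h_pos by (simp add: real_sqrt_mult real_sqrt_divide powr_minus_divide powr_half_sqrt)
    also have "\<dots> \<le> ?C * (\<tau> powr (-1/2) * (\<tau> + h\<^sup>2))"
      using C(2) E0 by (intro mult_right_mono mult_nonneg_nonneg) auto
    finally have 2: "seminorm1_h J K hx hy ?e \<le> ?C * \<tau> powr (-1/2) * (\<tau> + h\<^sup>2)" by (simp add: mult.assoc)
    show "let e = ?e in norm_h J K hx hy e \<le> Ce * (\<tau> + h\<^sup>2) \<and> seminorm1_h J K hx hy e \<le> Ce * \<tau> powr (-1/2) * (\<tau> + h\<^sup>2)"
      unfolding Let_def Ce using 1 2 by blast
  qed
qed

end

theorem theorem3p1:
  shows "\<exists>Cu :: real \<Rightarrow> real \<Rightarrow> real \<Rightarrow> real \<Rightarrow> real \<Rightarrow> real \<Rightarrow> real.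
    (\<forall>m1 m2 m3 l A S. 0 < Cu m1 m2 m3 l A S) \<and>
    (\<forall>(a::real) (b::real) (c::real) (d::real) (lam::real) (T::real) (C::real)
       (u0 :: real \<times> real \<Rightarrow> complex) (u :: real \<Rightarrow> real \<times> real \<Rightarrow> complex) \<Omega> X.
       a < b \<and> c < d \<and> \<Omega> = {a<..<b} \<times> {c<..<d} \<and> lam \<noteq> 0 \<and>
       0 < T \<and> ereal T < max_existence_time \<Omega> lam u0 \<and>
       log_schroedinger_solution \<Omega> lam u0 T u \<and>
       X = inter_space (Sobolev \<Omega> 4 \<infinity>) (H10 \<Omega>) \<and>
       C_time 2 T (Lp \<Omega> \<infinity>) u \<and> C_time 1 T (Sobolev \<Omega> 2 \<infinity>) u \<and> C_time 0 T X u \<longrightarrow>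
       (\<exists>h0>0. \<exists>\<tau>0>0. \<forall>(J::nat) (K::nat) (N::nat) (hx::real) (hy::real) (\<tau>::real) (h::real) uh Ce.
          0 < J \<and> 0 < K \<and> 0 < N \<and>
          hx = (b - a) / real J \<and> hy = (d - c) / real K \<and> \<tau> = T / real N \<and>
          h = max hx hy \<and> h \<le> C * min hx hy \<and> h \<le> h0 \<and> \<tau> \<le> \<tau>0 \<and>
          bdf1_solution lam a c J K N hx hy \<tau> u0 uh \<and>
          Ce = Cu (C_time_norm 2 T (Lp \<Omega> \<infinity>) u) (C_time_norm 1 T (Sobolev \<Omega> 2 \<infinity>) u)
                  (C_time_norm 0 T X u) \<bar>lam\<bar> (measure lebesgue \<Omega>) T \<longrightarrow>
          (\<forall>n\<le>N.
             let e = (\<lambda>j k. u (real n * \<tau>) (a + real j * hx, c + real k * hy) - uh n j k)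
             in norm_h J K hx hy e \<le> Ce * (\<tau> + h\<^sup>2) \<and>
                seminorm1_h J K hx hy e \<le> Ce * \<tau> powr (-1/2) * (\<tau> + h\<^sup>2))))"
proof (rule exI[of _ error_const], intro conjI allI impI, goal_cases)
  case 1
  show ?case by (rule error_const_pos)
next
  case (2 a b c d lam T C u0 u \<Omega> X)
  interpret smooth_solution a b c d \<Omega> T lam u0 u X
    by unfold_locales (use 2 in auto)
  show ?case by (rule convergence[unfolded m1_def m2_def m3_def area_def])
qed

end
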